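(* Let $F\dashv G:\mathscr{L}\to\mathscr{X}$ be a symmetric monoidal adjunction between closed symmetric monoidal categories, with $\mathscr{L}$ finitely well-complete. Then the accessible distribution monad $\widetilde{\mathbb{D}}$ is a commutative $\mathscr{X}$-monad on $\underline{\mathscr{X}}$.
   Context: Setting. $\mathscr{X}=(\mathscr{X},\boxtimes,I)$ and $\mathscr{L}=(\mathscr{L},\otimes,R)$ are closed symmetric monoidal categories, and $F\dashv G:\mathscr{L}\to\mathscr{X}$ (unit $\eta$, counit $\varepsilon$) is an adjunction in the 2-category of symmetric monoidal categories, (lax) symmetric monoidal functors and monoidal transformations. $\underline{\mathscr{X}},\underline{\mathscr{L}}$ denote $\mathscr{X},\mathscr{L}$ regarded as categories enriched in themselves. $G_*$ is change of base along $G$: an $\mathscr{L}$-category $\mathscr{A}$ is sent to the $\mathscr{X}$-category $G_*\mathscr{A}$ with the same objects and $(G_*\mathscr{A})(A,B)=G(\mathscr{A}(A,B))$. The underlying ordinary category of $G_*\underline{\mathscr{L}}$ is identified with $\mathscr{L}$. $G$ carries the structure of an $\mathscr{X}$-functor $G_*\underline{\mathscr{L}}\to\underline{\mathscr{X}}$, with structure morphisms $G\underline{\mathscr{L}}(E,E')\to\underline{\mathscr{X}}(GE,GE')$ the transposes of $GE\boxtimes G\underline{\mathscr{L}}(E,E')\to G(E\otimes\underline{\mathscr{L}}(E,E'))\to GE'$, and $F\dashv G$ thereby underlies an $\mathscr{X}$-adjunction $F\dashv G:G_*\underline{\mathscr{L}}\to\underline{\mathscr{X}}$ with the same unit and counit.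 For an $\mathscr{X}$-monad $\mathbb{M}=(M,e,m)$ on $G_*\underline{\mathscr{L}}$, $[F,G](\mathbb{M})$ denotes the $\mathscr{X}$-monad on $\underline{\mathscr{X}}$ with endofunctor $GMF$, unit $(GeF)\cdot\eta$ and multiplication $(GmF)\cdot(GM\varepsilon MF)$. Finitely well-complete: having finite limits and intersections (fibre products) of arbitrary class-indexed families of strong monomorphisms with common codomain. Functional completeness. $E^*:=\underline{\mathscr{L}}(E,R)$. An object $E\in\mathscr{L}$ is functionally complete if for every $h:E_1\to E_2$ in $\mathscr{L}$ such that $h^{**}:E_1^{**}\to E_2^{**}$ is an isomorphism, $\underline{\mathscr{L}}(h,E):\underline{\mathscr{L}}(E_2,E)\to\underline{\mathscr{L}}(E_1,E)$ is an isomorphism. When $\mathscr{L}$ is finitely well-complete, the functionally complete objects form an $\mathscr{L}$-reflective subcategory of $\underline{\mathscr{L}}$; $\widetilde{\mathbb{H}}$ denotes the associated idempotent $\mathscr{L}$-monad on $\underline{\mathscr{L}}$. The accessible distribution monad is $\widetilde{\mathbb{D}}:=[F,G](G_*\widetilde{\mathbb{H}})$, so $\widetilde{D}X=G\widetilde{H}FX$. Commutative monads. For an $\mathscr{X}$-monad $\mathbb{T}=(T,\eta,\mu)$ on $\underline{\mathscr{X}}$ and $X,Y\in\mathscr{X}$, let $t'_{XY}:TX\boxtimes Y\to T(X\boxtimes Y)$ be the transpose of $Y\to\underline{\mathscr{X}}(X,X\boxtimes Y)\xrightarrow{T}\underline{\mathscr{X}}(TX,T(X\boxtimes Y))$ and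 $t''_{XY}:X\boxtimes TY\to T(X\boxtimes Y)$ the transpose of $X\to\underline{\mathscr{X}}(Y,X\boxtimes Y)\xrightarrow{T}\underline{\mathscr{X}}(TY,T(X\boxtimes Y))$. Put $\otimes_{XY}:=\mu\cdot Tt'_{XY}\cdot t''_{TX,Y}$ and $\widetilde{\otimes}_{XY}:=\mu\cdot Tt''_{XY}\cdot t'_{X,TY}$, both morphisms $TX\boxtimes TY\to T(X\boxtimes Y)$. $\mathbb{T}$ is commutative if $\otimes_{XY}=\widetilde{\otimes}_{XY}$ for all $X,Y\in\mathscr{X}$. *)

theory Defs
  imports Main
begin

section \<open>Categories, limits and strong monomorphisms\<close>

text \<open>
  A category has a type \<open>'o\<close> of objects and a type \<open>'a\<close> of arrows; only composition is partial,
  and \<open>g \<cdot> f\<close> is unconstrained unless the target of \<open>f\<close> is the source of \<open>g\<close>.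
\<close>

record ('o, 'a) cat =
  src :: "'a \<Rightarrow> 'o"
  tgt :: "'a \<Rightarrow> 'o"
  idn :: "'o \<Rightarrow> 'a"
  cmp :: "'a \<Rightarrow> 'a \<Rightarrow> 'a"  (infixl "\<cdot>\<index>" 55)

definition in_hom :: "('o, 'a, 'm) cat_scheme \<Rightarrow> 'a \<Rightarrow> 'o \<Rightarrow> 'o \<Rightarrow> bool"
    ("\<guillemotleft>_ : _ \<rightarrow> _\<guillemotright>\<index>")
  where "in_hom C f A B \<longleftrightarrow> src C f = A \<and> tgt C f = B"

locale category =
  fixes C :: "('o, 'a, 'm) cat_scheme" (structure)
  assumes idn_in_hom: "\<guillemotleft>idn C A : A \<rightarrow> A\<guillemotright>"
    and cmp_in_hom: "\<lbrakk>\<guillemotleft>f : A \<rightarrow> B\<guillemotright>; \<guillemotleft>g : B \<rightarrow> D\<guillemotright>\<rbrakk> \<Longrightarrow> \<guillemotleft>g \<cdot> f : A \<rightarrow> D\<guillemotright>"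
    and cmp_idn_left: "\<guillemotleft>f : A \<rightarrow> B\<guillemotright> \<Longrightarrow> idn C B \<cdot> f = f"
    and cmp_idn_right: "\<guillemotleft>f : A \<rightarrow> B\<guillemotright> \<Longrightarrow> f \<cdot> idn C A = f"
    and cmp_assoc: "\<lbrakk>\<guillemotleft>f : A \<rightarrow> B\<guillemotright>; \<guillemotleft>g : B \<rightarrow> D\<guillemotright>; \<guillemotleft>h : D \<rightarrow> E\<guillemotright>\<rbrakk>
      \<Longrightarrow> (h \<cdot> g) \<cdot> f = h \<cdot> (g \<cdot> f)"

definition inverses :: "('o, 'a, 'm) cat_scheme \<Rightarrow> 'a \<Rightarrow> 'a \<Rightarrow> bool"
  where "inverses C f g \<longleftrightarrow> (\<exists>A B. \<guillemotleft>f : A \<rightarrow> B\<guillemotright>\<^bsub>C\<^esub> \<and> \<guillemotleft>g : B \<rightarrow> A\<guillemotright>\<^bsub>C\<^esub>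
    \<and> g \<cdot>\<^bsub>C\<^esub> f = idn C A \<and> f \<cdot>\<^bsub>C\<^esub> g = idn C B)"

definition iso :: "('o, 'a, 'm) cat_scheme \<Rightarrow> 'a \<Rightarrow> bool"
  where "iso C f \<longleftrightarrow> (\<exists>g. inverses C f g)"

definition inverse_arrow :: "('o, 'a, 'm) cat_scheme \<Rightarrow> 'a \<Rightarrow> 'a"
  where "inverse_arrow C f = (THE g. inverses C f g)"

definition mono_arrow :: "('o, 'a, 'm) cat_scheme \<Rightarrow> 'a \<Rightarrow> bool"
  where "mono_arrow C m \<longleftrightarrow> (\<forall>Q u v. \<guillemotleft>u : Q \<rightarrow> src C m\<guillemotright>\<^bsub>C\<^esub> \<and> \<guillemotleft>v : Q \<rightarrow> src C m\<guillemotright>\<^bsub>C\<^esub>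
    \<and> m \<cdot>\<^bsub>C\<^esub> u = m \<cdot>\<^bsub>C\<^esub> v \<longrightarrow> u = v)"

definition epi_arrow :: "('o, 'a, 'm) cat_scheme \<Rightarrow> 'a \<Rightarrow> bool"
  where "epi_arrow C e \<longleftrightarrow> (\<forall>Q u v. \<guillemotleft>u : tgt C e \<rightarrow> Q\<guillemotright>\<^bsub>C\<^esub> \<and> \<guillemotleft>v : tgt C e \<rightarrow> Q\<guillemotright>\<^bsub>C\<^esub>
    \<and> u \<cdot>\<^bsub>C\<^esub> e = v \<cdot>\<^bsub>C\<^esub> e \<longrightarrow> u = v)"

definition strong_mono :: "('o, 'a, 'm) cat_scheme \<Rightarrow> 'a \<Rightarrow> bool"
  where "strong_mono C m \<longleftrightarrow> mono_arrow C m \<and>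
    (\<forall>e u v. epi_arrow C e \<and> \<guillemotleft>u : src C e \<rightarrow> src C m\<guillemotright>\<^bsub>C\<^esub> \<and> \<guillemotleft>v : tgt C e \<rightarrow> tgt C m\<guillemotright>\<^bsub>C\<^esub>
        \<and> m \<cdot>\<^bsub>C\<^esub> u = v \<cdot>\<^bsub>C\<^esub> e
      \<longrightarrow> (\<exists>!w. \<guillemotleft>w : tgt C e \<rightarrow> src C m\<guillemotright>\<^bsub>C\<^esub> \<and> w \<cdot>\<^bsub>C\<^esub> e = u \<and> m \<cdot>\<^bsub>C\<^esub> w = v))"

text \<open>
  Every finite category is isomorphic to one whose objects and arrows form finite sets \<open>Ob\<close> and
  \<open>Ar\<close> of natural numbers, so it suffices to consider diagrams of such shapes.
\<close>

definition finite_shape :: "(nat, nat) cat \<Rightarrow> nat set \<Rightarrow> nat set \<Rightarrow> bool"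
  where "finite_shape J Ob Ar \<longleftrightarrow> finite Ob \<and> finite Ar
    \<and> (\<forall>f\<in>Ar. src J f \<in> Ob \<and> tgt J f \<in> Ob)
    \<and> (\<forall>i\<in>Ob. idn J i \<in> Ar \<and> \<guillemotleft>idn J i : i \<rightarrow> i\<guillemotright>\<^bsub>J\<^esub>)
    \<and> (\<forall>f\<in>Ar. \<forall>g\<in>Ar. src J g = tgt J f \<longrightarrow>
          g \<cdot>\<^bsub>J\<^esub> f \<in> Ar \<and> \<guillemotleft>g \<cdot>\<^bsub>J\<^esub> f : src J f \<rightarrow> tgt J g\<guillemotright>\<^bsub>J\<^esub>)
    \<and> (\<forall>f\<in>Ar. idn J (tgt J f) \<cdot>\<^bsub>J\<^esub> f = f \<and> f \<cdot>\<^bsub>J\<^esub> idn J (src J f) = f)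
    \<and> (\<forall>f\<in>Ar. \<forall>g\<in>Ar. \<forall>h\<in>Ar. src J g = tgt J f \<and> src J h = tgt J g \<longrightarrow>
          (h \<cdot>\<^bsub>J\<^esub> g) \<cdot>\<^bsub>J\<^esub> f = h \<cdot>\<^bsub>J\<^esub> (g \<cdot>\<^bsub>J\<^esub> f))"

definition diagram :: "(nat, nat) cat \<Rightarrow> nat set \<Rightarrow> nat set \<Rightarrow> ('o, 'a, 'm) cat_scheme
    \<Rightarrow> (nat \<Rightarrow> 'o) \<Rightarrow> (nat \<Rightarrow> 'a) \<Rightarrow> bool"
  where "diagram J Ob Ar C D d \<longleftrightarrow>
    (\<forall>f\<in>Ar. \<guillemotleft>d f : D (src J f) \<rightarrow> D (tgt J f)\<guillemotright>\<^bsub>C\<^esub>)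
    \<and> (\<forall>i\<in>Ob. d (idn J i) = idn C (D i))
    \<and> (\<forall>f\<in>Ar. \<forall>g\<in>Ar. src J g = tgt J f \<longrightarrow> d (g \<cdot>\<^bsub>J\<^esub> f) = d g \<cdot>\<^bsub>C\<^esub> d f)"

definition cone :: "(nat, nat) cat \<Rightarrow> nat set \<Rightarrow> nat set \<Rightarrow> ('o, 'a, 'm) cat_scheme
    \<Rightarrow> (nat \<Rightarrow> 'o) \<Rightarrow> (nat \<Rightarrow> 'a) \<Rightarrow> 'o \<Rightarrow> (nat \<Rightarrow> 'a) \<Rightarrow> bool"
  where "cone J Ob Ar C D d P p \<longleftrightarrow> (\<forall>i\<in>Ob. \<guillemotleft>p i : P \<rightarrow> D i\<guillemotright>\<^bsub>C\<^esub>)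
    \<and> (\<forall>f\<in>Ar. d f \<cdot>\<^bsub>C\<^esub> p (src J f) = p (tgt J f))"

definition has_finite_limits :: "('o, 'a, 'm) cat_scheme \<Rightarrow> bool"
  where "has_finite_limits C \<longleftrightarrow> (\<forall>J Ob Ar D d. finite_shape J Ob Ar \<and> diagram J Ob Ar C D d \<longrightarrow>
    (\<exists>P p. cone J Ob Ar C D d P p \<and> (\<forall>Q q. cone J Ob Ar C D d Q q \<longrightarrow>
      (\<exists>!u. \<guillemotleft>u : Q \<rightarrow> P\<guillemotright>\<^bsub>C\<^esub> \<and> (\<forall>i\<in>Ob. p i \<cdot>\<^bsub>C\<^esub> u = q i)))))"

text \<open>
  A fibre product over \<open>B\<close> of a family of monomorphisms depends only on the set of members of the
  family, so families are given as sets \<open>S\<close> of arrows; \<open>p m\<close> is the projection to the source of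
  \<open>m\<close> and \<open>b\<close> is the common composite into \<open>B\<close>.
\<close>

definition fibre_product_cone :: "('o, 'a, 'm) cat_scheme \<Rightarrow> 'o \<Rightarrow> 'a set \<Rightarrow> 'o \<Rightarrow> 'a \<Rightarrow> ('a \<Rightarrow> 'a) \<Rightarrow> bool"
  where "fibre_product_cone C B S P b p \<longleftrightarrow> \<guillemotleft>b : P \<rightarrow> B\<guillemotright>\<^bsub>C\<^esub>
    \<and> (\<forall>m\<in>S. \<guillemotleft>p m : P \<rightarrow> src C m\<guillemotright>\<^bsub>C\<^esub> \<and> m \<cdot>\<^bsub>C\<^esub> p m = b)"

definition has_strong_intersections :: "('o, 'a, 'm) cat_scheme \<Rightarrow> bool"
  where "has_strong_intersections C \<longleftrightarrow> (\<forall>B S. (\<forall>m\<in>S. strong_mono C m \<and> tgt C m = B) \<longrightarrow>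
    (\<exists>P b p. fibre_product_cone C B S P b p \<and> (\<forall>Q c q. fibre_product_cone C B S Q c q \<longrightarrow>
      (\<exists>!u. \<guillemotleft>u : Q \<rightarrow> P\<guillemotright>\<^bsub>C\<^esub> \<and> b \<cdot>\<^bsub>C\<^esub> u = c \<and> (\<forall>m\<in>S. p m \<cdot>\<^bsub>C\<^esub> u = q m)))))"

definition finitely_well_complete :: "('o, 'a, 'm) cat_scheme \<Rightarrow> bool"
  where "finitely_well_complete C \<longleftrightarrow> has_finite_limits C \<and> has_strong_intersections C"

section \<open>Closed symmetric monoidal categories\<close>

text \<open>
  \<open>\<otimes>\<close> is the tensor product of objects, \<open>\<odot>\<close> that of arrows.  The constraints go
  \<open>asc A B D : (A \<otimes> B) \<otimes> D \<rightarrow> A \<otimes> (B \<otimes> D)\<close>, \<open>lun A : \<one> \<otimes> A \<rightarrow> A\<close>, \<open>run A : A \<otimes> \<one> \<rightarrow> A\<close> and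
  \<open>sym A B : A \<otimes> B \<rightarrow> B \<otimes> A\<close>.
\<close>

record ('o, 'a) smcat = "('o, 'a) cat" +
  tob :: "'o \<Rightarrow> 'o \<Rightarrow> 'o"  (infixr "\<otimes>\<index>" 70)
  tar :: "'a \<Rightarrow> 'a \<Rightarrow> 'a"  (infixr "\<odot>\<index>" 70)
  unt :: "'o"  ("\<one>\<index>")
  asc :: "'o \<Rightarrow> 'o \<Rightarrow> 'o \<Rightarrow> 'a"
  lun :: "'o \<Rightarrow> 'a"
  run :: "'o \<Rightarrow> 'a"
  sym :: "'o \<Rightarrow> 'o \<Rightarrow> 'a"

locale symmetric_monoidal_category = category V
  for V :: "('o, 'a, 'm) smcat_scheme" (structure) +
  assumes tar_in_hom: "\<lbrakk>\<guillemotleft>f : A \<rightarrow> B\<guillemotright>; \<guillemotleft>g : D \<rightarrow> E\<guillemotright>\<rbrakk> \<Longrightarrow> \<guillemotleft>f \<odot> g : A \<otimes> D \<rightarrow> B \<otimes> E\<guillemotright>"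
    and tar_idn: "idn V A \<odot> idn V B = idn V (A \<otimes> B)"
    and tar_cmp: "\<lbrakk>\<guillemotleft>f : A \<rightarrow> B\<guillemotright>; \<guillemotleft>f' : B \<rightarrow> D\<guillemotright>; \<guillemotleft>g : A' \<rightarrow> B'\<guillemotright>; \<guillemotleft>g' : B' \<rightarrow> D'\<guillemotright>\<rbrakk>
      \<Longrightarrow> (f' \<cdot> f) \<odot> (g' \<cdot> g) = (f' \<odot> g') \<cdot> (f \<odot> g)"
    and asc_in_hom: "\<guillemotleft>asc V A B D : (A \<otimes> B) \<otimes> D \<rightarrow> A \<otimes> (B \<otimes> D)\<guillemotright>"
    and asc_iso: "iso V (asc V A B D)"
    and asc_natural: "\<lbrakk>\<guillemotleft>f : A \<rightarrow> A'\<guillemotright>; \<guillemotleft>g : B \<rightarrow> B'\<guillemotright>; \<guillemotleft>h : D \<rightarrow> D'\<guillemotright>\<rbrakk>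
      \<Longrightarrow> asc V A' B' D' \<cdot> ((f \<odot> g) \<odot> h) = (f \<odot> (g \<odot> h)) \<cdot> asc V A B D"
    and lun_in_hom: "\<guillemotleft>lun V A : \<one> \<otimes> A \<rightarrow> A\<guillemotright>"
    and lun_iso: "iso V (lun V A)"
    and lun_natural: "\<guillemotleft>f : A \<rightarrow> B\<guillemotright> \<Longrightarrow> lun V B \<cdot> (idn V \<one> \<odot> f) = f \<cdot> lun V A"
    and run_in_hom: "\<guillemotleft>run V A : A \<otimes> \<one> \<rightarrow> A\<guillemotright>"
    and run_iso: "iso V (run V A)"
    and run_natural: "\<guillemotleft>f : A \<rightarrow> B\<guillemotright> \<Longrightarrow> run V B \<cdot> (f \<odot> idn V \<one>) = f \<cdot> run V A"
    and sym_in_hom: "\<guillemotleft>sym V A B : A \<otimes> B \<rightarrow> B \<otimes> A\<guillemotright>"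
    and sym_natural: "\<lbrakk>\<guillemotleft>f : A \<rightarrow> A'\<guillemotright>; \<guillemotleft>g : B \<rightarrow> B'\<guillemotright>\<rbrakk>
      \<Longrightarrow> sym V A' B' \<cdot> (f \<odot> g) = (g \<odot> f) \<cdot> sym V A B"
    and sym_sym: "sym V B A \<cdot> sym V A B = idn V (A \<otimes> B)"
    and pentagon: "asc V A B (D \<otimes> E) \<cdot> asc V (A \<otimes> B) D E
      = (idn V A \<odot> asc V B D E) \<cdot> asc V A (B \<otimes> D) E \<cdot> (asc V A B D \<odot> idn V E)"
    and triangle: "(idn V A \<odot> lun V B) \<cdot> asc V A \<one> B = run V A \<odot> idn V B"
    and hexagon: "asc V B D A \<cdot> sym V A (B \<otimes> D) \<cdot> asc V A B D
      = (idn V B \<odot> sym V A D) \<cdot> asc V B A D \<cdot> (sym V A B \<odot> idn V D)"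

text \<open>
  \<open>ihom A\<close> is right adjoint to \<open>A \<otimes> -\<close> with counit \<open>ev A B : A \<otimes> ihom A B \<rightarrow> B\<close>.
\<close>

record ('o, 'a) csmcat = "('o, 'a) smcat" +
  ihom :: "'o \<Rightarrow> 'o \<Rightarrow> 'o"
  ev :: "'o \<Rightarrow> 'o \<Rightarrow> 'a"

locale closed_symmetric_monoidal_category = symmetric_monoidal_category V
  for V :: "('o, 'a, 'm) csmcat_scheme" (structure) +
  assumes ev_in_hom: "\<guillemotleft>ev V A B : A \<otimes> ihom V A B \<rightarrow> B\<guillemotright>"
    and ev_universal: "\<guillemotleft>f : A \<otimes> D \<rightarrow> B\<guillemotright>
      \<Longrightarrow> \<exists>!g. \<guillemotleft>g : D \<rightarrow> ihom V A B\<guillemotright> \<and> ev V A B \<cdot> (idn V A \<odot> g) = f"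

text \<open>\<open>transpose V A D B f : D \<rightarrow> ihom A B\<close> for \<open>f : A \<otimes> D \<rightarrow> B\<close>, and its inverse operation.\<close>

definition transpose :: "('o, 'a, 'm) csmcat_scheme \<Rightarrow> 'o \<Rightarrow> 'o \<Rightarrow> 'o \<Rightarrow> 'a \<Rightarrow> 'a"
  where "transpose V A D B f =
    (THE g. \<guillemotleft>g : D \<rightarrow> ihom V A B\<guillemotright>\<^bsub>V\<^esub> \<and> ev V A B \<cdot>\<^bsub>V\<^esub> (idn V A \<odot>\<^bsub>V\<^esub> g) = f)"

definition untranspose :: "('o, 'a, 'm) csmcat_scheme \<Rightarrow> 'o \<Rightarrow> 'o \<Rightarrow> 'a \<Rightarrow> 'a"
  where "untranspose V A B g = ev V A B \<cdot>\<^bsub>V\<^esub> (idn V A \<odot>\<^bsub>V\<^esub> g)"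

text \<open>\<open>ihom_pre V h B : ihom E' B \<rightarrow> ihom E B\<close> is precomposition with \<open>h : E \<rightarrow> E'\<close>.\<close>

definition ihom_pre :: "('o, 'a, 'm) csmcat_scheme \<Rightarrow> 'a \<Rightarrow> 'o \<Rightarrow> 'a"
  where "ihom_pre V h B = transpose V (src V h) (ihom V (tgt V h) B) B
    (ev V (tgt V h) B \<cdot>\<^bsub>V\<^esub> (h \<odot>\<^bsub>V\<^esub> idn V (ihom V (tgt V h) B)))"

definition functionally_complete :: "('o, 'a, 'm) csmcat_scheme \<Rightarrow> 'o \<Rightarrow> bool"
  where "functionally_complete V E \<longleftrightarrow>
    (\<forall>h. iso V (ihom_pre V (ihom_pre V h \<one>\<^bsub>V\<^esub>) \<one>\<^bsub>V\<^esub>) \<longrightarrow> iso V (ihom_pre V h E))"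

section \<open>Symmetric monoidal adjunctions\<close>

text \<open>
  Symmetric monoidal functors are lax, with structure morphisms \<open>phi0 F : \<one> \<rightarrow> F \<one>\<close> and
  \<open>phi2 F A B : F A \<otimes> F B \<rightarrow> F (A \<otimes> B)\<close>.
\<close>

record ('o, 'a, 'p, 'b) smfun =
  fob :: "'o \<Rightarrow> 'p"
  far :: "'a \<Rightarrow> 'b"
  phi0 :: "'b"
  phi2 :: "'o \<Rightarrow> 'o \<Rightarrow> 'b"

locale symmetric_monoidal_functor =
  C: symmetric_monoidal_category C + D: symmetric_monoidal_category D
  for C :: "('o, 'a, 'm) smcat_scheme" and D :: "('p, 'b, 'n) smcat_scheme" +
  fixes F :: "('o, 'a, 'p, 'b) smfun"
  assumes far_in_hom: "\<guillemotleft>f : A \<rightarrow> B\<guillemotright>\<^bsub>C\<^esub> \<Longrightarrow> \<guillemotleft>far F f : fob F A \<rightarrow> fob F B\<guillemotright>\<^bsub>D\<^esub>"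
    and far_idn: "far F (idn C A) = idn D (fob F A)"
    and far_cmp: "\<lbrakk>\<guillemotleft>f : A \<rightarrow> B\<guillemotright>\<^bsub>C\<^esub>; \<guillemotleft>g : B \<rightarrow> E\<guillemotright>\<^bsub>C\<^esub>\<rbrakk> \<Longrightarrow> far F (g \<cdot>\<^bsub>C\<^esub> f) = far F g \<cdot>\<^bsub>D\<^esub> far F f"
    and phi0_in_hom: "\<guillemotleft>phi0 F : \<one>\<^bsub>D\<^esub> \<rightarrow> fob F \<one>\<^bsub>C\<^esub>\<guillemotright>\<^bsub>D\<^esub>"
    and phi2_in_hom: "\<guillemotleft>phi2 F A B : fob F A \<otimes>\<^bsub>D\<^esub> fob F B \<rightarrow> fob F (A \<otimes>\<^bsub>C\<^esub> B)\<guillemotright>\<^bsub>D\<^esub>"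
    and phi2_natural: "\<lbrakk>\<guillemotleft>f : A \<rightarrow> A'\<guillemotright>\<^bsub>C\<^esub>; \<guillemotleft>g : B \<rightarrow> B'\<guillemotright>\<^bsub>C\<^esub>\<rbrakk>
      \<Longrightarrow> phi2 F A' B' \<cdot>\<^bsub>D\<^esub> (far F f \<odot>\<^bsub>D\<^esub> far F g) = far F (f \<odot>\<^bsub>C\<^esub> g) \<cdot>\<^bsub>D\<^esub> phi2 F A B"
    and phi_asc: "far F (asc C A B E) \<cdot>\<^bsub>D\<^esub> phi2 F (A \<otimes>\<^bsub>C\<^esub> B) E
        \<cdot>\<^bsub>D\<^esub> (phi2 F A B \<odot>\<^bsub>D\<^esub> idn D (fob F E))
      = phi2 F A (B \<otimes>\<^bsub>C\<^esub> E) \<cdot>\<^bsub>D\<^esub> (idn D (fob F A) \<odot>\<^bsub>D\<^esub> phi2 F B E)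
        \<cdot>\<^bsub>D\<^esub> asc D (fob F A) (fob F B) (fob F E)"
    and phi_lun: "far F (lun C A) \<cdot>\<^bsub>D\<^esub> phi2 F \<one>\<^bsub>C\<^esub> A \<cdot>\<^bsub>D\<^esub> (phi0 F \<odot>\<^bsub>D\<^esub> idn D (fob F A)) = lun D (fob F A)"
    and phi_run: "far F (run C A) \<cdot>\<^bsub>D\<^esub> phi2 F A \<one>\<^bsub>C\<^esub> \<cdot>\<^bsub>D\<^esub> (idn D (fob F A) \<odot>\<^bsub>D\<^esub> phi0 F) = run D (fob F A)"
    and phi_sym: "far F (sym C A B) \<cdot>\<^bsub>D\<^esub> phi2 F A B = phi2 F B A \<cdot>\<^bsub>D\<^esub> sym D (fob F A) (fob F B)"

definition smfun_id :: "('o, 'a, 'm) smcat_scheme \<Rightarrow> ('o, 'a, 'o, 'a) smfun"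
  where "smfun_id C = \<lparr>fob = (\<lambda>A. A), far = (\<lambda>f. f), phi0 = idn C \<one>\<^bsub>C\<^esub>,
    phi2 = (\<lambda>A B. idn C (A \<otimes>\<^bsub>C\<^esub> B))\<rparr>"

definition smfun_comp :: "('q, 'c, 'k) smcat_scheme \<Rightarrow> ('p, 'b, 'q, 'c) smfun \<Rightarrow> ('o, 'a, 'p, 'b) smfun
    \<Rightarrow> ('o, 'a, 'q, 'c) smfun"
  where "smfun_comp E G F = \<lparr>fob = (\<lambda>A. fob G (fob F A)), far = (\<lambda>f. far G (far F f)),
    phi0 = far G (phi0 F) \<cdot>\<^bsub>E\<^esub> phi0 G,
    phi2 = (\<lambda>A B. far G (phi2 F A B) \<cdot>\<^bsub>E\<^esub> phi2 G (fob F A) (fob F B))\<rparr>"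

locale monoidal_transformation =
  F: symmetric_monoidal_functor C D F + G: symmetric_monoidal_functor C D G
  for C :: "('o, 'a, 'm) smcat_scheme" and D :: "('p, 'b, 'n) smcat_scheme"
    and F :: "('o, 'a, 'p, 'b) smfun" and G :: "('o, 'a, 'p, 'b) smfun" +
  fixes t :: "'o \<Rightarrow> 'b"
  assumes t_in_hom: "\<guillemotleft>t A : fob F A \<rightarrow> fob G A\<guillemotright>\<^bsub>D\<^esub>"
    and t_natural: "\<guillemotleft>f : A \<rightarrow> B\<guillemotright>\<^bsub>C\<^esub> \<Longrightarrow> t B \<cdot>\<^bsub>D\<^esub> far F f = far G f \<cdot>\<^bsub>D\<^esub> t A"
    and t_phi0: "t \<one>\<^bsub>C\<^esub> \<cdot>\<^bsub>D\<^esub> phi0 F = phi0 G"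
    and t_phi2: "t (A \<otimes>\<^bsub>C\<^esub> B) \<cdot>\<^bsub>D\<^esub> phi2 F A B = phi2 G A B \<cdot>\<^bsub>D\<^esub> (t A \<odot>\<^bsub>D\<^esub> t B)"

locale symmetric_monoidal_adjunction =
  F: symmetric_monoidal_functor X L F + G: symmetric_monoidal_functor L X G
  + unit: monoidal_transformation X X "smfun_id X" "smfun_comp X G F" \<eta>
  + counit: monoidal_transformation L L "smfun_comp L F G" "smfun_id L" \<epsilon>
  for X :: "('x, 'a, 'm) smcat_scheme" and L :: "('l, 'b, 'n) smcat_scheme"
    and F :: "('x, 'a, 'l, 'b) smfun" and G :: "('l, 'b, 'x, 'a) smfun"
    and \<eta> :: "'x \<Rightarrow> 'a" and \<epsilon> :: "'l \<Rightarrow> 'b" +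
  assumes triangle_left: "\<epsilon> (fob F A) \<cdot>\<^bsub>L\<^esub> far F (\<eta> A) = idn L (fob F A)"
    and triangle_right: "far G (\<epsilon> E) \<cdot>\<^bsub>X\<^esub> \<eta> (fob G E) = idn X (fob G E)"

section \<open>Enriched categories\<close>

text \<open>
  Composition is in diagrammatic order, \<open>vcmp A a b c : A(a,b) \<otimes> A(b,c) \<rightarrow> A(a,c)\<close>, which matches
  the evaluation \<open>A \<otimes> ihom A B \<rightarrow> B\<close>.
\<close>

record ('c, 'o, 'a) vcat =
  vob :: "'c set"
  vhom :: "'c \<Rightarrow> 'c \<Rightarrow> 'o"
  vcmp :: "'c \<Rightarrow> 'c \<Rightarrow> 'c \<Rightarrow> 'a"
  vidn :: "'c \<Rightarrow> 'a"

locale enriched_category = symmetric_monoidal_category V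
  for V :: "('o, 'a, 'm) smcat_scheme" (structure) +
  fixes A :: "('c, 'o, 'a) vcat"
  assumes vcmp_in_hom: "\<lbrakk>a \<in> vob A; b \<in> vob A; c \<in> vob A\<rbrakk>
      \<Longrightarrow> \<guillemotleft>vcmp A a b c : vhom A a b \<otimes> vhom A b c \<rightarrow> vhom A a c\<guillemotright>"
    and vidn_in_hom: "a \<in> vob A \<Longrightarrow> \<guillemotleft>vidn A a : \<one> \<rightarrow> vhom A a a\<guillemotright>"
    and vcmp_vidn_left: "\<lbrakk>a \<in> vob A; b \<in> vob A\<rbrakk>
      \<Longrightarrow> vcmp A a a b \<cdot> (vidn A a \<odot> idn V (vhom A a b)) = lun V (vhom A a b)"
    and vcmp_vidn_right: "\<lbrakk>a \<in> vob A; b \<in> vob A\<rbrakk>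
      \<Longrightarrow> vcmp A a b b \<cdot> (idn V (vhom A a b) \<odot> vidn A b) = run V (vhom A a b)"
    and vcmp_assoc: "\<lbrakk>a \<in> vob A; b \<in> vob A; c \<in> vob A; d \<in> vob A\<rbrakk>
      \<Longrightarrow> vcmp A a c d \<cdot> (vcmp A a b c \<odot> idn V (vhom A c d))
        = vcmp A a b d \<cdot> (idn V (vhom A a b) \<odot> vcmp A b c d)
          \<cdot> asc V (vhom A a b) (vhom A b c) (vhom A c d)"

record ('c, 'd, 'a) vfun =
  vfob :: "'c \<Rightarrow> 'd"
  vfar :: "'c \<Rightarrow> 'c \<Rightarrow> 'a"

locale enriched_functor = A: enriched_category V A + B: enriched_category V B
  for V :: "('o, 'a, 'm) smcat_scheme" (structure)
    and A :: "('c, 'o, 'a) vcat" and B :: "('d, 'o, 'a) vcat" +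
  fixes T :: "('c, 'd, 'a) vfun"
  assumes vfob_in_vob: "a \<in> vob A \<Longrightarrow> vfob T a \<in> vob B"
    and vfar_in_hom: "\<lbrakk>a \<in> vob A; b \<in> vob A\<rbrakk>
      \<Longrightarrow> \<guillemotleft>vfar T a b : vhom A a b \<rightarrow> vhom B (vfob T a) (vfob T b)\<guillemotright>"
    and vfar_vidn: "a \<in> vob A \<Longrightarrow> vfar T a a \<cdot> vidn A a = vidn B (vfob T a)"
    and vfar_vcmp: "\<lbrakk>a \<in> vob A; b \<in> vob A; c \<in> vob A\<rbrakk>
      \<Longrightarrow> vfar T a c \<cdot> vcmp A a b c
        = vcmp B (vfob T a) (vfob T b) (vfob T c) \<cdot> (vfar T a b \<odot> vfar T b c)"

definition vfun_id :: "('o, 'a, 'm) smcat_scheme \<Rightarrow> ('c, 'o, 'a) vcat \<Rightarrow> ('c, 'c, 'a) vfun"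
  where "vfun_id V A = \<lparr>vfob = (\<lambda>a. a), vfar = (\<lambda>a b. idn V (vhom A a b))\<rparr>"

definition vfun_comp :: "('o, 'a, 'm) smcat_scheme \<Rightarrow> ('d, 'e, 'a) vfun \<Rightarrow> ('c, 'd, 'a) vfun
    \<Rightarrow> ('c, 'e, 'a) vfun"
  where "vfun_comp V S T = \<lparr>vfob = (\<lambda>a. vfob S (vfob T a)),
    vfar = (\<lambda>a b. vfar S (vfob T a) (vfob T b) \<cdot>\<^bsub>V\<^esub> vfar T a b)\<rparr>"

text \<open>
  An arrow \<open>a \<rightarrow> b\<close> of the underlying ordinary category of \<open>A\<close> is an arrow \<open>\<one> \<rightarrow> A(a,b)\<close> of \<open>V\<close>;
  \<open>elem_cmp\<close> is their composition, first \<open>f\<close>, then \<open>g\<close>.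
\<close>

definition elem_cmp :: "('o, 'a, 'm) smcat_scheme \<Rightarrow> ('c, 'o, 'a) vcat \<Rightarrow> 'c \<Rightarrow> 'c \<Rightarrow> 'c \<Rightarrow> 'a \<Rightarrow> 'a \<Rightarrow> 'a"
  where "elem_cmp V A a b c f g
    = vcmp A a b c \<cdot>\<^bsub>V\<^esub> (f \<odot>\<^bsub>V\<^esub> g) \<cdot>\<^bsub>V\<^esub> inverse_arrow V (lun V \<one>\<^bsub>V\<^esub>)"

locale enriched_transformation = S: enriched_functor V A B S + T: enriched_functor V A B T
  for V :: "('o, 'a, 'm) smcat_scheme" (structure)
    and A :: "('c, 'o, 'a) vcat" and B :: "('d, 'o, 'a) vcat"
    and S :: "('c, 'd, 'a) vfun" and T :: "('c, 'd, 'a) vfun" +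
  fixes t :: "'c \<Rightarrow> 'a"
  assumes comp_in_hom: "a \<in> vob A \<Longrightarrow> \<guillemotleft>t a : \<one> \<rightarrow> vhom B (vfob S a) (vfob T a)\<guillemotright>"
    and comp_natural: "\<lbrakk>a \<in> vob A; b \<in> vob A\<rbrakk>
      \<Longrightarrow> vcmp B (vfob S a) (vfob T a) (vfob T b) \<cdot> (t a \<odot> vfar T a b)
            \<cdot> inverse_arrow V (lun V (vhom A a b))
        = vcmp B (vfob S a) (vfob S b) (vfob T b) \<cdot> (vfar S a b \<odot> t b)
            \<cdot> inverse_arrow V (run V (vhom A a b))"

text \<open>Vertical composite of \<open>s : S \<rightarrow> T\<close> and \<open>t : T \<rightarrow> U\<close>, where \<open>B\<close> is the codomain.\<close>

definition vtrans_comp :: "('o, 'a, 'm) smcat_scheme \<Rightarrow> ('d, 'o, 'a) vcat \<Rightarrow> ('c, 'd, 'a) vfun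
    \<Rightarrow> ('c, 'd, 'a) vfun \<Rightarrow> ('c, 'd, 'a) vfun \<Rightarrow> ('c \<Rightarrow> 'a) \<Rightarrow> ('c \<Rightarrow> 'a) \<Rightarrow> 'c \<Rightarrow> 'a"
  where "vtrans_comp V B S T U s t = (\<lambda>a. elem_cmp V B (vfob S a) (vfob T a) (vfob U a) (s a) (t a))"

text \<open>Whiskerings of \<open>t : S \<rightarrow> T\<close>: \<open>U t : U S \<rightarrow> U T\<close> and \<open>t U : S U \<rightarrow> T U\<close>.\<close>

definition whisker_post :: "('o, 'a, 'm) smcat_scheme \<Rightarrow> ('d, 'e, 'a) vfun \<Rightarrow> ('c, 'd, 'a) vfun
    \<Rightarrow> ('c, 'd, 'a) vfun \<Rightarrow> ('c \<Rightarrow> 'a) \<Rightarrow> 'c \<Rightarrow> 'a"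
  where "whisker_post V U S T t = (\<lambda>a. vfar U (vfob S a) (vfob T a) \<cdot>\<^bsub>V\<^esub> t a)"

definition whisker_pre :: "('d \<Rightarrow> 'a) \<Rightarrow> ('c, 'd, 'a) vfun \<Rightarrow> 'c \<Rightarrow> 'a"
  where "whisker_pre t U = (\<lambda>a. t (vfob U a))"

record ('c, 'a) vmonad =
  mfun :: "('c, 'c, 'a) vfun"
  munit :: "'c \<Rightarrow> 'a"
  mmult :: "'c \<Rightarrow> 'a"

locale enriched_monad =
  unit: enriched_transformation V A A "vfun_id V A" "mfun M" "munit M"
  + mult: enriched_transformation V A A "vfun_comp V (mfun M) (mfun M)" "mfun M" "mmult M"
  for V :: "('o, 'a, 'm) smcat_scheme" (structure)
    and A :: "('c, 'o, 'a) vcat" and M :: "('c, 'a) vmonad" +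
  assumes mmult_munit_left: "a \<in> vob A \<Longrightarrow>
      vtrans_comp V A (mfun M) (vfun_comp V (mfun M) (mfun M)) (mfun M)
        (whisker_pre (munit M) (mfun M)) (mmult M) a
      = vidn A (vfob (mfun M) a)"
    and mmult_munit_right: "a \<in> vob A \<Longrightarrow>
      vtrans_comp V A (mfun M) (vfun_comp V (mfun M) (mfun M)) (mfun M)
        (whisker_post V (mfun M) (vfun_id V A) (mfun M) (munit M)) (mmult M) a
      = vidn A (vfob (mfun M) a)"
    and mmult_assoc: "a \<in> vob A \<Longrightarrow>
      vtrans_comp V A (vfun_comp V (mfun M) (vfun_comp V (mfun M) (mfun M)))
        (vfun_comp V (mfun M) (mfun M)) (mfun M)
        (whisker_pre (mmult M) (mfun M)) (mmult M) a
      = vtrans_comp V A (vfun_comp V (mfun M) (vfun_comp V (mfun M) (mfun M)))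
        (vfun_comp V (mfun M) (mfun M)) (mfun M)
        (whisker_post V (mfun M) (vfun_comp V (mfun M) (mfun M)) (mfun M) (mmult M)) (mmult M) a"

text \<open>\<open>S : A \<rightarrow> B\<close> is left adjoint to \<open>T : B \<rightarrow> A\<close> with unit \<open>u\<close> and counit \<open>c\<close>.\<close>

locale enriched_adjunction =
  unit: enriched_transformation V A A "vfun_id V A" "vfun_comp V T S" u
  + counit: enriched_transformation V B B "vfun_comp V S T" "vfun_id V B" c
  + left: enriched_functor V A B S + right: enriched_functor V B A T
  for V :: "('o, 'a, 'm) smcat_scheme" (structure)
    and A :: "('c, 'o, 'a) vcat" and B :: "('d, 'o, 'a) vcat"
    and S :: "('c, 'd, 'a) vfun" and T :: "('d, 'c, 'a) vfun"
    and u :: "'c \<Rightarrow> 'a" and c :: "'d \<Rightarrow> 'a" +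
  assumes vtriangle_left: "a \<in> vob A \<Longrightarrow>
      vtrans_comp V B S (vfun_comp V S (vfun_comp V T S)) S
        (whisker_post V S (vfun_id V A) (vfun_comp V T S) u) (whisker_pre c S) a
      = vidn B (vfob S a)"
    and vtriangle_right: "b \<in> vob B \<Longrightarrow>
      vtrans_comp V A T (vfun_comp V T (vfun_comp V S T)) T
        (whisker_pre u T) (whisker_post V T (vfun_comp V S T) (vfun_id V B) c) b
      = vidn A (vfob T b)"

definition adjunction_monad :: "('o, 'a, 'm) smcat_scheme \<Rightarrow> ('c, 'd, 'a) vfun \<Rightarrow> ('d, 'c, 'a) vfun
    \<Rightarrow> ('c \<Rightarrow> 'a) \<Rightarrow> ('d \<Rightarrow> 'a) \<Rightarrow> ('c, 'a) vmonad"
  where "adjunction_monad V S T u c = \<lparr>mfun = vfun_comp V T S, munit = u,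
    mmult = whisker_post V T (vfun_comp V S (vfun_comp V T S)) S (whisker_pre c S)\<rparr>"

section \<open>Reflective subcategories and their monads\<close>

definition full_subcategory :: "('c, 'o, 'a) vcat \<Rightarrow> 'c set \<Rightarrow> ('c, 'o, 'a) vcat"
  where "full_subcategory A P = A\<lparr>vob := vob A \<inter> P\<rparr>"

text \<open>
  The inclusion of a full subcategory acts as the identity, so it is \<open>vfun_id\<close>.  The left adjoint
  is unique only up to isomorphism, hence a choice.
\<close>

definition reflection_monad :: "('o, 'a, 'm) smcat_scheme \<Rightarrow> ('c, 'o, 'a) vcat \<Rightarrow> 'c set \<Rightarrow> ('c, 'a) vmonad"
  where "reflection_monad V A P = (let B = full_subcategory A P; J = vfun_id V B in
    (case (SOME (K, u, c). enriched_adjunction V A B K J u c) of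
      (K, u, c) \<Rightarrow> adjunction_monad V K J u c))"

section \<open>Self-enrichment and change of base\<close>

definition self_enriched :: "('o, 'a, 'm) csmcat_scheme \<Rightarrow> ('o, 'o, 'a) vcat"
  where "self_enriched V = \<lparr>vob = UNIV, vhom = ihom V,
    vcmp = (\<lambda>A B D. transpose V A (ihom V A B \<otimes>\<^bsub>V\<^esub> ihom V B D) D
      (ev V B D \<cdot>\<^bsub>V\<^esub> (ev V A B \<odot>\<^bsub>V\<^esub> idn V (ihom V B D))
        \<cdot>\<^bsub>V\<^esub> inverse_arrow V (asc V A (ihom V A B) (ihom V B D)))),
    vidn = (\<lambda>A. transpose V A \<one>\<^bsub>V\<^esub> A (run V A))\<rparr>"

text \<open>
  Mutually inverse identifications of arrows \<open>f : A \<rightarrow> B\<close> with elements \<open>\<one> \<rightarrow> ihom A B\<close>.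
\<close>

definition elem_of :: "('o, 'a, 'm) csmcat_scheme \<Rightarrow> 'a \<Rightarrow> 'a"
  where "elem_of V f = transpose V (src V f) \<one>\<^bsub>V\<^esub> (tgt V f) (f \<cdot>\<^bsub>V\<^esub> run V (src V f))"

definition arrow_of :: "('o, 'a, 'm) csmcat_scheme \<Rightarrow> 'o \<Rightarrow> 'o \<Rightarrow> 'a \<Rightarrow> 'a"
  where "arrow_of V A B g = untranspose V A B g \<cdot>\<^bsub>V\<^esub> inverse_arrow V (run V A)"

text \<open>Change of base along \<open>G : L \<rightarrow> X\<close>, on elements, categories, functors and monads.\<close>

definition base_elem :: "('x, 'a, 'm) smcat_scheme \<Rightarrow> ('l, 'b, 'x, 'a) smfun \<Rightarrow> 'b \<Rightarrow> 'a"
  where "base_elem X G f = far G f \<cdot>\<^bsub>X\<^esub> phi0 G"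

definition base_cat :: "('x, 'a, 'm) smcat_scheme \<Rightarrow> ('l, 'b, 'x, 'a) smfun
    \<Rightarrow> ('c, 'l, 'b) vcat \<Rightarrow> ('c, 'x, 'a) vcat"
  where "base_cat X G A = \<lparr>vob = vob A, vhom = (\<lambda>a b. fob G (vhom A a b)),
    vcmp = (\<lambda>a b c. far G (vcmp A a b c) \<cdot>\<^bsub>X\<^esub> phi2 G (vhom A a b) (vhom A b c)),
    vidn = (\<lambda>a. base_elem X G (vidn A a))\<rparr>"

definition base_fun :: "('l, 'b, 'x, 'a) smfun \<Rightarrow> ('c, 'd, 'b) vfun \<Rightarrow> ('c, 'd, 'a) vfun"
  where "base_fun G T = \<lparr>vfob = vfob T, vfar = (\<lambda>a b. far G (vfar T a b))\<rparr>"

definition base_monad :: "('x, 'a, 'm) smcat_scheme \<Rightarrow> ('l, 'b, 'x, 'a) smfun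
    \<Rightarrow> ('c, 'b) vmonad \<Rightarrow> ('c, 'a) vmonad"
  where "base_monad X G M = \<lparr>mfun = base_fun G (mfun M),
    munit = (\<lambda>a. base_elem X G (munit M a)), mmult = (\<lambda>a. base_elem X G (mmult M a))\<rparr>"

section \<open>The enriched adjunction determined by a symmetric monoidal adjunction\<close>

text \<open>\<open>G\<close> as an enriched functor from \<open>base_cat X G (self_enriched L)\<close> to \<open>self_enriched X\<close>.\<close>

definition right_vfun :: "('x, 'a, 'm) csmcat_scheme \<Rightarrow> ('l, 'b, 'n) csmcat_scheme
    \<Rightarrow> ('l, 'b, 'x, 'a) smfun \<Rightarrow> ('l, 'x, 'a) vfun"
  where "right_vfun X L G = \<lparr>vfob = fob G,
    vfar = (\<lambda>E E'. transpose X (fob G E) (fob G (ihom L E E')) (fob G E')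
      (far G (ev L E E') \<cdot>\<^bsub>X\<^esub> phi2 G E (ihom L E E')))\<rparr>"

text \<open>
  The arrows \<open>\<eta>\<close> of \<open>X\<close> and \<open>\<epsilon>\<close> of \<open>L\<close> as elements of the enriched homs; an arrow \<open>f\<close> of \<open>L\<close> is an
  arrow of the underlying category of \<open>base_cat X G (self_enriched L)\<close> via \<open>base_elem X G (elem_of L f)\<close>.
\<close>

definition unit_elem :: "('x, 'a, 'm) csmcat_scheme \<Rightarrow> ('x \<Rightarrow> 'a) \<Rightarrow> 'x \<Rightarrow> 'a"
  where "unit_elem X \<eta> = (\<lambda>A. elem_of X (\<eta> A))"

definition counit_elem :: "('x, 'a, 'm) csmcat_scheme \<Rightarrow> ('l, 'b, 'n) csmcat_scheme
    \<Rightarrow> ('l, 'b, 'x, 'a) smfun \<Rightarrow> ('l \<Rightarrow> 'b) \<Rightarrow> 'l \<Rightarrow> 'a"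
  where "counit_elem X L G \<epsilon> = (\<lambda>E. base_elem X G (elem_of L (\<epsilon> E)))"

text \<open>
  The enriched structure of \<open>F\<close> is the one making \<open>F\<close> left adjoint to \<open>right_vfun X L G\<close> with the
  given unit and counit; naturality of the unit determines it.
\<close>

definition left_vfun :: "('x, 'a, 'm) csmcat_scheme \<Rightarrow> ('l, 'b, 'n) csmcat_scheme
    \<Rightarrow> ('x, 'a, 'l, 'b) smfun \<Rightarrow> ('l, 'b, 'x, 'a) smfun \<Rightarrow> ('x \<Rightarrow> 'a) \<Rightarrow> ('l \<Rightarrow> 'b)
    \<Rightarrow> ('x, 'l, 'a) vfun"
  where "left_vfun X L F G \<eta> \<epsilon> = (THE S. vfob S = fob F \<and>
    enriched_adjunction X (self_enriched X) (base_cat X G (self_enriched L)) S (right_vfun X L G)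
      (unit_elem X \<eta>) (counit_elem X L G \<epsilon>))"

text \<open>
  The monad \<open>[S,T](M)\<close> on \<open>A\<close>, for \<open>S : A \<rightarrow> B\<close> left adjoint to \<open>T : B \<rightarrow> A\<close> with unit \<open>u\<close> and
  counit \<open>c\<close>, and \<open>M\<close> a monad on \<open>B\<close>: its unit is \<open>(T e S) \<cdot> u\<close>, its multiplication
  \<open>(T m S) \<cdot> (T M c M S)\<close>.
\<close>

definition transfer_monad :: "('o, 'a, 'm) smcat_scheme \<Rightarrow> ('c, 'o, 'a) vcat \<Rightarrow> ('d, 'o, 'a) vcat
    \<Rightarrow> ('c, 'd, 'a) vfun \<Rightarrow> ('d, 'c, 'a) vfun \<Rightarrow> ('c \<Rightarrow> 'a) \<Rightarrow> ('d \<Rightarrow> 'a)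
    \<Rightarrow> ('d, 'a) vmonad \<Rightarrow> ('c, 'a) vmonad"
  where "transfer_monad V A B S T u c M = (let
      MS = vfun_comp V (mfun M) S;
      TM = vfun_comp V T (mfun M);
      TMS = vfun_comp V T MS;
      TMMS = vfun_comp V TM MS
    in \<lparr>mfun = TMS,
      munit = vtrans_comp V A (vfun_id V A) (vfun_comp V T S) TMS
        u (whisker_post V T S MS (whisker_pre (munit M) S)),
      mmult = vtrans_comp V A (vfun_comp V TMS TMS) TMMS TMS
        (whisker_post V TM (vfun_comp V S (vfun_comp V T MS)) MS (whisker_pre c MS))
        (whisker_post V T (vfun_comp V (mfun M) MS) MS (whisker_pre (mmult M) S))\<rparr>)"

section \<open>Commutative monads\<close>

definition underlying_ob :: "('x, 'a) vmonad \<Rightarrow> 'x \<Rightarrow> 'x"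
  where "underlying_ob T A = vfob (mfun T) A"

definition underlying_ar :: "('x, 'a, 'm) csmcat_scheme \<Rightarrow> ('x, 'a) vmonad \<Rightarrow> 'a \<Rightarrow> 'a"
  where "underlying_ar X T f = arrow_of X (underlying_ob T (src X f)) (underlying_ob T (tgt X f))
    (vfar (mfun T) (src X f) (tgt X f) \<cdot>\<^bsub>X\<^esub> elem_of X f)"

definition underlying_mult :: "('x, 'a, 'm) csmcat_scheme \<Rightarrow> ('x, 'a) vmonad \<Rightarrow> 'x \<Rightarrow> 'a"
  where "underlying_mult X T A
    = arrow_of X (underlying_ob T (underlying_ob T A)) (underlying_ob T A) (mmult T A)"

text \<open>\<open>strength' X T A B : T A \<otimes> B \<rightarrow> T (A \<otimes> B)\<close> and \<open>strength'' X T A B : A \<otimes> T B \<rightarrow> T (A \<otimes> B)\<close>.\<close>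

definition strength' :: "('x, 'a, 'm) csmcat_scheme \<Rightarrow> ('x, 'a) vmonad \<Rightarrow> 'x \<Rightarrow> 'x \<Rightarrow> 'a"
  where "strength' X T A B = untranspose X (underlying_ob T A) (underlying_ob T (A \<otimes>\<^bsub>X\<^esub> B))
    (vfar (mfun T) A (A \<otimes>\<^bsub>X\<^esub> B) \<cdot>\<^bsub>X\<^esub> transpose X A B (A \<otimes>\<^bsub>X\<^esub> B) (idn X (A \<otimes>\<^bsub>X\<^esub> B)))"

definition strength'' :: "('x, 'a, 'm) csmcat_scheme \<Rightarrow> ('x, 'a) vmonad \<Rightarrow> 'x \<Rightarrow> 'x \<Rightarrow> 'a"
  where "strength'' X T A B = untranspose X (underlying_ob T B) (underlying_ob T (A \<otimes>\<^bsub>X\<^esub> B))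
      (vfar (mfun T) B (A \<otimes>\<^bsub>X\<^esub> B) \<cdot>\<^bsub>X\<^esub> transpose X B A (A \<otimes>\<^bsub>X\<^esub> B) (sym X B A))
    \<cdot>\<^bsub>X\<^esub> sym X A (underlying_ob T B)"

definition commutative_vmonad :: "('x, 'a, 'm) csmcat_scheme \<Rightarrow> ('x, 'a) vmonad \<Rightarrow> bool"
  where "commutative_vmonad X T \<longleftrightarrow> enriched_monad X (self_enriched X) T \<and> (\<forall>A B.
    underlying_mult X T (A \<otimes>\<^bsub>X\<^esub> B) \<cdot>\<^bsub>X\<^esub> underlying_ar X T (strength' X T A B)
        \<cdot>\<^bsub>X\<^esub> strength'' X T (underlying_ob T A) B
    = underlying_mult X T (A \<otimes>\<^bsub>X\<^esub> B) \<cdot>\<^bsub>X\<^esub> underlying_ar X T (strength'' X T A B)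
        \<cdot>\<^bsub>X\<^esub> strength' X T A (underlying_ob T B))"

section \<open>The accessible distribution monad\<close>

definition functional_completion_monad :: "('l, 'b, 'n) csmcat_scheme \<Rightarrow> ('l, 'b) vmonad"
  where "functional_completion_monad L
    = reflection_monad L (self_enriched L) {E. functionally_complete L E}"

definition accessible_distribution_monad :: "('x, 'a, 'm) csmcat_scheme \<Rightarrow> ('l, 'b, 'n) csmcat_scheme
    \<Rightarrow> ('x, 'a, 'l, 'b) smfun \<Rightarrow> ('l, 'b, 'x, 'a) smfun \<Rightarrow> ('x \<Rightarrow> 'a) \<Rightarrow> ('l \<Rightarrow> 'b)
    \<Rightarrow> ('x, 'a) vmonad"
  where "accessible_distribution_monad X L F G \<eta> \<epsilon> =
    transfer_monad X (self_enriched X) (base_cat X G (self_enriched L))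
      (left_vfun X L F G \<eta> \<epsilon>) (right_vfun X L G) (unit_elem X \<eta>) (counit_elem X L G \<epsilon>)
      (base_monad X G (functional_completion_monad L))"

end

theory Submission
  imports Defs
begin

text \<open>
  In a tensored enriched category a generalised element \<open>Z \<rightarrow> A(a,b)\<close> is an arrow \<open>a \<cdot> Z \<rightarrow> b\<close>, so enriched
  functors become operations on such parametrised arrows and enriched naturality becomes an equation
  between ordinary arrows; \<open>G\<^sub>*L\<close> is tensored by \<open>E \<cdot> Z = E \<otimes> F Z\<close>.

  The functionally complete objects are those orthogonal to all \<open>h \<otimes> Z\<close> with \<open>h\<^sup>*\<close> invertible, so the
  reflection \<open>e : E \<rightarrow> H E\<close> stays a reflection after tensoring with any \<open>Z\<close>.  Hence the strength of \<open>H\<close>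
  and the monad structure of \<open>D = G H F\<close> are determined by their restrictions along \<open>e\<close>, the
  multiplication being \<open>G \<kappa>\<close> with \<open>\<kappa> e = \<epsilon>\<close>.  Likewise there is a unique \<open>\<chi> : H F A \<otimes> H F B \<rightarrow> H F (A \<otimes> B)\<close>
  extending \<open>F A \<otimes> F B \<rightarrow> F (A \<otimes> B) \<rightarrow> H F (A \<otimes> B)\<close> along \<open>e \<otimes> e\<close>, and both maps \<open>D A \<otimes> D B \<rightarrow> D (A \<otimes> B)\<close>
  are the monoidal structure morphism of \<open>G\<close> followed by \<open>G \<chi>\<close>.
\<close>

section \<open>Monoidal categories\<close>

text \<open>Two ingredients of the definition are not given by formulas: the enrichment of F is a
  definite description and the reflector of L an arbitrary choice. So the former needs a uniqueness
  proof (naturality of the unit leaves a single candidate), and the latter needs both the existence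
  of some enriched adjunction and a derivation of the orthogonality property from an unknown one.
  The tensors of the change of base require invertible constraints, whereas monoidal functors are
  here only lax. They are available because a left adjoint among lax monoidal functors is
  automatically strong: the mates of the structure morphisms of G invert those of F. Functional
  completeness is defined through double duals. That single duals suffice holds because a pairing
  with the dual of h can be extended along that dual as soon as its own dual is invertible. In the
  end, commutativity says that extending a map from FA \<otimes> FB first in one variable and then
  in the other does not depend on the order, which is uniqueness of extensions in two
  variables.\<close>

context category
begin

lemma src_idn [simp]: "src C (idn C A) = A" and tgt_idn [simp]: "tgt C (idn C A) = A"
  using idn_in_hom[of A] by (simp_all add: in_hom_def)

lemma src_cmp [simp]: "tgt C f = src C g \<Longrightarrow> src C (g \<cdot> f) = src C f"
  and tgt_cmp [simp]: "tgt C f = src C g \<Longrightarrow> tgt C (g \<cdot> f) = tgt C g"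
  using cmp_in_hom[of f _ _ g] by (simp_all add: in_hom_def)

lemma idn_cmp [simp]: "tgt C f = B \<Longrightarrow> idn C B \<cdot> f = f"
  and cmp_idn [simp]: "src C f = A \<Longrightarrow> f \<cdot> idn C A = f"
  using cmp_idn_left cmp_idn_right by (auto simp: in_hom_def)

lemma assoc [simp]: "\<lbrakk>tgt C f = src C g; tgt C g = src C h\<rbrakk> \<Longrightarrow> (h \<cdot> g) \<cdot> f = h \<cdot> (g \<cdot> f)"
  using cmp_assoc by (simp add: in_hom_def)

text \<open>The simplifier keeps composites nested to the right, where an equation for
  \<open>g \<cdot> f\<close> no longer matches once a further arrow precedes \<open>f\<close>. This
  form supplies the equation inside such a composite.\<close>

lemma reassoc: "\<lbrakk>g \<cdot> f = h; tgt C f = src C g; tgt C k = src C f\<rbrakk> \<Longrightarrow> g \<cdot> (f \<cdot> k) = h \<cdot> k"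
  using assoc by metis

lemma inverses_unique: "\<lbrakk>inverses C f g; inverses C f h\<rbrakk> \<Longrightarrow> g = h"
  unfolding inverses_def in_hom_def by (metis assoc cmp_idn idn_cmp)

lemma inverse_arrow_eq: "inverses C f g \<Longrightarrow> inverse_arrow C f = g"
  unfolding inverse_arrow_def using inverses_unique by blast

lemma isoI: "\<lbrakk>src C g = tgt C f; tgt C g = src C f; g \<cdot> f = idn C (src C f); f \<cdot> g = idn C (tgt C f)\<rbrakk>
    \<Longrightarrow> iso C f"
  unfolding iso_def inverses_def in_hom_def by blast

lemma inverses_inverse_arrow: "iso C f \<Longrightarrow> inverses C f (inverse_arrow C f)"
  using inverse_arrow_eq iso_def by metis

lemma src_inverse [simp]: "iso C f \<Longrightarrow> src C (inverse_arrow C f) = tgt C f"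
  and tgt_inverse [simp]: "iso C f \<Longrightarrow> tgt C (inverse_arrow C f) = src C f"
  and inverse_cmp [simp]: "iso C f \<Longrightarrow> inverse_arrow C f \<cdot> f = idn C (src C f)"
  and cmp_inverse [simp]: "iso C f \<Longrightarrow> f \<cdot> inverse_arrow C f = idn C (tgt C f)"
  using inverses_inverse_arrow[of f] by (auto simp: inverses_def in_hom_def)

lemma inverse_cmp' [simp]: "\<lbrakk>iso C f; tgt C k = src C f\<rbrakk> \<Longrightarrow> inverse_arrow C f \<cdot> (f \<cdot> k) = k"
  and cmp_inverse' [simp]: "\<lbrakk>iso C f; tgt C k = tgt C f\<rbrakk> \<Longrightarrow> f \<cdot> (inverse_arrow C f \<cdot> k) = k"
  by (simp_all add: assoc[symmetric] del: assoc)

lemma iso_epi: "\<lbrakk>iso C f; src C g = tgt C f; src C h = tgt C f; g \<cdot> f = h \<cdot> f\<rbrakk> \<Longrightarrow> g = h"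
  by (metis assoc cmp_idn cmp_inverse tgt_inverse)

lemma iso_mono: "\<lbrakk>iso C f; tgt C g = src C f; tgt C h = src C f; f \<cdot> g = f \<cdot> h\<rbrakk> \<Longrightarrow> g = h"
  by (metis inverse_cmp')

lemma iso_inverse: "iso C f \<Longrightarrow> iso C (inverse_arrow C f)"
  by (rule isoI[of f]) simp_all

lemma iso_idn: "iso C (idn C A)"
  by (rule isoI[of "idn C A"]) simp_all

lemma iso_cmp: "\<lbrakk>iso C f; iso C g; tgt C f = src C g\<rbrakk> \<Longrightarrow> iso C (g \<cdot> f)"
  by (rule isoI[of "inverse_arrow C f \<cdot> inverse_arrow C g"]) simp_all

lemma inverse_unique: "\<lbrakk>iso C f; src C g = tgt C f; tgt C g = src C f; g \<cdot> f = idn C (src C f)\<rbrakk>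
    \<Longrightarrow> g = inverse_arrow C f"
  by (metis assoc cmp_idn cmp_inverse idn_cmp tgt_inverse)

end

context symmetric_monoidal_category
begin

lemma src_tar [simp]: "src V (f \<odot> g) = src V f \<otimes> src V g"
  and tgt_tar [simp]: "tgt V (f \<odot> g) = tgt V f \<otimes> tgt V g"
  using tar_in_hom[of f _ _ g] by (simp_all add: in_hom_def)

lemma tar_idn' [simp]: "idn V A \<odot> idn V B = idn V (A \<otimes> B)"
  by (rule tar_idn)

lemma tar_tar [simp]: "\<lbrakk>tgt V f = src V f'; tgt V g = src V g'\<rbrakk>
    \<Longrightarrow> (f' \<odot> g') \<cdot> (f \<odot> g) = (f' \<cdot> f) \<odot> (g' \<cdot> g)"
  using tar_cmp by (simp add: in_hom_def)

lemma tar_tar' [simp]: "\<lbrakk>tgt V f = src V f'; tgt V g = src V g'; tgt V k = src V f \<otimes> src V g\<rbrakk>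
    \<Longrightarrow> (f' \<odot> g') \<cdot> ((f \<odot> g) \<cdot> k) = ((f' \<cdot> f) \<odot> (g' \<cdot> g)) \<cdot> k"
  using reassoc[OF tar_tar] by simp

lemma src_asc [simp]: "src V (asc V A B D) = (A \<otimes> B) \<otimes> D"
  and tgt_asc [simp]: "tgt V (asc V A B D) = A \<otimes> (B \<otimes> D)"
  using asc_in_hom[of A B D] by (simp_all add: in_hom_def)

lemma src_lun [simp]: "src V (lun V A) = \<one> \<otimes> A" and tgt_lun [simp]: "tgt V (lun V A) = A"
  using lun_in_hom[of A] by (simp_all add: in_hom_def)

lemma src_run [simp]: "src V (run V A) = A \<otimes> \<one>" and tgt_run [simp]: "tgt V (run V A) = A"
  using run_in_hom[of A] by (simp_all add: in_hom_def)

lemma src_sym [simp]: "src V (sym V A B) = A \<otimes> B" and tgt_sym [simp]: "tgt V (sym V A B) = B \<otimes> A"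
  using sym_in_hom[of A B] by (simp_all add: in_hom_def)

declare asc_iso [simp] lun_iso [simp] run_iso [simp] sym_sym [simp]

lemma sym_iso [simp]: "iso V (sym V A B)"
  by (rule isoI[of "sym V B A"]) simp_all

lemma asc_nat: "\<lbrakk>A = tgt V f; B = tgt V g; D = tgt V h\<rbrakk> \<Longrightarrow>
    asc V A B D \<cdot> ((f \<odot> g) \<odot> h) = (f \<odot> (g \<odot> h)) \<cdot> asc V (src V f) (src V g) (src V h)"
  using asc_natural by (simp add: in_hom_def)

lemma run_nat: "B = tgt V f \<Longrightarrow> run V B \<cdot> (f \<odot> idn V \<one>) = f \<cdot> run V (src V f)"
  using run_natural by (simp add: in_hom_def)

lemma sym_nat: "\<lbrakk>A = tgt V f; B = tgt V g\<rbrakk> \<Longrightarrow> sym V A B \<cdot> (f \<odot> g) = (g \<odot> f) \<cdot> sym V (src V f) (src V g)"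
  using sym_natural by (simp add: in_hom_def)

lemma tar_iso: assumes "iso V f" "iso V g" shows "iso V (f \<odot> g)"
  by (rule isoI[of "inverse_arrow V f \<odot> inverse_arrow V g"]) (use assms in simp_all)

text \<open>\<open>run\<close> is a natural isomorphism from tensoring with the unit to the identity
  functor, and the latter is faithful.\<close>

lemma tar_unit_faithful:
  assumes "src V f = src V g" "tgt V f = tgt V g" "f \<odot> idn V \<one> = g \<odot> idn V \<one>"
  shows "f = g"
proof -
  have "f \<cdot> run V (src V f) = g \<cdot> run V (src V f)"
    using run_nat[OF refl, of f] run_nat[OF refl, of g] assms by metis
  then show ?thesis using assms(1) iso_epi[OF run_iso] tgt_run by metis
qed

text \<open>Kelly's argument: after tensoring with \<open>\<one>\<close> on the right, both sides agree by the pentagon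
  and two triangles.\<close>

lemma run_tensor: "(idn V A \<odot> run V B) \<cdot> asc V A B \<one> = run V (A \<otimes> B)"
proof (rule tar_unit_faithful)
  let ?I = "idn V \<one>"
  have eq: "asc V A B \<one> \<cdot> (run V (A \<otimes> B) \<odot> ?I)
    = asc V A B \<one> \<cdot> (((idn V A \<odot> run V B) \<cdot> asc V A B \<one>) \<odot> ?I)"
  proof -
    have "asc V A B \<one> \<cdot> (run V (A \<otimes> B) \<odot> ?I)
      = asc V A B \<one> \<cdot> ((idn V (A \<otimes> B) \<odot> lun V \<one>) \<cdot> asc V (A \<otimes> B) \<one> \<one>)"
      by (simp add: triangle)
    also have "\<dots> = (idn V A \<odot> (idn V B \<odot> lun V \<one>)) \<cdot> (asc V A B (\<one> \<otimes> \<one>) \<cdot> asc V (A \<otimes> B) \<one> \<one>)"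
      using reassoc[OF asc_nat[of A "idn V A" B "idn V B" \<one> "lun V \<one>"], of "asc V (A \<otimes> B) \<one> \<one>"] by simp
    also have "\<dots> = (idn V A \<odot> (idn V B \<odot> lun V \<one>)) \<cdot> ((idn V A \<odot> asc V B \<one> \<one>) \<cdot> (asc V A (B \<otimes> \<one>) \<one> \<cdot> (asc V A B \<one> \<odot> ?I)))"
      by (simp add: pentagon)
    also have "\<dots> = (idn V A \<odot> (run V B \<odot> ?I)) \<cdot> (asc V A (B \<otimes> \<one>) \<one> \<cdot> (asc V A B \<one> \<odot> ?I))"
      by (simp add: triangle)
    also have "\<dots> = asc V A B \<one> \<cdot> ((idn V A \<odot> run V B) \<odot> ?I) \<cdot> (asc V A B \<one> \<odot> ?I)"
      by (simp add: asc_nat reassoc[OF asc_nat[of A "idn V A" B "run V B" \<one> "?I"], symmetric] del: tar_tar)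
    finally show ?thesis by simp
  qed
  show "((idn V A \<odot> run V B) \<cdot> asc V A B \<one>) \<odot> ?I = run V (A \<otimes> B) \<odot> ?I"
    by (rule iso_mono[OF asc_iso[of A B \<one>]]) (simp_all add: eq)
qed simp_all

end

context closed_symmetric_monoidal_category
begin

lemma src_ev [simp]: "src V (ev V A B) = A \<otimes> ihom V A B" and tgt_ev [simp]: "tgt V (ev V A B) = B"
  using ev_in_hom[of A B] by (simp_all add: in_hom_def)

lemma transpose_char:
  assumes "src V f = A \<otimes> D" "tgt V f = B"
  shows "src V (transpose V A D B f) = D \<and> tgt V (transpose V A D B f) = ihom V A B
    \<and> ev V A B \<cdot> (idn V A \<odot> transpose V A D B f) = f"
  using theI'[OF ev_universal[of f A D B]] assms unfolding transpose_def in_hom_def by simp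

lemma src_transpose [simp]: "\<lbrakk>src V f = A \<otimes> D; tgt V f = B\<rbrakk> \<Longrightarrow> src V (transpose V A D B f) = D"
  and tgt_transpose [simp]: "\<lbrakk>src V f = A \<otimes> D; tgt V f = B\<rbrakk> \<Longrightarrow> tgt V (transpose V A D B f) = ihom V A B"
  and ev_transpose [simp]: "\<lbrakk>src V f = A \<otimes> D; tgt V f = B\<rbrakk>
    \<Longrightarrow> ev V A B \<cdot> (idn V A \<odot> transpose V A D B f) = f"
  using transpose_char by blast+

lemma ev_eqI:
  assumes "tgt V g = ihom V A B" "tgt V h = ihom V A B" "src V g = src V h"
    and "ev V A B \<cdot> (idn V A \<odot> g) = ev V A B \<cdot> (idn V A \<odot> h)"
  shows "g = h"
  using ev_universal[of "ev V A B \<cdot> (idn V A \<odot> g)" A "src V g" B] assms unfolding in_hom_def by auto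

end

section \<open>Tensored enriched categories\<close>

lemma vfun_id_simps [simp]: "vfob (vfun_id V A) a = a" "vfar (vfun_id V A) a b = idn V (vhom A a b)"
  by (simp_all add: vfun_id_def)

lemma vfun_comp_simps [simp]: "vfob (vfun_comp V S T) a = vfob S (vfob T a)"
  "vfar (vfun_comp V S T) a b = vfar S (vfob T a) (vfob T b) \<cdot>\<^bsub>V\<^esub> vfar T a b"
  by (simp_all add: vfun_comp_def)

lemma enriched_functor_id:
  assumes "enriched_category V A" shows "enriched_functor V A A (vfun_id V A)"
proof -
  interpret enriched_category V A by fact
  show ?thesis
    by (unfold_locales)
      (use vcmp_in_hom vidn_in_hom in \<open>simp_all add: vfun_id_def in_hom_def\<close>)
qed

lemma enriched_functor_comp:
  assumes "enriched_functor V A B T" "enriched_functor V B D S"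
  shows "enriched_functor V A D (vfun_comp V S T)"
proof -
  interpret T: enriched_functor V A B T by fact
  interpret S: enriched_functor V B D S by fact
  note [simp] = T.vfob_in_vob S.vfob_in_vob
    T.vfar_in_hom[unfolded in_hom_def, THEN conjunct1] T.vfar_in_hom[unfolded in_hom_def, THEN conjunct2]
    S.vfar_in_hom[unfolded in_hom_def, THEN conjunct1] S.vfar_in_hom[unfolded in_hom_def, THEN conjunct2]
    T.A.vcmp_in_hom[unfolded in_hom_def, THEN conjunct1] T.A.vcmp_in_hom[unfolded in_hom_def, THEN conjunct2]
    T.B.vcmp_in_hom[unfolded in_hom_def, THEN conjunct1] T.B.vcmp_in_hom[unfolded in_hom_def, THEN conjunct2]
    S.B.vcmp_in_hom[unfolded in_hom_def, THEN conjunct1] S.B.vcmp_in_hom[unfolded in_hom_def, THEN conjunct2]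
    T.A.vidn_in_hom[unfolded in_hom_def, THEN conjunct1] T.A.vidn_in_hom[unfolded in_hom_def, THEN conjunct2]
  show ?thesis
    by (unfold_locales) (simp_all add: in_hom_def T.vfar_vidn S.vfar_vidn
        T.vfar_vcmp T.A.reassoc[OF S.vfar_vcmp])
qed

text \<open>
  A tensored enriched category is presented by an ordinary category \<open>C\<close>, an action
  \<open>aob a Z\<close> of the base on \<open>C\<close> with unit and associativity constraints \<open>aun\<close> and \<open>aas\<close>, and
  universal arrows \<open>aev a b : aob a (vhom a b) \<rightarrow> b\<close>.
\<close>

record ('c, 'o, 'a, 'b) action =
  aob :: "'c \<Rightarrow> 'o \<Rightarrow> 'c"
  aar :: "'b \<Rightarrow> 'a \<Rightarrow> 'b"
  aun :: "'c \<Rightarrow> 'b"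
  aas :: "'c \<Rightarrow> 'o \<Rightarrow> 'o \<Rightarrow> 'b"
  aev :: "'c \<Rightarrow> 'c \<Rightarrow> 'b"

text \<open>\<open>aev_vcmp\<close> and \<open>aev_vidn\<close> tie the enrichment to C: composition
  is the transpose of iterated evaluation, the identity that of the unit constraint. Only these two
  laws are restricted to \<open>vob A\<close>, while tensors are formed in all of C. A full
  subcategory thereby satisfies the locale with the same C and N, even if it is not closed under
  tensors.\<close>

locale tensored_category = enriched_category V A + C: category C
  for V :: "('o, 'a, 'm) smcat_scheme" (structure)
    and A :: "('c, 'o, 'a) vcat" and C :: "('c, 'b, 'k) cat_scheme"
    and N :: "('c, 'o, 'a, 'b) action" +
  assumes src_aar [simp]: "src C (aar N f x) = aob N (src C f) (src V x)"
    and tgt_aar [simp]: "tgt C (aar N f x) = aob N (tgt C f) (tgt V x)"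
    and aar_idn [simp]: "aar N (idn C a) (idn V Z) = idn C (aob N a Z)"
    and aar_cmp [simp]: "\<lbrakk>tgt C f = src C f'; tgt V x = src V x'\<rbrakk>
      \<Longrightarrow> aar N f' x' \<cdot>\<^bsub>C\<^esub> aar N f x = aar N (f' \<cdot>\<^bsub>C\<^esub> f) (x' \<cdot> x)"
    and src_aun [simp]: "src C (aun N a) = aob N a \<one>" and tgt_aun [simp]: "tgt C (aun N a) = a"
    and aun_iso [simp]: "iso C (aun N a)"
    and aun_nat: "aun N (tgt C f) \<cdot>\<^bsub>C\<^esub> aar N f (idn V \<one>) = f \<cdot>\<^bsub>C\<^esub> aun N (src C f)"
    and src_aas [simp]: "src C (aas N a Z W) = aob N (aob N a Z) W"
    and tgt_aas [simp]: "tgt C (aas N a Z W) = aob N a (Z \<otimes> W)"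
    and aas_iso [simp]: "iso C (aas N a Z W)"
    and aas_nat: "aas N (tgt C f) (tgt V x) (tgt V y) \<cdot>\<^bsub>C\<^esub> aar N (aar N f x) y
      = aar N f (x \<odot> y) \<cdot>\<^bsub>C\<^esub> aas N (src C f) (src V x) (src V y)"
    and aun_lun: "aar N (idn C a) (lun V Z) \<cdot>\<^bsub>C\<^esub> aas N a \<one> Z = aar N (aun N a) (idn V Z)"
    and aun_run: "aar N (idn C a) (run V Z) \<cdot>\<^bsub>C\<^esub> aas N a Z \<one> = aun N (aob N a Z)"
    and src_aev [simp]: "src C (aev N a b) = aob N a (vhom A a b)"
    and tgt_aev [simp]: "tgt C (aev N a b) = b"
    and aev_universal: "\<lbrakk>src C f = aob N a Z; tgt C f = b\<rbrakk>
      \<Longrightarrow> \<exists>!x. src V x = Z \<and> tgt V x = vhom A a b \<and> aev N a b \<cdot>\<^bsub>C\<^esub> aar N (idn C a) x = f"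
    and aev_vcmp: "\<lbrakk>a \<in> vob A; b \<in> vob A; c \<in> vob A\<rbrakk>
      \<Longrightarrow> aev N a c \<cdot>\<^bsub>C\<^esub> aar N (idn C a) (vcmp A a b c) \<cdot>\<^bsub>C\<^esub> aas N a (vhom A a b) (vhom A b c)
        = aev N b c \<cdot>\<^bsub>C\<^esub> aar N (aev N a b) (idn V (vhom A b c))"
    and aev_vidn: "a \<in> vob A \<Longrightarrow> aev N a a \<cdot>\<^bsub>C\<^esub> aar N (idn C a) (vidn A a) = aun N a"
begin

lemma src_vcmp [simp]: "\<lbrakk>a \<in> vob A; b \<in> vob A; c \<in> vob A\<rbrakk> \<Longrightarrow> src V (vcmp A a b c) = vhom A a b \<otimes> vhom A b c"
  and tgt_vcmp [simp]: "\<lbrakk>a \<in> vob A; b \<in> vob A; c \<in> vob A\<rbrakk> \<Longrightarrow> tgt V (vcmp A a b c) = vhom A a c"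
  using vcmp_in_hom[of a b c] by (simp_all add: in_hom_def)

lemma src_vidn [simp]: "a \<in> vob A \<Longrightarrow> src V (vidn A a) = \<one>"
  and tgt_vidn [simp]: "a \<in> vob A \<Longrightarrow> tgt V (vidn A a) = vhom A a a"
  using vidn_in_hom[of a] by (simp_all add: in_hom_def)

lemma aar_cmp' [simp]: "\<lbrakk>tgt C f = src C f'; tgt V x = src V x'; tgt C k = aob N (src C f) (src V x)\<rbrakk>
    \<Longrightarrow> aar N f' x' \<cdot>\<^bsub>C\<^esub> (aar N f x \<cdot>\<^bsub>C\<^esub> k) = aar N (f' \<cdot>\<^bsub>C\<^esub> f) (x' \<cdot> x) \<cdot>\<^bsub>C\<^esub> k"
  using C.reassoc[OF aar_cmp] by simp

text \<open>Transposition across the tensor-hom adjunction, from generalised elements to the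
  parametrised arrows that they name; \<open>unhat\<close> goes back.\<close>

definition hat :: "'c \<Rightarrow> 'c \<Rightarrow> 'a \<Rightarrow> 'b"
  where "hat a b x = aev N a b \<cdot>\<^bsub>C\<^esub> aar N (idn C a) x"

definition unhat :: "'c \<Rightarrow> 'o \<Rightarrow> 'c \<Rightarrow> 'b \<Rightarrow> 'a"
  where "unhat a Z b f = (THE x. src V x = Z \<and> tgt V x = vhom A a b \<and> hat a b x = f)"

text \<open>The element \<one> \<rightarrow> A(a,b) naming an arrow of C. Through it C is identified
  with the underlying ordinary category of A, see \<open>elem_cmp_elem\<close> and
  \<open>elem_idn\<close>.\<close>

definition elem :: "'b \<Rightarrow> 'a"
  where "elem f = unhat (src C f) \<one> (tgt C f) (f \<cdot>\<^bsub>C\<^esub> aun N (src C f))"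

lemma src_hat [simp]: "tgt V x = vhom A a b \<Longrightarrow> src C (hat a b x) = aob N a (src V x)"
  and tgt_hat [simp]: "tgt V x = vhom A a b \<Longrightarrow> tgt C (hat a b x) = b"
  by (simp_all add: hat_def)

lemma unhat_char:
  assumes "src C f = aob N a Z" "tgt C f = b"
  shows "src V (unhat a Z b f) = Z \<and> tgt V (unhat a Z b f) = vhom A a b \<and> hat a b (unhat a Z b f) = f"
  using theI'[OF aev_universal[of f a Z b]] assms unfolding unhat_def hat_def by simp

lemma src_unhat [simp]: "\<lbrakk>src C f = aob N a Z; tgt C f = b\<rbrakk> \<Longrightarrow> src V (unhat a Z b f) = Z"
  and tgt_unhat [simp]: "\<lbrakk>src C f = aob N a Z; tgt C f = b\<rbrakk> \<Longrightarrow> tgt V (unhat a Z b f) = vhom A a b"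
  and hat_unhat [simp]: "\<lbrakk>src C f = aob N a Z; tgt C f = b\<rbrakk> \<Longrightarrow> hat a b (unhat a Z b f) = f"
  using unhat_char by blast+

lemma hat_inject:
  assumes "tgt V x = vhom A a b" "tgt V y = vhom A a b" "src V x = src V y" "hat a b x = hat a b y"
  shows "x = y"
  using aev_universal[of "hat a b x" a "src V x" b] assms unfolding hat_def by auto

lemma unhat_hat [simp]: "\<lbrakk>tgt V x = vhom A a b; src V x = Z\<rbrakk> \<Longrightarrow> unhat a Z b (hat a b x) = x"
  by (rule hat_inject[of _ a b]) simp_all

lemma hat_idn [simp]: "hat a b (idn V (vhom A a b)) = aev N a b"
  by (simp add: hat_def)

lemma hat_cmp: "\<lbrakk>tgt V x = vhom A a b; tgt V y = src V x\<rbrakk>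
    \<Longrightarrow> hat a b (x \<cdot> y) = hat a b x \<cdot>\<^bsub>C\<^esub> aar N (idn C a) y"
  by (simp add: hat_def)

lemma hat_vidn: "a \<in> vob A \<Longrightarrow> hat a a (vidn A a) = aun N a"
  by (simp add: hat_def aev_vidn)

text \<open>Composition of generalised elements is substitution of parametrised arrows: the result
  of x is fed into y while the parameter of y is carried along, and \<open>aas\<close> splits the
  joint parameter.\<close>

lemma hat_vcmp:
  assumes "a \<in> vob A" "b \<in> vob A" "c \<in> vob A" "tgt V x = vhom A a b" "tgt V y = vhom A b c"
  shows "hat a c (vcmp A a b c \<cdot> (x \<odot> y)) \<cdot>\<^bsub>C\<^esub> aas N a (src V x) (src V y)
    = hat b c y \<cdot>\<^bsub>C\<^esub> aar N (hat a b x) (idn V (src V y))"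
proof -
  have "hat a c (vcmp A a b c \<cdot> (x \<odot> y)) \<cdot>\<^bsub>C\<^esub> aas N a (src V x) (src V y)
    = hat a c (vcmp A a b c) \<cdot>\<^bsub>C\<^esub> (aar N (idn C a) (x \<odot> y) \<cdot>\<^bsub>C\<^esub> aas N a (src V x) (src V y))"
    using assms by (simp add: hat_cmp)
  also have "\<dots> = (aev N a c \<cdot>\<^bsub>C\<^esub> aar N (idn C a) (vcmp A a b c) \<cdot>\<^bsub>C\<^esub> aas N a (vhom A a b) (vhom A b c))
      \<cdot>\<^bsub>C\<^esub> aar N (aar N (idn C a) x) y"
    using assms aas_nat[of "idn C a" x y] by (simp add: hat_def del: aar_cmp aar_cmp')
  also have "\<dots> = hat b c y \<cdot>\<^bsub>C\<^esub> aar N (hat a b x) (idn V (src V y))"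
    unfolding aev_vcmp[OF assms(1-3)] using assms by (simp add: hat_def)
  finally show ?thesis .
qed

lemma src_elem [simp]: "src V (elem f) = \<one>"
  and tgt_elem [simp]: "tgt V (elem f) = vhom A (src C f) (tgt C f)"
  and hat_elem: "hat (src C f) (tgt C f) (elem f) = f \<cdot>\<^bsub>C\<^esub> aun N (src C f)"
  by (simp_all add: elem_def)

lemma hat_elem' [simp]: "\<lbrakk>src C f = a; tgt C f = b\<rbrakk> \<Longrightarrow> hat a b (elem f) = f \<cdot>\<^bsub>C\<^esub> aun N a"
  using hat_elem by blast

lemma elem_eqI:
  assumes "src C f = a" "tgt C f = b" "src V x = \<one>" "tgt V x = vhom A a b"
    and "hat a b x = f \<cdot>\<^bsub>C\<^esub> aun N a"
  shows "x = elem f"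
  by (rule hat_inject[of _ a b]) (use assms in auto)

lemma elem_inject:
  assumes "elem f = elem g" "src C f = src C g" "tgt C f = tgt C g" shows "f = g"
proof -
  have "f \<cdot>\<^bsub>C\<^esub> aun N (src C f) = g \<cdot>\<^bsub>C\<^esub> aun N (src C f)"
    using hat_elem[of f] hat_elem[of g] assms by simp
  then show ?thesis by (rule C.iso_epi[OF aun_iso, rotated 2]) (simp_all add: assms)
qed

lemma elem_exhaust:
  assumes "src V x = \<one>" "tgt V x = vhom A a b"
  obtains f where "src C f = a" "tgt C f = b" "x = elem f"
proof
  let ?f = "hat a b x \<cdot>\<^bsub>C\<^esub> inverse_arrow C (aun N a)"
  show "src C ?f = a" "tgt C ?f = b" using assms by simp_all
  show "x = elem ?f" by (rule elem_eqI[of _ a b]) (use assms in simp_all)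
qed

lemma elem_idn: "a \<in> vob A \<Longrightarrow> elem (idn C a) = vidn A a"
  by (rule elem_eqI[symmetric, of _ a a]) (simp_all add: hat_vidn)

text \<open>An instance of \<open>hat_vcmp\<close> with both parameters the unit.
  \<open>aun_lun\<close> converts the doubled unit parameter into the \<open>lun\<close> that
  \<open>elem_cmp\<close> inverts.\<close>

lemma elem_cmp_elem:
  assumes "src C f = a" "tgt C f = b" "src C g = b" "tgt C g = c"
    and "a \<in> vob A" "b \<in> vob A" "c \<in> vob A"
  shows "elem_cmp V A a b c (elem f) (elem g) = elem (g \<cdot>\<^bsub>C\<^esub> f)"
proof (rule elem_eqI[of _ a c])
  have "hat a c (vcmp A a b c \<cdot> (elem f \<odot> elem g)) \<cdot>\<^bsub>C\<^esub> aas N a \<one> \<one>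
    = (g \<cdot>\<^bsub>C\<^esub> aun N b) \<cdot>\<^bsub>C\<^esub> aar N (f \<cdot>\<^bsub>C\<^esub> aun N a) (idn V \<one>)"
    using hat_vcmp[of a b c "elem f" "elem g"] assms by simp
  also have "\<dots> = (g \<cdot>\<^bsub>C\<^esub> f) \<cdot>\<^bsub>C\<^esub> (aun N a \<cdot>\<^bsub>C\<^esub> aar N (aun N a) (idn V \<one>))"
    using aun_nat[of "f \<cdot>\<^bsub>C\<^esub> aun N a"] aun_nat[of "aun N a"] assms by simp
  also have "aar N (aun N a) (idn V \<one>) = aar N (idn C a) (lun V \<one>) \<cdot>\<^bsub>C\<^esub> aas N a \<one> \<one>"
    by (simp add: aun_lun)
  finally have "hat a c (vcmp A a b c \<cdot> (elem f \<odot> elem g))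
      = ((g \<cdot>\<^bsub>C\<^esub> f) \<cdot>\<^bsub>C\<^esub> aun N a) \<cdot>\<^bsub>C\<^esub> aar N (idn C a) (lun V \<one>)"
    using assms by - (rule C.iso_epi[OF aas_iso[of a \<one> \<one>]], simp_all)
  then show "hat a c (elem_cmp V A a b c (elem f) (elem g)) = (g \<cdot>\<^bsub>C\<^esub> f) \<cdot>\<^bsub>C\<^esub> aun N a"
    using assms hat_cmp[of "vcmp A a b c \<cdot> (elem f \<odot> elem g)" a c "inverse_arrow V (lun V \<one>)"]
    by (simp add: elem_cmp_def)
qed (use assms in \<open>simp_all add: elem_cmp_def\<close>)

end

section \<open>Enriched functors between tensored categories\<close>

locale tensored_pair =
  A: tensored_category V A C M + B: tensored_category V B D N
  for V :: "('o, 'a, 'm) smcat_scheme" (structure)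
    and A :: "('c, 'o, 'a) vcat" and C :: "('c, 'b, 'k) cat_scheme"
    and M :: "('c, 'o, 'a, 'b) action"
    and B :: "('d, 'o, 'a) vcat" and D :: "('d, 'e, 'l) cat_scheme"
    and N :: "('d, 'o, 'a, 'e) action"
begin

text \<open>The action of an enriched functor on parametrised arrows \<open>f : aob a Z \<rightarrow> b\<close>.\<close>

definition pact :: "('c, 'd, 'a) vfun \<Rightarrow> 'c \<Rightarrow> 'o \<Rightarrow> 'c \<Rightarrow> 'b \<Rightarrow> 'e"
  where "pact T a Z b f = B.hat (vfob T a) (vfob T b) (vfar T a b \<cdot> A.unhat a Z b f)"

text \<open>By the Yoneda lemma an operation P that is natural in the parameter is determined by its
  value at \<open>aev\<close>, so the hom arrows of T carry all of P. The functor laws are then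
  checked after \<open>hat\<close>, where they become the unit hypothesis and the substitution
  hypothesis of P.\<close>

lemma enriched_functorI:
  assumes ob: "\<And>a. a \<in> vob A \<Longrightarrow> vfob T a \<in> vob B"
    and ar: "\<And>a b. \<lbrakk>a \<in> vob A; b \<in> vob A\<rbrakk>
      \<Longrightarrow> src V (vfar T a b) = vhom A a b \<and> tgt V (vfar T a b) = vhom B (vfob T a) (vfob T b)"
    and ev: "\<And>a b. \<lbrakk>a \<in> vob A; b \<in> vob A\<rbrakk>
      \<Longrightarrow> B.hat (vfob T a) (vfob T b) (vfar T a b) = P a (vhom A a b) b (aev M a b)"
    and nat: "\<And>a b x f. \<lbrakk>a \<in> vob A; b \<in> vob A; src C f = aob M a (tgt V x); tgt C f = b\<rbrakk>
      \<Longrightarrow> P a (src V x) b (f \<cdot>\<^bsub>C\<^esub> aar M (idn C a) x) = P a (tgt V x) b f \<cdot>\<^bsub>D\<^esub> aar N (idn D (vfob T a)) x"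
    and un: "\<And>a. a \<in> vob A \<Longrightarrow> P a \<one> a (aun M a) = aun N (vfob T a)"
    and as: "\<And>a b c Z W f g h. \<lbrakk>a \<in> vob A; b \<in> vob A; c \<in> vob A; src C f = aob M a Z; tgt C f = b;
        src C g = aob M b W; tgt C g = c; src C h = aob M a (Z \<otimes> W); tgt C h = c;
        h \<cdot>\<^bsub>C\<^esub> aas M a Z W = g \<cdot>\<^bsub>C\<^esub> aar M f (idn V W)\<rbrakk>
      \<Longrightarrow> P a (Z \<otimes> W) c h \<cdot>\<^bsub>D\<^esub> aas N (vfob T a) Z W = P b W c g \<cdot>\<^bsub>D\<^esub> aar N (P a Z b f) (idn V W)"
  shows "enriched_functor V A B T"
proof -
  have P: "B.hat (vfob T a) (vfob T b) (vfar T a b \<cdot> x) = P a (src V x) b (A.hat a b x)"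
    if "a \<in> vob A" "b \<in> vob A" "tgt V x = vhom A a b" for a b x
    using that ar ev nat[of a b "aev M a b" x] by (simp add: B.hat_cmp A.hat_def)
  show ?thesis
  proof (unfold_locales; (unfold in_hom_def)?)
    fix a assume a: "a \<in> vob A"
    show "vfar T a a \<cdot> vidn A a = vidn B (vfob T a)"
      by (rule B.hat_inject[of _ "vfob T a" "vfob T a"])
        (use a ob ar un in \<open>simp_all add: P A.hat_vidn B.hat_vidn\<close>)
  next
    fix a b c assume abc: "a \<in> vob A" "b \<in> vob A" "c \<in> vob A"
    note [simp] = abc ob ar
    let ?a = "vfob T a" and ?b = "vfob T b" and ?c = "vfob T c"
    show "vfar T a c \<cdot> vcmp A a b c = vcmp B ?a ?b ?c \<cdot> (vfar T a b \<odot> vfar T b c)"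
    proof (rule B.hat_inject[of _ ?a ?c])
      have "B.hat ?a ?c (vfar T a c \<cdot> vcmp A a b c) \<cdot>\<^bsub>D\<^esub> aas N ?a (vhom A a b) (vhom A b c)
        = P b (vhom A b c) c (aev M b c) \<cdot>\<^bsub>D\<^esub> aar N (P a (vhom A a b) b (aev M a b)) (idn V (vhom A b c))"
        using A.hat_vcmp[of a b c "idn V (vhom A a b)" "idn V (vhom A b c)"]
        by (simp add: P as)
      also have "\<dots> = B.hat ?a ?c (vcmp B ?a ?b ?c \<cdot> (vfar T a b \<odot> vfar T b c)) \<cdot>\<^bsub>D\<^esub> aas N ?a (vhom A a b) (vhom A b c)"
        using B.hat_vcmp[of ?a ?b ?c "vfar T a b" "vfar T b c"] by (simp add: ev)
      finally show "B.hat ?a ?c (vfar T a c \<cdot> vcmp A a b c) = B.hat ?a ?c (vcmp B ?a ?b ?c \<cdot> (vfar T a b \<odot> vfar T b c))"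
        by (rule B.C.iso_epi[OF B.aas_iso, rotated 2]) simp_all
    qed simp_all
  qed (use ob ar in simp_all)
qed

end

locale tensored_functor = tensored_pair V A C M B D N + enriched_functor V A B T
  for V :: "('o, 'a, 'm) smcat_scheme" (structure)
    and A :: "('c, 'o, 'a) vcat" and C :: "('c, 'b, 'k) cat_scheme"
    and M :: "('c, 'o, 'a, 'b) action"
    and B :: "('d, 'o, 'a) vcat" and D :: "('d, 'e, 'l) cat_scheme"
    and N :: "('d, 'o, 'a, 'e) action"
    and T :: "('c, 'd, 'a) vfun"
begin

lemma src_vfar [simp]: "\<lbrakk>a \<in> vob A; b \<in> vob A\<rbrakk> \<Longrightarrow> src V (vfar T a b) = vhom A a b"
  and tgt_vfar [simp]: "\<lbrakk>a \<in> vob A; b \<in> vob A\<rbrakk> \<Longrightarrow> tgt V (vfar T a b) = vhom B (vfob T a) (vfob T b)"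
  using vfar_in_hom[of a b] by (simp_all add: in_hom_def)

declare vfob_in_vob [simp]

lemma pact_hat: "\<lbrakk>a \<in> vob A; b \<in> vob A; tgt V x = vhom A a b\<rbrakk>
    \<Longrightarrow> pact T a (src V x) b (A.hat a b x) = B.hat (vfob T a) (vfob T b) (vfar T a b \<cdot> x)"
  by (simp add: pact_def)

lemma pact_eq: "\<lbrakk>a \<in> vob A; b \<in> vob A; src C f = aob M a Z; tgt C f = b\<rbrakk>
    \<Longrightarrow> pact T a Z b f = B.hat (vfob T a) (vfob T b) (vfar T a b) \<cdot>\<^bsub>D\<^esub> aar N (idn D (vfob T a)) (A.unhat a Z b f)"
  by (simp add: pact_def B.hat_cmp)

lemma src_pact [simp]: "\<lbrakk>a \<in> vob A; b \<in> vob A; src C f = aob M a Z; tgt C f = b\<rbrakk>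
    \<Longrightarrow> src D (pact T a Z b f) = aob N (vfob T a) Z"
  and tgt_pact [simp]: "\<lbrakk>a \<in> vob A; b \<in> vob A; src C f = aob M a Z; tgt C f = b\<rbrakk>
    \<Longrightarrow> tgt D (pact T a Z b f) = vfob T b"
  by (simp_all add: pact_def)

text \<open>Converse to the last hypothesis of \<open>enriched_functorI\<close>. As
  \<open>aas\<close> is invertible, the equation for h forces h to be the arrow named by the
  composite of the two generalised elements, and T preserves that composite.\<close>

lemma pact_compose:
  assumes abc: "a \<in> vob A" "b \<in> vob A" "c \<in> vob A"
    and fgh: "src C f = aob M a Z" "tgt C f = b" "src C g = aob M b W" "tgt C g = c"
      "src C h = aob M a (Z \<otimes> W)" "tgt C h = c" "h \<cdot>\<^bsub>C\<^esub> aas M a Z W = g \<cdot>\<^bsub>C\<^esub> aar M f (idn V W)"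
  shows "pact T a (Z \<otimes> W) c h \<cdot>\<^bsub>D\<^esub> aas N (vfob T a) Z W = pact T b W c g \<cdot>\<^bsub>D\<^esub> aar N (pact T a Z b f) (idn V W)"
proof -
  let ?x = "A.unhat a Z b f" and ?y = "A.unhat b W c g"
  have "A.hat a c (vcmp A a b c \<cdot> (?x \<odot> ?y)) \<cdot>\<^bsub>C\<^esub> aas M a Z W = h \<cdot>\<^bsub>C\<^esub> aas M a Z W"
    using A.hat_vcmp[of a b c ?x ?y] abc fgh by simp
  then have h: "A.hat a c (vcmp A a b c \<cdot> (?x \<odot> ?y)) = h"
    by (rule A.C.iso_epi[OF A.aas_iso, rotated 2]) (use abc fgh in simp_all)
  have "pact T a (Z \<otimes> W) c h = B.hat (vfob T a) (vfob T c) (vfar T a c \<cdot> (vcmp A a b c \<cdot> (?x \<odot> ?y)))"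
    using pact_hat[of a c "vcmp A a b c \<cdot> (?x \<odot> ?y)"] abc fgh by (simp add: h)
  also have "\<dots> = B.hat (vfob T a) (vfob T c) (vcmp B (vfob T a) (vfob T b) (vfob T c) \<cdot> ((vfar T a b \<cdot> ?x) \<odot> (vfar T b c \<cdot> ?y)))"
    using A.reassoc[OF vfar_vcmp[OF abc]] abc fgh by simp
  finally show ?thesis
    using B.hat_vcmp[of "vfob T a" "vfob T b" "vfob T c" "vfar T a b \<cdot> ?x" "vfar T b c \<cdot> ?y"] abc fgh
    by (simp add: pact_def)
qed

text \<open>An ordinary arrow is a parametrised one with unit parameter, up to \<open>aun\<close>.
  Hence \<open>pact\<close> at the unit computes the underlying functor of T.\<close>

lemma vfar_elem:
  assumes "src C f = a" "tgt C f = b" "a \<in> vob A" "b \<in> vob A"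
    and "src D g = vfob T a" "tgt D g = vfob T b"
    and "pact T a \<one> b (f \<cdot>\<^bsub>C\<^esub> aun M a) = g \<cdot>\<^bsub>D\<^esub> aun N (vfob T a)"
  shows "vfar T a b \<cdot> A.elem f = B.elem g"
  by (rule B.elem_eqI[of _ "vfob T a" "vfob T b"])
    (use assms pact_hat[of a b "A.elem f"] in simp_all)

end

section \<open>Enriched transformations and monads in terms of ordinary arrows\<close>

context tensored_pair
begin

text \<open>Both sides of the enriched naturality condition are generalised elements with parameter
  A(a,b), and \<open>hat\<close> is injective on these. The unit parameter contributed by the
  component is absorbed by \<open>aun_lun\<close> on one side and by \<open>aun_nat\<close> with
  \<open>aun_run\<close> on the other.\<close>

lemma comp_natural_iff:
  assumes "enriched_functor V A B S" "enriched_functor V A B T"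
    and ab: "a \<in> vob A" "b \<in> vob A"
    and s: "src D s = vfob S a" "tgt D s = vfob T a" "src D s' = vfob S b" "tgt D s' = vfob T b"
  shows "vcmp B (vfob S a) (vfob T a) (vfob T b) \<cdot> (B.elem s \<odot> vfar T a b)
            \<cdot> inverse_arrow V (lun V (vhom A a b))
        = vcmp B (vfob S a) (vfob S b) (vfob T b) \<cdot> (vfar S a b \<odot> B.elem s')
            \<cdot> inverse_arrow V (run V (vhom A a b))
    \<longleftrightarrow> B.hat (vfob T a) (vfob T b) (vfar T a b) \<cdot>\<^bsub>D\<^esub> aar N s (idn V (vhom A a b))
        = s' \<cdot>\<^bsub>D\<^esub> B.hat (vfob S a) (vfob S b) (vfar S a b)" (is "?l = ?r \<longleftrightarrow> ?p = ?q")
proof -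
  interpret S: tensored_functor V A C M B D N S
    using assms(1) by (simp add: tensored_functor_def tensored_pair_axioms)
  interpret T: tensored_functor V A C M B D N T
    using assms(2) by (simp add: tensored_functor_def tensored_pair_axioms)
  note [simp] = ab s
  let ?W = "vhom A a b" and ?Sa = "vfob S a" and ?Tb = "vfob T b"
  let ?l' = "vcmp B ?Sa (vfob T a) ?Tb \<cdot> (B.elem s \<odot> vfar T a b)"
  let ?r' = "vcmp B ?Sa (vfob S b) ?Tb \<cdot> (vfar S a b \<odot> B.elem s')"
  have "B.hat ?Sa ?Tb ?l' \<cdot>\<^bsub>D\<^esub> aas N ?Sa \<one> ?W
      = B.hat (vfob T a) ?Tb (vfar T a b) \<cdot>\<^bsub>D\<^esub> aar N (s \<cdot>\<^bsub>D\<^esub> aun N ?Sa) (idn V ?W)"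
    using B.hat_vcmp[of ?Sa "vfob T a" ?Tb "B.elem s" "vfar T a b"] by simp
  also have "\<dots> = ?p \<cdot>\<^bsub>D\<^esub> (aar N (idn D ?Sa) (lun V ?W) \<cdot>\<^bsub>D\<^esub> aas N ?Sa \<one> ?W)"
    by (simp add: B.aun_lun)
  finally have "B.hat ?Sa ?Tb ?l' = ?p \<cdot>\<^bsub>D\<^esub> aar N (idn D ?Sa) (lun V ?W)"
    by - (rule B.C.iso_epi[OF B.aas_iso[of ?Sa \<one> ?W]], simp_all)
  then have l: "B.hat ?Sa ?Tb ?l = ?p"
    using B.hat_cmp[of ?l' ?Sa ?Tb "inverse_arrow V (lun V ?W)"] by simp
  have "B.hat ?Sa ?Tb ?r' \<cdot>\<^bsub>D\<^esub> aas N ?Sa ?W \<one>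
      = (s' \<cdot>\<^bsub>D\<^esub> aun N (vfob S b)) \<cdot>\<^bsub>D\<^esub> aar N (B.hat ?Sa (vfob S b) (vfar S a b)) (idn V \<one>)"
    using B.hat_vcmp[of ?Sa "vfob S b" ?Tb "vfar S a b" "B.elem s'"] by simp
  also have "\<dots> = ?q \<cdot>\<^bsub>D\<^esub> (aar N (idn D ?Sa) (run V ?W) \<cdot>\<^bsub>D\<^esub> aas N ?Sa ?W \<one>)"
    using B.aun_nat[of "B.hat ?Sa (vfob S b) (vfar S a b)"] by (simp add: B.aun_run)
  finally have "B.hat ?Sa ?Tb ?r' = ?q \<cdot>\<^bsub>D\<^esub> aar N (idn D ?Sa) (run V ?W)"
    by - (rule B.C.iso_epi[OF B.aas_iso[of ?Sa ?W \<one>]], simp_all)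
  then have r: "B.hat ?Sa ?Tb ?r = ?q"
    using B.hat_cmp[of ?r' ?Sa ?Tb "inverse_arrow V (run V ?W)"] by simp
  show ?thesis
    using l r B.hat_inject[of ?l ?Sa ?Tb ?r] by auto
qed

lemma enriched_transformationI:
  assumes "enriched_functor V A B S" "enriched_functor V A B T"
    and "\<And>a. a \<in> vob A \<Longrightarrow> t a = B.elem (s a)"
    and "\<And>a. a \<in> vob A \<Longrightarrow> src D (s a) = vfob S a"
    and "\<And>a. a \<in> vob A \<Longrightarrow> tgt D (s a) = vfob T a"
    and "\<And>a b. \<lbrakk>a \<in> vob A; b \<in> vob A\<rbrakk>
      \<Longrightarrow> B.hat (vfob T a) (vfob T b) (vfar T a b) \<cdot>\<^bsub>D\<^esub> aar N (s a) (idn V (vhom A a b))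
        = s b \<cdot>\<^bsub>D\<^esub> B.hat (vfob S a) (vfob S b) (vfar S a b)"
  shows "enriched_transformation V A B S T t"
proof -
  interpret S: enriched_functor V A B S by fact
  interpret T: enriched_functor V A B T by fact
  show ?thesis
  proof (unfold_locales; (unfold in_hom_def)?)
    fix a b assume ab: "a \<in> vob A" "b \<in> vob A"
    show "vcmp B (vfob S a) (vfob T a) (vfob T b) \<cdot> (t a \<odot> vfar T a b) \<cdot> inverse_arrow V (lun V (vhom A a b))
        = vcmp B (vfob S a) (vfob S b) (vfob T b) \<cdot> (vfar S a b \<odot> t b) \<cdot> inverse_arrow V (run V (vhom A a b))"
      using comp_natural_iff[OF assms(1,2) ab, of "s a" "s b"] ab assms(3-6) by simp
  qed (use assms(3-5) in simp_all)
qed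

lemma enriched_transformationD:
  assumes "enriched_transformation V A B S T t" "a \<in> vob A" "b \<in> vob A"
    and "t a = B.elem s" "t b = B.elem s'"
    and "src D s = vfob S a" "tgt D s = vfob T a" "src D s' = vfob S b" "tgt D s' = vfob T b"
  shows "B.hat (vfob T a) (vfob T b) (vfar T a b) \<cdot>\<^bsub>D\<^esub> aar N s (idn V (vhom A a b))
        = s' \<cdot>\<^bsub>D\<^esub> B.hat (vfob S a) (vfob S b) (vfar S a b)"
proof -
  interpret t: enriched_transformation V A B S T t by fact
  show ?thesis
    using comp_natural_iff[OF t.S.enriched_functor_axioms t.T.enriched_functor_axioms assms(2,3,6-9)]
      t.comp_natural[OF assms(2,3)] assms(4,5) by simp
qed

end

context tensored_category
begin

text \<open>Whiskering with the monad on the left applies the enriched functor to an element. U is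
  its underlying functor on arrows of C, so that the monad laws can be stated and checked as
  equations in C; only the two naturality conditions still involve the enrichment.\<close>

lemma enriched_monadI:
  assumes T: "enriched_functor V A A (mfun M)"
    and e: "\<And>a. a \<in> vob A \<Longrightarrow> munit M a = elem (e a)"
    and m: "\<And>a. a \<in> vob A \<Longrightarrow> mmult M a = elem (m a)"
    and [simp]: "\<And>a. a \<in> vob A \<Longrightarrow> src C (e a) = a" "\<And>a. a \<in> vob A \<Longrightarrow> tgt C (e a) = vfob (mfun M) a"
      "\<And>a. a \<in> vob A \<Longrightarrow> src C (m a) = vfob (mfun M) (vfob (mfun M) a)"
      "\<And>a. a \<in> vob A \<Longrightarrow> tgt C (m a) = vfob (mfun M) a"
    and e_nat: "\<And>a b. \<lbrakk>a \<in> vob A; b \<in> vob A\<rbrakk>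
      \<Longrightarrow> hat (vfob (mfun M) a) (vfob (mfun M) b) (vfar (mfun M) a b) \<cdot>\<^bsub>C\<^esub> aar N (e a) (idn V (vhom A a b))
        = e b \<cdot>\<^bsub>C\<^esub> aev N a b"
    and m_nat: "\<And>a b. \<lbrakk>a \<in> vob A; b \<in> vob A\<rbrakk>
      \<Longrightarrow> hat (vfob (mfun M) a) (vfob (mfun M) b) (vfar (mfun M) a b) \<cdot>\<^bsub>C\<^esub> aar N (m a) (idn V (vhom A a b))
        = m b \<cdot>\<^bsub>C\<^esub> hat (vfob (mfun M) (vfob (mfun M) a)) (vfob (mfun M) (vfob (mfun M) b))
            (vfar (mfun M) (vfob (mfun M) a) (vfob (mfun M) b) \<cdot> vfar (mfun M) a b)"
    and U: "\<And>f. \<lbrakk>src C f \<in> vob A; tgt C f \<in> vob A\<rbrakk>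
      \<Longrightarrow> vfar (mfun M) (src C f) (tgt C f) \<cdot> elem f = elem (U f)"
    and U_src [simp]: "\<And>f. src C (U f) = vfob (mfun M) (src C f)"
    and U_tgt [simp]: "\<And>f. tgt C (U f) = vfob (mfun M) (tgt C f)"
    and "\<And>a. a \<in> vob A \<Longrightarrow> m a \<cdot>\<^bsub>C\<^esub> e (vfob (mfun M) a) = idn C (vfob (mfun M) a)"
    and "\<And>a. a \<in> vob A \<Longrightarrow> m a \<cdot>\<^bsub>C\<^esub> U (e a) = idn C (vfob (mfun M) a)"
    and "\<And>a. a \<in> vob A \<Longrightarrow> m a \<cdot>\<^bsub>C\<^esub> m (vfob (mfun M) a) = m a \<cdot>\<^bsub>C\<^esub> U (m a)"
  shows "enriched_monad V A M"
proof -
  interpret tensored_pair V A C N A C N ..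
  interpret T: enriched_functor V A A "mfun M" by fact
  note [simp] = T.vfob_in_vob e m
  have U': "vfar (mfun M) a b \<cdot> elem f = elem (U f)"
    if "src C f = a" "tgt C f = b" "a \<in> vob A" "b \<in> vob A" for a b f
    using U[of f] that by simp
  show ?thesis
  proof (intro enriched_monad.intro enriched_monad_axioms.intro)
    show "enriched_transformation V A A (vfun_id V A) (mfun M) (munit M)"
      by (rule enriched_transformationI[where s = e])
        (use enriched_functor_id[OF enriched_category_axioms] T e_nat in simp_all)
    show "enriched_transformation V A A (vfun_comp V (mfun M) (mfun M)) (mfun M) (mmult M)"
      by (rule enriched_transformationI[where s = m])
        (use enriched_functor_comp[OF T T] T m_nat in simp_all)
  qed (use assms(12-) in \<open>simp_all add: vtrans_comp_def whisker_pre_def whisker_post_def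
      elem_cmp_elem elem_idn U'\<close>)
qed

end

section \<open>Self-enrichment and change of base\<close>

definition self_action :: "('o, 'a, 'm) csmcat_scheme \<Rightarrow> ('o, 'o, 'a, 'a) action"
  where "self_action V = \<lparr>aob = tob V, aar = tar V, aun = run V, aas = asc V, aev = ev V\<rparr>"

lemma self_action_simps [simp]:
  "aob (self_action V) = tob V" "aar (self_action V) = tar V" "aun (self_action V) = run V"
  "aas (self_action V) = asc V" "aev (self_action V) = ev V"
  by (simp_all add: self_action_def)

lemma self_enriched_simps [simp]: "vob (self_enriched V) = UNIV" "vhom (self_enriched V) = ihom V"
  by (simp_all add: self_enriched_def)

context closed_symmetric_monoidal_category
begin

abbreviation (input) self_cmp where "self_cmp \<equiv> vcmp (self_enriched V)"

lemma src_self_cmp [simp]: "src V (self_cmp A B D) = ihom V A B \<otimes> ihom V B D"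
  and tgt_self_cmp [simp]: "tgt V (self_cmp A B D) = ihom V A D"
  and ev_self_cmp: "ev V A D \<cdot> (idn V A \<odot> self_cmp A B D) \<cdot> asc V A (ihom V A B) (ihom V B D)
    = ev V B D \<cdot> (ev V A B \<odot> idn V (ihom V B D))"
  by (simp_all add: self_enriched_def)

lemma src_self_idn [simp]: "src V (vidn (self_enriched V) A) = \<one>"
  and tgt_self_idn [simp]: "tgt V (vidn (self_enriched V) A) = ihom V A A"
  and ev_self_idn [simp]: "ev V A A \<cdot> (idn V A \<odot> vidn (self_enriched V) A) = run V A"
  by (simp_all add: self_enriched_def)

text \<open>This is \<open>hat_vcmp\<close> for the self-enrichment. It is derived separately
  because \<open>tensored_category\<close> presupposes the enriched category laws that it serves to
  prove.\<close>

lemma ev_self_cmp_tar: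
  assumes "tgt V x = ihom V A B" "tgt V y = ihom V B D"
  shows "ev V A D \<cdot> (idn V A \<odot> (self_cmp A B D \<cdot> (x \<odot> y))) \<cdot> asc V A (src V x) (src V y)
    = (ev V B D \<cdot> (idn V B \<odot> y)) \<cdot> ((ev V A B \<cdot> (idn V A \<odot> x)) \<odot> idn V (src V y))"
proof -
  have "ev V A D \<cdot> (idn V A \<odot> (self_cmp A B D \<cdot> (x \<odot> y))) \<cdot> asc V A (src V x) (src V y)
    = ev V A D \<cdot> ((idn V A \<odot> self_cmp A B D) \<cdot> ((idn V A \<odot> (x \<odot> y)) \<cdot> asc V A (src V x) (src V y)))"
    using assms by simp
  also have "\<dots> = (ev V A D \<cdot> (idn V A \<odot> self_cmp A B D) \<cdot> asc V A (ihom V A B) (ihom V B D)) \<cdot> ((idn V A \<odot> x) \<odot> y)"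
    using assms asc_nat[of A "idn V A" "ihom V A B" x "ihom V B D" y] by simp
  also have "\<dots> = ev V B D \<cdot> ((ev V A B \<cdot> (idn V A \<odot> x)) \<odot> y)"
    unfolding ev_self_cmp using assms by simp
  finally show ?thesis using assms by simp
qed

lemma enriched_category_self: "enriched_category V (self_enriched V)"
proof (unfold_locales; (unfold in_hom_def)?)
  fix A B
  have "ev V A B \<cdot> (idn V A \<odot> (self_cmp A A B \<cdot> (vidn (self_enriched V) A \<odot> idn V (ihom V A B))))
      \<cdot> asc V A \<one> (ihom V A B) = ev V A B \<cdot> (idn V A \<odot> lun V (ihom V A B)) \<cdot> asc V A \<one> (ihom V A B)"
    using ev_self_cmp_tar[of "vidn (self_enriched V) A" A A "idn V (ihom V A B)" B]
    by (simp add: triangle)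
  then have "ev V A B \<cdot> (idn V A \<odot> (self_cmp A A B \<cdot> (vidn (self_enriched V) A \<odot> idn V (ihom V A B))))
      = ev V A B \<cdot> (idn V A \<odot> lun V (ihom V A B))"
    by (rule iso_epi[OF asc_iso, rotated 2]) simp_all
  then show "self_cmp A A B \<cdot> (vidn (self_enriched V) A \<odot> idn V (vhom (self_enriched V) A B)) = lun V (vhom (self_enriched V) A B)"
    by - (rule ev_eqI[of _ A B], simp_all)
  have "ev V A B \<cdot> (idn V A \<odot> (self_cmp A B B \<cdot> (idn V (ihom V A B) \<odot> vidn (self_enriched V) B)))
      \<cdot> asc V A (ihom V A B) \<one> = ev V A B \<cdot> (idn V A \<odot> run V (ihom V A B)) \<cdot> asc V A (ihom V A B) \<one>"
    using ev_self_cmp_tar[of "idn V (ihom V A B)" A B "vidn (self_enriched V) B" B] run_nat[of B "ev V A B"]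
    by (simp add: run_tensor)
  then have "ev V A B \<cdot> (idn V A \<odot> (self_cmp A B B \<cdot> (idn V (ihom V A B) \<odot> vidn (self_enriched V) B)))
      = ev V A B \<cdot> (idn V A \<odot> run V (ihom V A B))"
    by (rule iso_epi[OF asc_iso, rotated 2]) simp_all
  then show "self_cmp A B B \<cdot> (idn V (vhom (self_enriched V) A B) \<odot> vidn (self_enriched V) B) = run V (vhom (self_enriched V) A B)"
    by - (rule ev_eqI[of _ A B], simp_all)
next
  fix a b c d
  let ?x = "ihom V a b" and ?y = "ihom V b c" and ?z = "ihom V c d" and ?i = "idn V a"
  let ?u = "self_cmp a c d \<cdot> (self_cmp a b c \<odot> idn V ?z)"
  let ?w = "self_cmp a b d \<cdot> (idn V ?x \<odot> self_cmp b c d)"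
  \<comment> \<open>Both triple composites evaluate to three successive evaluations. The bracketings
    of the parameters differ and are compared by the pentagon, which is why the whole equation is
    first precomposed with two associators.\<close>
  have "(ev V a d \<cdot> (?i \<odot> ?u)) \<cdot> (asc V a (?x \<otimes> ?y) ?z \<cdot> (asc V a ?x ?y \<odot> idn V ?z))
    = (ev V a d \<cdot> (?i \<odot> ?u) \<cdot> asc V a (?x \<otimes> ?y) ?z) \<cdot> (asc V a ?x ?y \<odot> idn V ?z)"
    by simp
  also have "\<dots> = ev V c d \<cdot> ((ev V a c \<cdot> (?i \<odot> self_cmp a b c) \<cdot> asc V a ?x ?y) \<odot> idn V ?z)"
    using ev_self_cmp_tar[of "self_cmp a b c" a c "idn V ?z" d] by simp
  also have "\<dots> = ev V c d \<cdot> ((ev V b c \<odot> idn V ?z) \<cdot> ((ev V a b \<odot> idn V ?y) \<odot> idn V ?z))"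
    unfolding ev_self_cmp by simp
  also have "\<dots> = (ev V b d \<cdot> (idn V b \<odot> self_cmp b c d) \<cdot> asc V b ?y ?z) \<cdot> ((ev V a b \<odot> idn V ?y) \<odot> idn V ?z)"
    unfolding ev_self_cmp by simp
  also have "\<dots> = ev V b d \<cdot> ((idn V b \<odot> self_cmp b c d) \<cdot> ((ev V a b \<odot> (idn V ?y \<odot> idn V ?z)) \<cdot> asc V (a \<otimes> ?x) ?y ?z))"
    using asc_nat[of b "ev V a b" ?y "idn V ?y" ?z "idn V ?z"] by (simp del: tar_idn' tar_tar)
  also have "\<dots> = (ev V a d \<cdot> (?i \<odot> ?w) \<cdot> asc V a ?x (?y \<otimes> ?z)) \<cdot> asc V (a \<otimes> ?x) ?y ?z"
    using ev_self_cmp_tar[of "idn V ?x" a b "self_cmp b c d" d] by simp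
  also have "\<dots> = (ev V a d \<cdot> (?i \<odot> (?w \<cdot> asc V ?x ?y ?z))) \<cdot> (asc V a (?x \<otimes> ?y) ?z \<cdot> (asc V a ?x ?y \<odot> idn V ?z))"
    by (simp add: pentagon)
  finally have "ev V a d \<cdot> (?i \<odot> ?u) \<cdot> asc V a (?x \<otimes> ?y) ?z = ev V a d \<cdot> (?i \<odot> (?w \<cdot> asc V ?x ?y ?z)) \<cdot> asc V a (?x \<otimes> ?y) ?z"
    by - (rule iso_epi[OF tar_iso[OF asc_iso iso_idn], of _ a ?x ?y ?z], simp_all)
  then have "ev V a d \<cdot> (?i \<odot> ?u) = ev V a d \<cdot> (?i \<odot> (?w \<cdot> asc V ?x ?y ?z))"
    by (rule iso_epi[OF asc_iso, rotated 2]) simp_all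
  then show "self_cmp a c d \<cdot> (self_cmp a b c \<odot> idn V (vhom (self_enriched V) c d))
        = self_cmp a b d \<cdot> (idn V (vhom (self_enriched V) a b) \<odot> self_cmp b c d)
          \<cdot> asc V (vhom (self_enriched V) a b) (vhom (self_enriched V) b c) (vhom (self_enriched V) c d)"
    by - (rule ev_eqI[of _ a d], simp_all)
qed simp_all

lemma tensored_self: "tensored_category V (self_enriched V) V (self_action V)"
proof -
  interpret E: enriched_category V "self_enriched V" by (rule enriched_category_self)
  show ?thesis
  proof (unfold_locales, goal_cases)
    \<comment> \<open>Goal 17 is \<open>aev_universal\<close>, here the universal property of
      \<open>ev\<close>.\<close>
    case (17 f a Z b)
    show ?case using ev_universal[of f a Z b] 17 unfolding in_hom_def by simp
  qed (simp_all add: run_nat asc_nat triangle run_tensor ev_self_cmp[unfolded self_enriched_simps])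
qed

end

sublocale closed_symmetric_monoidal_category \<subseteq> self: tensored_category V "self_enriched V" V "self_action V"
  by (rule tensored_self)

context closed_symmetric_monoidal_category
begin

lemma self_hat: "self.hat A B x = ev V A B \<cdot> (idn V A \<odot> x)"
  by (simp add: self.hat_def)

lemma self_hat_idn [simp]: "self.hat A B (idn V (ihom V A B)) = ev V A B"
  by (simp add: self_hat)

lemma untranspose_eq: "untranspose V A B x = self.hat A B x"
  by (simp add: self.hat_def untranspose_def)

lemma transpose_eq: "transpose V A D B f = self.unhat A D B f"
  by (simp add: self.unhat_def transpose_def self_hat in_hom_def conj_assoc)

lemma elem_of_eq: "elem_of V f = self.elem f"
  by (simp add: self.elem_def elem_of_def transpose_eq)

lemma arrow_of_elem: "\<lbrakk>src V f = A; tgt V f = B\<rbrakk> \<Longrightarrow> arrow_of V A B (self.elem f) = f"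
  by (simp add: arrow_of_def untranspose_eq)

end

section \<open>Lax monoidal functors and change of base\<close>

context symmetric_monoidal_functor
begin

lemma src_far [simp]: "src D (far F f) = fob F (src C f)" and tgt_far [simp]: "tgt D (far F f) = fob F (tgt C f)"
  using far_in_hom[of f "src C f" "tgt C f"] by (simp_all add: in_hom_def)

lemma src_phi0 [simp]: "src D (phi0 F) = \<one>\<^bsub>D\<^esub>" and tgt_phi0 [simp]: "tgt D (phi0 F) = fob F \<one>\<^bsub>C\<^esub>"
  using phi0_in_hom by (simp_all add: in_hom_def)

lemma src_phi2 [simp]: "src D (phi2 F A B) = fob F A \<otimes>\<^bsub>D\<^esub> fob F B"
  and tgt_phi2 [simp]: "tgt D (phi2 F A B) = fob F (A \<otimes>\<^bsub>C\<^esub> B)"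
  using phi2_in_hom[of A B] by (simp_all add: in_hom_def)

declare far_idn [simp]

lemma far_comp [simp]: "tgt C f = src C g \<Longrightarrow> far F (g \<cdot>\<^bsub>C\<^esub> f) = far F g \<cdot>\<^bsub>D\<^esub> far F f"
  using far_cmp by (simp add: in_hom_def)

lemma phi2_nat: "\<lbrakk>A = tgt C f; B = tgt C g\<rbrakk>
    \<Longrightarrow> phi2 F A B \<cdot>\<^bsub>D\<^esub> (far F f \<odot>\<^bsub>D\<^esub> far F g) = far F (f \<odot>\<^bsub>C\<^esub> g) \<cdot>\<^bsub>D\<^esub> phi2 F (src C f) (src C g)"
  using phi2_natural by (simp add: in_hom_def)

lemma phi2_nat_left: "B = tgt C f
    \<Longrightarrow> phi2 F B E \<cdot>\<^bsub>D\<^esub> (far F f \<odot>\<^bsub>D\<^esub> idn D (fob F E)) = far F (f \<odot>\<^bsub>C\<^esub> idn C E) \<cdot>\<^bsub>D\<^esub> phi2 F (src C f) E"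
  using phi2_nat[of B f E "idn C E"] by simp

lemma phi2_nat_right: "B = tgt C f
    \<Longrightarrow> phi2 F E B \<cdot>\<^bsub>D\<^esub> (idn D (fob F E) \<odot>\<^bsub>D\<^esub> far F f) = far F (idn C E \<odot>\<^bsub>C\<^esub> f) \<cdot>\<^bsub>D\<^esub> phi2 F E (src C f)"
  using phi2_nat[of E "idn C E" B f] by simp

text \<open>Naturality of \<open>phi2\<close> moves the structure arrows of A together under F,
  where the corresponding law of A applies; what remains is the coherence law
  \<open>phi_lun\<close>, \<open>phi_run\<close> or \<open>phi_asc\<close>.\<close>

lemma enriched_category_base:
  assumes "enriched_category C A" shows "enriched_category D (base_cat D F A)"
proof -
  interpret A: enriched_category C A by fact
  note [simp] =
    A.vcmp_in_hom[unfolded in_hom_def, THEN conjunct1] A.vcmp_in_hom[unfolded in_hom_def, THEN conjunct2]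
    A.vidn_in_hom[unfolded in_hom_def, THEN conjunct1] A.vidn_in_hom[unfolded in_hom_def, THEN conjunct2]
  show ?thesis
  proof (unfold_locales; (unfold in_hom_def)?)
    fix a b assume "a \<in> vob (base_cat D F A)" "b \<in> vob (base_cat D F A)"
    then have [simp]: "a \<in> vob A" "b \<in> vob A" by (simp_all add: base_cat_def)
    let ?h = "vhom A a b"
    have "(far F (vcmp A a a b) \<cdot>\<^bsub>D\<^esub> phi2 F (vhom A a a) ?h) \<cdot>\<^bsub>D\<^esub> ((far F (vidn A a) \<cdot>\<^bsub>D\<^esub> phi0 F) \<odot>\<^bsub>D\<^esub> idn D (fob F ?h))
      = far F (vcmp A a a b) \<cdot>\<^bsub>D\<^esub> (phi2 F (vhom A a a) ?h \<cdot>\<^bsub>D\<^esub> (far F (vidn A a) \<odot>\<^bsub>D\<^esub> idn D (fob F ?h)))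
        \<cdot>\<^bsub>D\<^esub> (phi0 F \<odot>\<^bsub>D\<^esub> idn D (fob F ?h))" by simp
    also have "\<dots> = far F (vcmp A a a b \<cdot>\<^bsub>C\<^esub> (vidn A a \<odot>\<^bsub>C\<^esub> idn C ?h)) \<cdot>\<^bsub>D\<^esub> phi2 F \<one>\<^bsub>C\<^esub> ?h \<cdot>\<^bsub>D\<^esub> (phi0 F \<odot>\<^bsub>D\<^esub> idn D (fob F ?h))"
      by (simp add: phi2_nat_left)
    finally show "vcmp (base_cat D F A) a a b \<cdot>\<^bsub>D\<^esub> (vidn (base_cat D F A) a \<odot>\<^bsub>D\<^esub> idn D (vhom (base_cat D F A) a b))
        = lun D (vhom (base_cat D F A) a b)"
      by (simp add: base_cat_def base_elem_def A.vcmp_vidn_left phi_lun[simplified])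
    let ?p = "idn D (fob F ?h)"
    have "(far F (vcmp A a b b) \<cdot>\<^bsub>D\<^esub> phi2 F ?h (vhom A b b)) \<cdot>\<^bsub>D\<^esub> (?p \<odot>\<^bsub>D\<^esub> (far F (vidn A b) \<cdot>\<^bsub>D\<^esub> phi0 F))
      = far F (vcmp A a b b) \<cdot>\<^bsub>D\<^esub> (phi2 F ?h (vhom A b b) \<cdot>\<^bsub>D\<^esub> (?p \<odot>\<^bsub>D\<^esub> far F (vidn A b))) \<cdot>\<^bsub>D\<^esub> (?p \<odot>\<^bsub>D\<^esub> phi0 F)"
      by simp
    also have "\<dots> = far F (vcmp A a b b \<cdot>\<^bsub>C\<^esub> (idn C ?h \<odot>\<^bsub>C\<^esub> vidn A b)) \<cdot>\<^bsub>D\<^esub> phi2 F ?h \<one>\<^bsub>C\<^esub> \<cdot>\<^bsub>D\<^esub> (?p \<odot>\<^bsub>D\<^esub> phi0 F)"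
      by (simp add: phi2_nat_right)
    finally show "vcmp (base_cat D F A) a b b \<cdot>\<^bsub>D\<^esub> (idn D (vhom (base_cat D F A) a b) \<odot>\<^bsub>D\<^esub> vidn (base_cat D F A) b)
        = run D (vhom (base_cat D F A) a b)"
      by (simp add: base_cat_def base_elem_def A.vcmp_vidn_right phi_run[simplified])
  next
    fix a b c d assume "a \<in> vob (base_cat D F A)" "b \<in> vob (base_cat D F A)"
      "c \<in> vob (base_cat D F A)" "d \<in> vob (base_cat D F A)"
    then have [simp]: "a \<in> vob A" "b \<in> vob A" "c \<in> vob A" "d \<in> vob A" by (simp_all add: base_cat_def)
    let ?x = "vhom A a b" and ?y = "vhom A b c" and ?z = "vhom A c d"
    let ?m = "\<lambda>a b c. far F (vcmp A a b c) \<cdot>\<^bsub>D\<^esub> phi2 F (vhom A a b) (vhom A b c)"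
    have "?m a c d \<cdot>\<^bsub>D\<^esub> (?m a b c \<odot>\<^bsub>D\<^esub> idn D (fob F ?z))
      = far F (vcmp A a c d) \<cdot>\<^bsub>D\<^esub> (phi2 F (vhom A a c) ?z \<cdot>\<^bsub>D\<^esub> (far F (vcmp A a b c) \<odot>\<^bsub>D\<^esub> idn D (fob F ?z)))
        \<cdot>\<^bsub>D\<^esub> (phi2 F ?x ?y \<odot>\<^bsub>D\<^esub> idn D (fob F ?z))" by simp
    also have "\<dots> = far F (vcmp A a c d \<cdot>\<^bsub>C\<^esub> (vcmp A a b c \<odot>\<^bsub>C\<^esub> idn C ?z)) \<cdot>\<^bsub>D\<^esub> phi2 F (?x \<otimes>\<^bsub>C\<^esub> ?y) ?z
        \<cdot>\<^bsub>D\<^esub> (phi2 F ?x ?y \<odot>\<^bsub>D\<^esub> idn D (fob F ?z))"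
      by (simp add: phi2_nat_left)
    also have "\<dots> = far F (vcmp A a b d) \<cdot>\<^bsub>D\<^esub> far F (idn C ?x \<odot>\<^bsub>C\<^esub> vcmp A b c d) \<cdot>\<^bsub>D\<^esub>
        (far F (asc C ?x ?y ?z) \<cdot>\<^bsub>D\<^esub> phi2 F (?x \<otimes>\<^bsub>C\<^esub> ?y) ?z \<cdot>\<^bsub>D\<^esub> (phi2 F ?x ?y \<odot>\<^bsub>D\<^esub> idn D (fob F ?z)))"
      by (simp add: A.vcmp_assoc)
    also have "\<dots> = far F (vcmp A a b d) \<cdot>\<^bsub>D\<^esub> (far F (idn C ?x \<odot>\<^bsub>C\<^esub> vcmp A b c d) \<cdot>\<^bsub>D\<^esub> phi2 F ?x (?y \<otimes>\<^bsub>C\<^esub> ?z))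
        \<cdot>\<^bsub>D\<^esub> (idn D (fob F ?x) \<odot>\<^bsub>D\<^esub> phi2 F ?y ?z) \<cdot>\<^bsub>D\<^esub> asc D (fob F ?x) (fob F ?y) (fob F ?z)"
      unfolding phi_asc by simp
    also have "\<dots> = far F (vcmp A a b d) \<cdot>\<^bsub>D\<^esub> (phi2 F ?x (vhom A b d) \<cdot>\<^bsub>D\<^esub> (idn D (fob F ?x) \<odot>\<^bsub>D\<^esub> far F (vcmp A b c d)))
        \<cdot>\<^bsub>D\<^esub> (idn D (fob F ?x) \<odot>\<^bsub>D\<^esub> phi2 F ?y ?z) \<cdot>\<^bsub>D\<^esub> asc D (fob F ?x) (fob F ?y) (fob F ?z)"
      by (simp add: phi2_nat_right)
    also have "\<dots> = ?m a b d \<cdot>\<^bsub>D\<^esub> (idn D (fob F ?x) \<odot>\<^bsub>D\<^esub> ?m b c d) \<cdot>\<^bsub>D\<^esub> asc D (fob F ?x) (fob F ?y) (fob F ?z)"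
      by simp
    finally show "vcmp (base_cat D F A) a c d \<cdot>\<^bsub>D\<^esub> (vcmp (base_cat D F A) a b c \<odot>\<^bsub>D\<^esub> idn D (vhom (base_cat D F A) c d))
        = vcmp (base_cat D F A) a b d \<cdot>\<^bsub>D\<^esub> (idn D (vhom (base_cat D F A) a b) \<odot>\<^bsub>D\<^esub> vcmp (base_cat D F A) b c d)
          \<cdot>\<^bsub>D\<^esub> asc D (vhom (base_cat D F A) a b) (vhom (base_cat D F A) b c) (vhom (base_cat D F A) c d)"
      by (simp add: base_cat_def)
  qed (simp_all add: base_cat_def base_elem_def)
qed

lemma enriched_functor_base:
  assumes "enriched_functor C A B T"
  shows "enriched_functor D (base_cat D F A) (base_cat D F B) (base_fun F T)"
proof -
  interpret T: enriched_functor C A B T by fact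
  interpret A: enriched_category D "base_cat D F A" by (rule enriched_category_base[OF T.A.enriched_category_axioms])
  interpret B: enriched_category D "base_cat D F B" by (rule enriched_category_base[OF T.B.enriched_category_axioms])
  note [simp] = T.vfob_in_vob
    T.vfar_in_hom[unfolded in_hom_def, THEN conjunct1] T.vfar_in_hom[unfolded in_hom_def, THEN conjunct2]
    T.A.vcmp_in_hom[unfolded in_hom_def, THEN conjunct1] T.A.vcmp_in_hom[unfolded in_hom_def, THEN conjunct2]
    T.B.vcmp_in_hom[unfolded in_hom_def, THEN conjunct1] T.B.vcmp_in_hom[unfolded in_hom_def, THEN conjunct2]
    T.A.vidn_in_hom[unfolded in_hom_def, THEN conjunct1] T.A.vidn_in_hom[unfolded in_hom_def, THEN conjunct2]
  show ?thesis
  proof (unfold_locales; (unfold in_hom_def)?)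
    fix a assume "a \<in> vob (base_cat D F A)"
    then have [simp]: "a \<in> vob A" by (simp add: base_cat_def)
    show "vfar (base_fun F T) a a \<cdot>\<^bsub>D\<^esub> vidn (base_cat D F A) a = vidn (base_cat D F B) (vfob (base_fun F T) a)"
      by (simp add: base_cat_def base_fun_def base_elem_def T.vfar_vidn[symmetric])
  next
    fix a b c assume "a \<in> vob (base_cat D F A)" "b \<in> vob (base_cat D F A)" "c \<in> vob (base_cat D F A)"
    then have [simp]: "a \<in> vob A" "b \<in> vob A" "c \<in> vob A" by (simp_all add: base_cat_def)
    have "far F (vfar T a c \<cdot>\<^bsub>C\<^esub> vcmp A a b c) \<cdot>\<^bsub>D\<^esub> phi2 F (vhom A a b) (vhom A b c)
      = far F (vcmp B (vfob T a) (vfob T b) (vfob T c)) \<cdot>\<^bsub>D\<^esub>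
        (far F (vfar T a b \<odot>\<^bsub>C\<^esub> vfar T b c) \<cdot>\<^bsub>D\<^esub> phi2 F (vhom A a b) (vhom A b c))"
      unfolding T.vfar_vcmp[OF \<open>a \<in> vob A\<close> \<open>b \<in> vob A\<close> \<open>c \<in> vob A\<close>] by simp
    then show "vfar (base_fun F T) a c \<cdot>\<^bsub>D\<^esub> vcmp (base_cat D F A) a b c
      = vcmp (base_cat D F B) (vfob (base_fun F T) a) (vfob (base_fun F T) b) (vfob (base_fun F T) c)
        \<cdot>\<^bsub>D\<^esub> (vfar (base_fun F T) a b \<odot>\<^bsub>D\<^esub> vfar (base_fun F T) b c)"
      by (simp add: base_cat_def base_fun_def phi2_nat)
  qed (simp_all add: base_cat_def base_fun_def)
qed

end

context tensored_functor
begin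

text \<open>Yoneda once more: an operation natural in the parameter that agrees with T at
  \<open>aev\<close> agrees with \<open>pact\<close> everywhere.\<close>

lemma pact_formula:
  assumes "a \<in> vob A" "b \<in> vob A" "src C f = aob M a Z" "tgt C f = b"
    and "B.hat (vfob T a) (vfob T b) (vfar T a b) = P a (vhom A a b) b (aev M a b)"
    and "\<And>x. tgt V x = vhom A a b \<Longrightarrow> P a (src V x) b (aev M a b \<cdot>\<^bsub>C\<^esub> aar M (idn C a) x)
        = P a (vhom A a b) b (aev M a b) \<cdot>\<^bsub>D\<^esub> aar N (idn D (vfob T a)) x"
  shows "pact T a Z b f = P a Z b f"
  using assms(5) assms(6)[of "A.unhat a Z b f"] assms(1-4)
  by (simp add: pact_eq A.hat_def[symmetric])

end

section \<open>The tensors of the change of base along G\<close>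

locale closed_adjunction =
  X: closed_symmetric_monoidal_category X + L: closed_symmetric_monoidal_category L
  + symmetric_monoidal_adjunction X L F G \<eta> \<epsilon>
  for X :: "('x, 'a, 'm) csmcat_scheme" and L :: "('l, 'b, 'n) csmcat_scheme"
    and F :: "('x, 'a, 'l, 'b) smfun" and G :: "('l, 'b, 'x, 'a) smfun"
    and \<eta> :: "'x \<Rightarrow> 'a" and \<epsilon> :: "'l \<Rightarrow> 'b"
begin

lemma src_unit [simp]: "src X (\<eta> A) = A" and tgt_unit [simp]: "tgt X (\<eta> A) = fob G (fob F A)"
  using unit.t_in_hom[of A] by (simp_all add: in_hom_def smfun_id_def smfun_comp_def)

lemma src_counit [simp]: "src L (\<epsilon> A) = fob F (fob G A)" and tgt_counit [simp]: "tgt L (\<epsilon> A) = A"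
  using counit.t_in_hom[of A] by (simp_all add: in_hom_def smfun_id_def smfun_comp_def)

lemma unit_nat: "far G (far F f) \<cdot>\<^bsub>X\<^esub> \<eta> (src X f) = \<eta> (tgt X f) \<cdot>\<^bsub>X\<^esub> f"
  using unit.t_natural[of f "src X f" "tgt X f"] by (simp add: in_hom_def smfun_id_def smfun_comp_def)

lemma counit_nat: "\<epsilon> (tgt L f) \<cdot>\<^bsub>L\<^esub> far F (far G f) = f \<cdot>\<^bsub>L\<^esub> \<epsilon> (src L f)"
  using counit.t_natural[of f "src L f" "tgt L f"] by (simp add: in_hom_def smfun_id_def smfun_comp_def)

lemma unit_phi0: "far G (phi0 F) \<cdot>\<^bsub>X\<^esub> phi0 G = \<eta> \<one>\<^bsub>X\<^esub>"
  using unit.t_phi0 by (simp add: smfun_id_def smfun_comp_def)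

lemma counit_phi0: "\<epsilon> \<one>\<^bsub>L\<^esub> \<cdot>\<^bsub>L\<^esub> (far F (phi0 G) \<cdot>\<^bsub>L\<^esub> phi0 F) = idn L \<one>\<^bsub>L\<^esub>"
  using counit.t_phi0 by (simp add: smfun_id_def smfun_comp_def)

lemma unit_phi2: "far G (phi2 F A B) \<cdot>\<^bsub>X\<^esub> (phi2 G (fob F A) (fob F B) \<cdot>\<^bsub>X\<^esub> (\<eta> A \<odot>\<^bsub>X\<^esub> \<eta> B)) = \<eta> (A \<otimes>\<^bsub>X\<^esub> B)"
  using unit.t_phi2[of A B] by (simp add: smfun_id_def smfun_comp_def)

lemma counit_phi2: "\<epsilon> (A \<otimes>\<^bsub>L\<^esub> B) \<cdot>\<^bsub>L\<^esub> (far F (phi2 G A B) \<cdot>\<^bsub>L\<^esub> phi2 F (fob G A) (fob G B)) = \<epsilon> A \<odot>\<^bsub>L\<^esub> \<epsilon> B"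
  using counit.t_phi2[of A B] by (simp add: smfun_id_def smfun_comp_def)

declare triangle_left [simp] triangle_right [simp]

lemma counit_phi2': "tgt L k = fob F (fob G A) \<otimes>\<^bsub>L\<^esub> fob F (fob G B) \<Longrightarrow>
    \<epsilon> (A \<otimes>\<^bsub>L\<^esub> B) \<cdot>\<^bsub>L\<^esub> (far F (phi2 G A B) \<cdot>\<^bsub>L\<^esub> (phi2 F (fob G A) (fob G B) \<cdot>\<^bsub>L\<^esub> k)) = (\<epsilon> A \<odot>\<^bsub>L\<^esub> \<epsilon> B) \<cdot>\<^bsub>L\<^esub> k"
  using L.reassoc[OF counit_phi2] by simp

lemma counit_nat': "\<lbrakk>tgt L f = E; tgt L k = fob F (fob G (src L f))\<rbrakk>
    \<Longrightarrow> \<epsilon> E \<cdot>\<^bsub>L\<^esub> (far F (far G f) \<cdot>\<^bsub>L\<^esub> k) = f \<cdot>\<^bsub>L\<^esub> (\<epsilon> (src L f) \<cdot>\<^bsub>L\<^esub> k)"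
  using L.reassoc[OF counit_nat] by auto

lemma transpose_counit: "\<lbrakk>tgt L f = E; src L f = fob F Z\<rbrakk> \<Longrightarrow> \<epsilon> E \<cdot>\<^bsub>L\<^esub> far F (far G f \<cdot>\<^bsub>X\<^esub> \<eta> Z) = f"
  by (simp add: counit_nat')

lemma transpose_unit: "\<lbrakk>src X x = Z; tgt X x = fob G E\<rbrakk> \<Longrightarrow> far G (\<epsilon> E \<cdot>\<^bsub>L\<^esub> far F x) \<cdot>\<^bsub>X\<^esub> \<eta> Z = x"
  using unit_nat[of x] X.reassoc[OF triangle_right[of E], of x] by simp

text \<open>Doctrinal adjunction: the inverse is the mate of \<open>phi0 G\<close>. Monoidality of
  the unit gives one of the two composites, monoidality of the counit the other.\<close>

lemma phi0_inverse: "iso L (phi0 F)" "\<epsilon> \<one>\<^bsub>L\<^esub> \<cdot>\<^bsub>L\<^esub> far F (phi0 G) = inverse_arrow L (phi0 F)"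
proof -
  have "phi0 F \<cdot>\<^bsub>L\<^esub> (\<epsilon> \<one>\<^bsub>L\<^esub> \<cdot>\<^bsub>L\<^esub> far F (phi0 G)) = \<epsilon> (fob F \<one>\<^bsub>X\<^esub>) \<cdot>\<^bsub>L\<^esub> far F (far G (phi0 F) \<cdot>\<^bsub>X\<^esub> phi0 G)"
    by (simp add: counit_nat')
  then have r: "phi0 F \<cdot>\<^bsub>L\<^esub> (\<epsilon> \<one>\<^bsub>L\<^esub> \<cdot>\<^bsub>L\<^esub> far F (phi0 G)) = idn L (fob F \<one>\<^bsub>X\<^esub>)"
    unfolding unit_phi0 by simp
  show "iso L (phi0 F)"
    by (rule L.isoI[of "\<epsilon> \<one>\<^bsub>L\<^esub> \<cdot>\<^bsub>L\<^esub> far F (phi0 G)"]) (simp_all add: r counit_phi0)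
  then show "\<epsilon> \<one>\<^bsub>L\<^esub> \<cdot>\<^bsub>L\<^esub> far F (phi0 G) = inverse_arrow L (phi0 F)"
    by (rule L.inverse_unique) (simp_all add: counit_phi0)
qed

declare phi0_inverse(1) [simp]

lemma phi2_iso [simp]: "iso L (phi2 F A B)"
\<comment> \<open>The witness is the mate of \<open>phi2 G\<close> under the adjunction.\<close>
proof (rule L.isoI[of "\<epsilon> (fob F A \<otimes>\<^bsub>L\<^esub> fob F B) \<cdot>\<^bsub>L\<^esub> far F (phi2 G (fob F A) (fob F B) \<cdot>\<^bsub>X\<^esub> (\<eta> A \<odot>\<^bsub>X\<^esub> \<eta> B))"])
  let ?i = "\<epsilon> (fob F A \<otimes>\<^bsub>L\<^esub> fob F B) \<cdot>\<^bsub>L\<^esub> far F (phi2 G (fob F A) (fob F B) \<cdot>\<^bsub>X\<^esub> (\<eta> A \<odot>\<^bsub>X\<^esub> \<eta> B))"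
  have "phi2 F A B \<cdot>\<^bsub>L\<^esub> ?i = \<epsilon> (fob F (A \<otimes>\<^bsub>X\<^esub> B)) \<cdot>\<^bsub>L\<^esub>
      far F (far G (phi2 F A B) \<cdot>\<^bsub>X\<^esub> (phi2 G (fob F A) (fob F B) \<cdot>\<^bsub>X\<^esub> (\<eta> A \<odot>\<^bsub>X\<^esub> \<eta> B)))"
    by (simp add: counit_nat')
  then show "phi2 F A B \<cdot>\<^bsub>L\<^esub> ?i = idn L (tgt L (phi2 F A B))" unfolding unit_phi2 by simp
  show "?i \<cdot>\<^bsub>L\<^esub> phi2 F A B = idn L (src L (phi2 F A B))"
  proof -
    have "?i \<cdot>\<^bsub>L\<^esub> phi2 F A B = \<epsilon> (fob F A \<otimes>\<^bsub>L\<^esub> fob F B) \<cdot>\<^bsub>L\<^esub> (far F (phi2 G (fob F A) (fob F B))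
        \<cdot>\<^bsub>L\<^esub> (phi2 F (fob G (fob F A)) (fob G (fob F B)) \<cdot>\<^bsub>L\<^esub> (far F (\<eta> A) \<odot>\<^bsub>L\<^esub> far F (\<eta> B))))"
      by (simp add: F.phi2_nat)
    then show ?thesis by (simp add: counit_phi2')
  qed
qed simp_all

text \<open>The constraints of L, corrected by the inverse of \<open>phi0\<close> and by
  \<open>phi2\<close> of F. An arrow Z \<rightarrow> G(ihom E E') corresponds to F Z \<rightarrow>
  ihom E E', hence the counit in front of the evaluation of L.\<close>

definition base_action :: "('l, 'x, 'a, 'b) action"
  where "base_action = \<lparr>aob = (\<lambda>E Z. E \<otimes>\<^bsub>L\<^esub> fob F Z), aar = (\<lambda>f x. f \<odot>\<^bsub>L\<^esub> far F x),
    aun = (\<lambda>E. run L E \<cdot>\<^bsub>L\<^esub> (idn L E \<odot>\<^bsub>L\<^esub> inverse_arrow L (phi0 F))),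
    aas = (\<lambda>E Z W. (idn L E \<odot>\<^bsub>L\<^esub> phi2 F Z W) \<cdot>\<^bsub>L\<^esub> asc L E (fob F Z) (fob F W)),
    aev = (\<lambda>E E'. ev L E E' \<cdot>\<^bsub>L\<^esub> (idn L E \<odot>\<^bsub>L\<^esub> \<epsilon> (ihom L E E')))\<rparr>"

lemma base_action_simps [simp]:
  "aob base_action E Z = E \<otimes>\<^bsub>L\<^esub> fob F Z" "aar base_action f x = f \<odot>\<^bsub>L\<^esub> far F x"
  "aun base_action E = run L E \<cdot>\<^bsub>L\<^esub> (idn L E \<odot>\<^bsub>L\<^esub> inverse_arrow L (phi0 F))"
  "aas base_action E Z W = (idn L E \<odot>\<^bsub>L\<^esub> phi2 F Z W) \<cdot>\<^bsub>L\<^esub> asc L E (fob F Z) (fob F W)"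
  "aev base_action E E' = ev L E E' \<cdot>\<^bsub>L\<^esub> (idn L E \<odot>\<^bsub>L\<^esub> \<epsilon> (ihom L E E'))"
  by (simp_all add: base_action_def)

abbreviation "base \<equiv> base_cat X G (self_enriched L)"

lemma base_simps [simp]: "vob base = UNIV" "vhom base E E' = fob G (ihom L E E')"
  by (simp_all add: base_cat_def)

lemma tensored_base: "tensored_category X base L base_action"
proof -
  interpret B: enriched_category X base
    by (rule G.enriched_category_base[OF L.enriched_category_self])
  show ?thesis
  proof (unfold_locales, goal_cases)
    case (7 a)
    show ?case using L.tar_iso[OF L.iso_idn L.iso_inverse[OF phi0_inverse(1)], of a]
      by (simp add: L.iso_cmp)
  next
    case (8 f)
    show ?case
      using L.reassoc[OF L.run_nat[OF refl, of f], of "idn L (src L f) \<odot>\<^bsub>L\<^esub> inverse_arrow L (phi0 F)"] by simp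
  next
    case (11 a Z W)
    show ?case using L.tar_iso[OF L.iso_idn phi2_iso, of a] by (simp add: L.iso_cmp)
  next
    case (12 f x y)
    show ?case
      using L.asc_nat[of "tgt L f" f "fob F (tgt X x)" "far F x" "fob F (tgt X y)" "far F y"]
      by (simp add: F.phi2_nat)
  next
    case (13 a Z)
    have "far F (lun X Z) \<cdot>\<^bsub>L\<^esub> phi2 F \<one>\<^bsub>X\<^esub> Z = (far F (lun X Z) \<cdot>\<^bsub>L\<^esub> phi2 F \<one>\<^bsub>X\<^esub> Z \<cdot>\<^bsub>L\<^esub> (phi0 F \<odot>\<^bsub>L\<^esub> idn L (fob F Z)))
        \<cdot>\<^bsub>L\<^esub> (inverse_arrow L (phi0 F) \<odot>\<^bsub>L\<^esub> idn L (fob F Z))" by simp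
    also have "\<dots> = lun L (fob F Z) \<cdot>\<^bsub>L\<^esub> (inverse_arrow L (phi0 F) \<odot>\<^bsub>L\<^esub> idn L (fob F Z))"
      unfolding F.phi_lun ..
    finally have "(idn L a \<odot>\<^bsub>L\<^esub> (far F (lun X Z) \<cdot>\<^bsub>L\<^esub> phi2 F \<one>\<^bsub>X\<^esub> Z)) \<cdot>\<^bsub>L\<^esub> asc L a (fob F \<one>\<^bsub>X\<^esub>) (fob F Z)
      = (idn L a \<odot>\<^bsub>L\<^esub> lun L (fob F Z)) \<cdot>\<^bsub>L\<^esub> ((idn L a \<odot>\<^bsub>L\<^esub> (inverse_arrow L (phi0 F) \<odot>\<^bsub>L\<^esub> idn L (fob F Z))) \<cdot>\<^bsub>L\<^esub> asc L a (fob F \<one>\<^bsub>X\<^esub>) (fob F Z))"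
      by simp
    also have "\<dots> = ((idn L a \<odot>\<^bsub>L\<^esub> lun L (fob F Z)) \<cdot>\<^bsub>L\<^esub> asc L a \<one>\<^bsub>L\<^esub> (fob F Z)) \<cdot>\<^bsub>L\<^esub> ((idn L a \<odot>\<^bsub>L\<^esub> inverse_arrow L (phi0 F)) \<odot>\<^bsub>L\<^esub> idn L (fob F Z))"
      using L.asc_nat[of a "idn L a" "\<one>\<^bsub>L\<^esub>" "inverse_arrow L (phi0 F)" "fob F Z" "idn L (fob F Z)"]
      by simp
    finally show ?case by (simp add: L.triangle)
  next
    case (14 a Z)
    have "far F (run X Z) \<cdot>\<^bsub>L\<^esub> phi2 F Z \<one>\<^bsub>X\<^esub> = (far F (run X Z) \<cdot>\<^bsub>L\<^esub> phi2 F Z \<one>\<^bsub>X\<^esub> \<cdot>\<^bsub>L\<^esub> (idn L (fob F Z) \<odot>\<^bsub>L\<^esub> phi0 F))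
        \<cdot>\<^bsub>L\<^esub> (idn L (fob F Z) \<odot>\<^bsub>L\<^esub> inverse_arrow L (phi0 F))" by simp
    also have "\<dots> = run L (fob F Z) \<cdot>\<^bsub>L\<^esub> (idn L (fob F Z) \<odot>\<^bsub>L\<^esub> inverse_arrow L (phi0 F))"
      unfolding F.phi_run ..
    finally have "(idn L a \<odot>\<^bsub>L\<^esub> (far F (run X Z) \<cdot>\<^bsub>L\<^esub> phi2 F Z \<one>\<^bsub>X\<^esub>)) \<cdot>\<^bsub>L\<^esub> asc L a (fob F Z) (fob F \<one>\<^bsub>X\<^esub>)
      = (idn L a \<odot>\<^bsub>L\<^esub> run L (fob F Z)) \<cdot>\<^bsub>L\<^esub> ((idn L a \<odot>\<^bsub>L\<^esub> (idn L (fob F Z) \<odot>\<^bsub>L\<^esub> inverse_arrow L (phi0 F))) \<cdot>\<^bsub>L\<^esub> asc L a (fob F Z) (fob F \<one>\<^bsub>X\<^esub>))"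
      by simp
    also have "\<dots> = ((idn L a \<odot>\<^bsub>L\<^esub> run L (fob F Z)) \<cdot>\<^bsub>L\<^esub> asc L a (fob F Z) \<one>\<^bsub>L\<^esub>) \<cdot>\<^bsub>L\<^esub> (idn L (a \<otimes>\<^bsub>L\<^esub> fob F Z) \<odot>\<^bsub>L\<^esub> inverse_arrow L (phi0 F))"
      using L.asc_nat[of a "idn L a" "fob F Z" "idn L (fob F Z)" "\<one>\<^bsub>L\<^esub>" "inverse_arrow L (phi0 F)"]
      by simp
    finally show ?case by (simp add: L.run_tensor)
  next
    case (17 f a Z b)
    show ?case
    \<comment> \<open>The witness transposes twice: from E \<otimes> F Z \<rightarrow> E' to F Z
      \<rightarrow> ihom E E' in L, then across the adjunction to Z \<rightarrow> G(ihom E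
      E').\<close>
    proof (rule ex1I[of _ "far G (L.self.unhat a (fob F Z) b f) \<cdot>\<^bsub>X\<^esub> \<eta> Z"], goal_cases)
      case 1
      then show ?case
        using 17 transpose_counit[of "L.self.unhat a (fob F Z) b f" "ihom L a b" Z]
          L.self.hat_unhat[of f a "fob F Z" b] by (simp add: L.self_hat)
    next
      case (2 x)
      then have "\<epsilon> (ihom L a b) \<cdot>\<^bsub>L\<^esub> far F x = L.self.unhat a (fob F Z) b f"
        using 17 L.self.unhat_hat[of "\<epsilon> (ihom L a b) \<cdot>\<^bsub>L\<^esub> far F x" a b "fob F Z"] by (auto simp: L.self_hat)
      then show ?case using 2 transpose_unit[of x Z "ihom L a b"] by simp
    qed
  next
    case (18 a b c)
    let ?x = "ihom L a b" and ?y = "ihom L b c"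
    \<comment> \<open>Seen through the counit, composition in the change of base is composition in
      L: \<open>counit_phi2\<close> consumes the \<open>phi2 G\<close> that change of base had
      inserted.\<close>
    have "\<epsilon> (ihom L a c) \<cdot>\<^bsub>L\<^esub> (far F (vcmp base a b c) \<cdot>\<^bsub>L\<^esub> phi2 F (fob G ?x) (fob G ?y))
      = L.self_cmp a b c \<cdot>\<^bsub>L\<^esub> (\<epsilon> ?x \<odot>\<^bsub>L\<^esub> \<epsilon> ?y)"
      by (simp add: base_cat_def counit_nat' counit_phi2)
    then have "aev base_action a c \<cdot>\<^bsub>L\<^esub> aar base_action (idn L a) (vcmp base a b c) \<cdot>\<^bsub>L\<^esub> aas base_action a (vhom base a b) (vhom base b c)
      = (ev L a c \<cdot>\<^bsub>L\<^esub> (idn L a \<odot>\<^bsub>L\<^esub> (L.self_cmp a b c \<cdot>\<^bsub>L\<^esub> (\<epsilon> ?x \<odot>\<^bsub>L\<^esub> \<epsilon> ?y)))) \<cdot>\<^bsub>L\<^esub> asc L a (fob F (fob G ?x)) (fob F (fob G ?y))"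
      by (simp add: base_cat_def)
    then show ?case
      using L.ev_self_cmp_tar[of "\<epsilon> ?x" a b "\<epsilon> ?y" c] by simp
  next
    case (19 a)
    have "\<epsilon> (ihom L a a) \<cdot>\<^bsub>L\<^esub> far F (vidn base a) = vidn (self_enriched L) a \<cdot>\<^bsub>L\<^esub> inverse_arrow L (phi0 F)"
      by (simp add: base_cat_def base_elem_def counit_nat' phi0_inverse)
    then show ?case
      using L.reassoc[OF L.ev_self_idn[of a], of "idn L a \<odot>\<^bsub>L\<^esub> inverse_arrow L (phi0 F)"]
      by (simp add: base_cat_def base_elem_def)
  qed simp_all
qed

end

sublocale closed_adjunction \<subseteq> base: tensored_category X base L base_action
  by (rule tensored_base)

sublocale closed_adjunction \<subseteq> right: tensored_pair X base L base_action "self_enriched X" X "self_action X" ..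

sublocale closed_adjunction \<subseteq> left: tensored_pair X "self_enriched X" X "self_action X" base L base_action ..

section \<open>The underlying category of the change of base, and the enrichments of G and F\<close>

context closed_adjunction
begin

lemma base_hat: "base.hat E E' x = (ev L E E' \<cdot>\<^bsub>L\<^esub> (idn L E \<odot>\<^bsub>L\<^esub> \<epsilon> (ihom L E E'))) \<cdot>\<^bsub>L\<^esub> (idn L E \<odot>\<^bsub>L\<^esub> far F x)"
  by (simp add: base.hat_def)

lemma base_hat_idn [simp]: "base.hat E E' (idn X (fob G (ihom L E E'))) = aev base_action E E'"
  using base.hat_idn[of E E'] by simp

text \<open>Identifies the underlying category of the change of base with L. The
  \<open>phi0 G\<close> in \<open>base_elem\<close> has as its mate the inverse of
  \<open>phi0 F\<close>, which is what \<open>aun\<close> contains.\<close>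

lemma base_elem_eq: "base_elem X G (elem_of L f) = base.elem f"
proof (rule base.elem_eqI[of _ "src L f" "tgt L f"])
  let ?f = "L.self.elem f"
  have "base.hat (src L f) (tgt L f) (base_elem X G ?f)
    = (ev L (src L f) (tgt L f) \<cdot>\<^bsub>L\<^esub> (idn L (src L f) \<odot>\<^bsub>L\<^esub> ?f)) \<cdot>\<^bsub>L\<^esub> (idn L (src L f) \<odot>\<^bsub>L\<^esub> (\<epsilon> \<one>\<^bsub>L\<^esub> \<cdot>\<^bsub>L\<^esub> far F (phi0 G)))"
    by (simp add: base_hat base_elem_def counit_nat')
  then show "base.hat (src L f) (tgt L f) (base_elem X G (elem_of L f)) = f \<cdot>\<^bsub>L\<^esub> aun base_action (src L f)"
    using L.reassoc[OF L.self.hat_elem[of f, unfolded L.self_hat], of "idn L (src L f) \<odot>\<^bsub>L\<^esub> inverse_arrow L (phi0 F)"]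
    by (simp add: L.self_hat phi0_inverse L.elem_of_eq)
qed (simp_all add: L.elem_of_eq base_elem_def)

text \<open>The action of G on arrows E \<otimes> F Z \<rightarrow> E' with parameter Z. The
  argument list is that of the operation P in \<open>enriched_functorI\<close>, and likewise for
  \<open>left_par\<close>.\<close>

definition right_par :: "'l \<Rightarrow> 'x \<Rightarrow> 'l \<Rightarrow> 'b \<Rightarrow> 'a"
  where "right_par E Z E' f = far G f \<cdot>\<^bsub>X\<^esub> (phi2 G E (fob F Z) \<cdot>\<^bsub>X\<^esub> (idn X (fob G E) \<odot>\<^bsub>X\<^esub> \<eta> Z))"

definition left_par :: "'x \<Rightarrow> 'x \<Rightarrow> 'x \<Rightarrow> 'a \<Rightarrow> 'b"
  where "left_par A Z B f = far F f \<cdot>\<^bsub>L\<^esub> phi2 F A Z"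

lemma src_right_par [simp]: "src L f = E \<otimes>\<^bsub>L\<^esub> fob F Z \<Longrightarrow> src X (right_par E Z E' f) = fob G E \<otimes>\<^bsub>X\<^esub> Z"
  and tgt_right_par [simp]: "src L f = E \<otimes>\<^bsub>L\<^esub> fob F Z \<Longrightarrow> tgt X (right_par E Z E' f) = fob G (tgt L f)"
  by (simp_all add: right_par_def)

lemma src_left_par [simp]: "src X f = A \<otimes>\<^bsub>X\<^esub> Z \<Longrightarrow> src L (left_par A Z B f) = fob F A \<otimes>\<^bsub>L\<^esub> fob F Z"
  and tgt_left_par [simp]: "src X f = A \<otimes>\<^bsub>X\<^esub> Z \<Longrightarrow> tgt L (left_par A Z B f) = fob F (tgt X f)"
  by (simp_all add: left_par_def)

lemma right_par_tar:
  "\<lbrakk>src L f = E \<otimes>\<^bsub>L\<^esub> tgt L y; src L y = fob F Z\<rbrakk>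
    \<Longrightarrow> right_par E Z E' (f \<cdot>\<^bsub>L\<^esub> (idn L E \<odot>\<^bsub>L\<^esub> y))
      = far G f \<cdot>\<^bsub>X\<^esub> (phi2 G E (tgt L y) \<cdot>\<^bsub>X\<^esub> (idn X (fob G E) \<odot>\<^bsub>X\<^esub> (far G y \<cdot>\<^bsub>X\<^esub> \<eta> Z)))"
  using X.reassoc[OF G.phi2_nat_right[of "tgt L y" y E], of "idn X (fob G E) \<odot>\<^bsub>X\<^esub> \<eta> Z"]
  by (simp add: right_par_def)

lemma right_par_nat:
  assumes "src L f = E \<otimes>\<^bsub>L\<^esub> fob F (tgt X x)"
  shows "right_par E (src X x) E' (f \<cdot>\<^bsub>L\<^esub> (idn L E \<odot>\<^bsub>L\<^esub> far F x))
    = right_par E (tgt X x) E' f \<cdot>\<^bsub>X\<^esub> (idn X (fob G E) \<odot>\<^bsub>X\<^esub> x)"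
  using assms by (simp add: right_par_tar unit_nat) (simp add: right_par_def)

lemma right_hat: "X.self.hat (fob G E) (fob G E') (vfar (right_vfun X L G) E E')
    = far G (ev L E E') \<cdot>\<^bsub>X\<^esub> phi2 G E (ihom L E E')"
  by (simp add: right_vfun_def X.transpose_eq)

lemma right_hat_par: "X.self.hat (fob G E) (fob G E') (vfar (right_vfun X L G) E E')
    = right_par E (fob G (ihom L E E')) E' (aev base_action E E')"
  by (simp add: right_hat right_par_tar)

text \<open>By monoidality the unit of the adjunction at \<one> factors through
  \<open>phi0 F\<close>, whose inverse occurs in \<open>aun\<close>. After cancellation only
  \<open>phi0 G\<close> is left, and \<open>phi_run\<close> for G finishes.\<close>

lemma right_par_run: "right_par E \<one>\<^bsub>X\<^esub> E' (f \<cdot>\<^bsub>L\<^esub> aun base_action E) = far G f \<cdot>\<^bsub>X\<^esub> run X (fob G E)"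
  if "src L f = E"
proof -
  have "far G (inverse_arrow L (phi0 F)) \<cdot>\<^bsub>X\<^esub> \<eta> \<one>\<^bsub>X\<^esub> = far G (inverse_arrow L (phi0 F) \<cdot>\<^bsub>L\<^esub> phi0 F) \<cdot>\<^bsub>X\<^esub> phi0 G"
    by (simp add: unit_phi0[symmetric] del: L.inverse_cmp)
  then have "far G (inverse_arrow L (phi0 F)) \<cdot>\<^bsub>X\<^esub> \<eta> \<one>\<^bsub>X\<^esub> = phi0 G" by simp
  then show ?thesis
    using that right_par_tar[of "f \<cdot>\<^bsub>L\<^esub> run L E" E "inverse_arrow L (phi0 F)" "\<one>\<^bsub>X\<^esub>" E'] G.phi_run[of E]
    by simp
qed

text \<open>The unit at Z \<otimes> W splits into the units at Z and W joined by \<open>phi2\<close>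
  of F and G. The \<open>phi2 F\<close> becomes part of \<open>aas\<close>, and the two
  \<open>phi2 G\<close> are rebracketed by \<open>phi_asc\<close>.\<close>

lemma right_par_compose:
  assumes "src L f = E \<otimes>\<^bsub>L\<^esub> fob F Z" "tgt L f = E'" "src L g = E' \<otimes>\<^bsub>L\<^esub> fob F W"
    "src L h = E \<otimes>\<^bsub>L\<^esub> fob F (Z \<otimes>\<^bsub>X\<^esub> W)"
    and h: "h \<cdot>\<^bsub>L\<^esub> aas base_action E Z W = g \<cdot>\<^bsub>L\<^esub> aar base_action f (idn X W)"
  shows "right_par E (Z \<otimes>\<^bsub>X\<^esub> W) E'' h \<cdot>\<^bsub>X\<^esub> asc X (fob G E) Z W
    = right_par E' W E'' g \<cdot>\<^bsub>X\<^esub> (right_par E Z E' f \<odot>\<^bsub>X\<^esub> idn X W)"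
proof -
  note [simp] = assms(1-4)
  let ?i = "idn X (fob G E)" and ?FZ = "fob F Z" and ?FW = "fob F W"
  have "right_par E (Z \<otimes>\<^bsub>X\<^esub> W) E'' h \<cdot>\<^bsub>X\<^esub> asc X (fob G E) Z W
    = far G h \<cdot>\<^bsub>X\<^esub> ((phi2 G E (fob F (Z \<otimes>\<^bsub>X\<^esub> W)) \<cdot>\<^bsub>X\<^esub> (?i \<odot>\<^bsub>X\<^esub> far G (phi2 F Z W)))
      \<cdot>\<^bsub>X\<^esub> ((?i \<odot>\<^bsub>X\<^esub> (phi2 G ?FZ ?FW \<cdot>\<^bsub>X\<^esub> (\<eta> Z \<odot>\<^bsub>X\<^esub> \<eta> W))) \<cdot>\<^bsub>X\<^esub> asc X (fob G E) Z W))"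
    by (simp add: right_par_def flip: unit_phi2)
  also have "\<dots> = far G (h \<cdot>\<^bsub>L\<^esub> (idn L E \<odot>\<^bsub>L\<^esub> phi2 F Z W)) \<cdot>\<^bsub>X\<^esub> (phi2 G E (?FZ \<otimes>\<^bsub>L\<^esub> ?FW) \<cdot>\<^bsub>X\<^esub>
      ((?i \<odot>\<^bsub>X\<^esub> phi2 G ?FZ ?FW) \<cdot>\<^bsub>X\<^esub> ((?i \<odot>\<^bsub>X\<^esub> (\<eta> Z \<odot>\<^bsub>X\<^esub> \<eta> W)) \<cdot>\<^bsub>X\<^esub> asc X (fob G E) Z W)))"
    by (simp add: G.phi2_nat_right)
  also have "\<dots> = far G (h \<cdot>\<^bsub>L\<^esub> (idn L E \<odot>\<^bsub>L\<^esub> phi2 F Z W)) \<cdot>\<^bsub>X\<^esub> ((phi2 G E (?FZ \<otimes>\<^bsub>L\<^esub> ?FW) \<cdot>\<^bsub>X\<^esub>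
      (?i \<odot>\<^bsub>X\<^esub> phi2 G ?FZ ?FW) \<cdot>\<^bsub>X\<^esub> asc X (fob G E) (fob G ?FZ) (fob G ?FW)) \<cdot>\<^bsub>X\<^esub> ((?i \<odot>\<^bsub>X\<^esub> \<eta> Z) \<odot>\<^bsub>X\<^esub> \<eta> W))"
    using X.asc_nat[of "fob G E" ?i "fob G ?FZ" "\<eta> Z" "fob G ?FW" "\<eta> W"] by simp
  also have "\<dots> = far G (h \<cdot>\<^bsub>L\<^esub> aas base_action E Z W) \<cdot>\<^bsub>X\<^esub> (phi2 G (E \<otimes>\<^bsub>L\<^esub> ?FZ) ?FW \<cdot>\<^bsub>X\<^esub>
      ((phi2 G E ?FZ \<cdot>\<^bsub>X\<^esub> (?i \<odot>\<^bsub>X\<^esub> \<eta> Z)) \<odot>\<^bsub>X\<^esub> \<eta> W))"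
    unfolding G.phi_asc[symmetric] by simp
  also have "\<dots> = far G g \<cdot>\<^bsub>X\<^esub> ((phi2 G E' ?FW \<cdot>\<^bsub>X\<^esub> (far G f \<odot>\<^bsub>X\<^esub> idn X (fob G ?FW))) \<cdot>\<^bsub>X\<^esub>
      ((phi2 G E ?FZ \<cdot>\<^bsub>X\<^esub> (?i \<odot>\<^bsub>X\<^esub> \<eta> Z)) \<odot>\<^bsub>X\<^esub> \<eta> W))"
    unfolding h by (simp add: G.phi2_nat_left)
  also have "\<dots> = right_par E' W E'' g \<cdot>\<^bsub>X\<^esub> (right_par E Z E' f \<odot>\<^bsub>X\<^esub> idn X W)"
    by (simp add: right_par_def)
  finally show ?thesis .
qed

lemma enriched_functor_right: "enriched_functor X base (self_enriched X) (right_vfun X L G)"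
proof (rule right.enriched_functorI[where P = right_par], goal_cases)
  case (3 a b)
  show ?case using right_hat_par by (simp add: right_vfun_def)
next
  case (4 a b x f)
  then show ?case using right_par_nat[of f a x b] by (simp add: right_vfun_def)
next
  case (5 a)
  show ?case using right_par_run[of "idn L a" a a] by (simp add: right_vfun_def)
next
  case (6 a b c Z W f g h)
  then show ?case using right_par_compose[of f a Z b g W h c] by (simp add: right_vfun_def)
qed (simp_all add: right_vfun_def)

text \<open>An explicit candidate for the enriched F, which \<open>left_vfun\<close> merely
  characterises; \<open>left_vfun_eq\<close> identifies the two.\<close>

definition left_functor :: "('x, 'l, 'a) vfun"
  where "left_functor = \<lparr>vfob = fob F, vfar = (\<lambda>A B. base.unhat (fob F A) (ihom X A B) (fob F B)
    (left_par A (ihom X A B) B (ev X A B)))\<rparr>"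

lemma vfob_left [simp]: "vfob left_functor = fob F"
  and vfob_right [simp]: "vfob (right_vfun X L G) = fob G"
  by (simp_all add: left_functor_def right_vfun_def)

lemma left_hat: "base.hat (fob F A) (fob F B) (vfar left_functor A B) = left_par A (ihom X A B) B (ev X A B)"
  by (simp add: left_functor_def left_par_def)

lemma left_par_nat:
  assumes "src X f = A \<otimes>\<^bsub>X\<^esub> tgt X x"
  shows "left_par A (src X x) B (f \<cdot>\<^bsub>X\<^esub> (idn X A \<odot>\<^bsub>X\<^esub> x)) = left_par A (tgt X x) B f \<cdot>\<^bsub>L\<^esub> (idn L (fob F A) \<odot>\<^bsub>L\<^esub> far F x)"
  using assms F.phi2_nat_right[of "tgt X x" x A] by (simp add: left_par_def)

lemma left_par_run: "left_par A \<one>\<^bsub>X\<^esub> B (f \<cdot>\<^bsub>X\<^esub> run X A) = far F f \<cdot>\<^bsub>L\<^esub> aun base_action (fob F A)"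
  if "src X f = A"
proof -
  have "far F (run X A) \<cdot>\<^bsub>L\<^esub> phi2 F A \<one>\<^bsub>X\<^esub> = (far F (run X A) \<cdot>\<^bsub>L\<^esub> phi2 F A \<one>\<^bsub>X\<^esub> \<cdot>\<^bsub>L\<^esub> (idn L (fob F A) \<odot>\<^bsub>L\<^esub> phi0 F))
    \<cdot>\<^bsub>L\<^esub> (idn L (fob F A) \<odot>\<^bsub>L\<^esub> inverse_arrow L (phi0 F))" by simp
  then show ?thesis unfolding F.phi_run using that by (simp add: left_par_def)
qed

lemma left_par_compose:
  assumes "src X f = A \<otimes>\<^bsub>X\<^esub> Z" "tgt X f = B" "src X g = B \<otimes>\<^bsub>X\<^esub> W" "src X h = A \<otimes>\<^bsub>X\<^esub> (Z \<otimes>\<^bsub>X\<^esub> W)"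
    and h: "h \<cdot>\<^bsub>X\<^esub> asc X A Z W = g \<cdot>\<^bsub>X\<^esub> (f \<odot>\<^bsub>X\<^esub> idn X W)"
  shows "left_par A (Z \<otimes>\<^bsub>X\<^esub> W) C h \<cdot>\<^bsub>L\<^esub> aas base_action (fob F A) Z W
    = left_par B W C g \<cdot>\<^bsub>L\<^esub> aar base_action (left_par A Z B f) (idn X W)"
proof -
  note [simp] = assms(1-4)
  have "left_par A (Z \<otimes>\<^bsub>X\<^esub> W) C h \<cdot>\<^bsub>L\<^esub> aas base_action (fob F A) Z W
    = far F h \<cdot>\<^bsub>L\<^esub> (phi2 F A (Z \<otimes>\<^bsub>X\<^esub> W) \<cdot>\<^bsub>L\<^esub> (idn L (fob F A) \<odot>\<^bsub>L\<^esub> phi2 F Z W) \<cdot>\<^bsub>L\<^esub> asc L (fob F A) (fob F Z) (fob F W))"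
    by (simp add: left_par_def)
  also have "\<dots> = far F (h \<cdot>\<^bsub>X\<^esub> asc X A Z W) \<cdot>\<^bsub>L\<^esub> (phi2 F (A \<otimes>\<^bsub>X\<^esub> Z) W \<cdot>\<^bsub>L\<^esub> (phi2 F A Z \<odot>\<^bsub>L\<^esub> idn L (fob F W)))"
    unfolding F.phi_asc[symmetric] by simp
  also have "\<dots> = far F g \<cdot>\<^bsub>L\<^esub> ((phi2 F B W \<cdot>\<^bsub>L\<^esub> (far F f \<odot>\<^bsub>L\<^esub> idn L (fob F W))) \<cdot>\<^bsub>L\<^esub> (phi2 F A Z \<odot>\<^bsub>L\<^esub> idn L (fob F W)))"
    unfolding h by (simp add: F.phi2_nat_left)
  also have "\<dots> = left_par B W C g \<cdot>\<^bsub>L\<^esub> aar base_action (left_par A Z B f) (idn X W)"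
    by (simp add: left_par_def)
  finally show ?thesis .
qed

lemma enriched_functor_left: "enriched_functor X (self_enriched X) base left_functor"
proof (rule left.enriched_functorI[where P = left_par], goal_cases)
  case (2 a b)
  show ?case by (simp add: left_functor_def left_par_def)
next
  case (3 a b)
  show ?case using left_hat by simp
next
  case (4 a b x f)
  then show ?case using left_par_nat[of f a x b] by simp
next
  case (5 a)
  show ?case using left_par_run[of "idn X a" a a] by simp
next
  case (6 a b c Z W f g h)
  then show ?case using left_par_compose[of f a Z b g W h c] by simp
qed simp_all

end

sublocale closed_adjunction \<subseteq> right: tensored_functor X base L base_action "self_enriched X" X "self_action X" "right_vfun X L G"
  by (simp add: tensored_functor_def right.tensored_pair_axioms enriched_functor_right)

sublocale closed_adjunction \<subseteq> left: tensored_functor X "self_enriched X" X "self_action X" base L base_action left_functor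
  by (simp add: tensored_functor_def left.tensored_pair_axioms enriched_functor_left)

context closed_adjunction
begin

lemma right_pact: "\<lbrakk>src L f = E \<otimes>\<^bsub>L\<^esub> fob F Z; tgt L f = E'\<rbrakk>
    \<Longrightarrow> right.pact (right_vfun X L G) E Z E' f = right_par E Z E' f"
proof (rule right.pact_formula, goal_cases)
  case (6 x)
  then show ?case using right_par_nat[of "aev base_action E E'" E x E'] by simp
qed (simp_all add: right_hat_par[simplified])

lemma left_pact: "\<lbrakk>src X f = A \<otimes>\<^bsub>X\<^esub> Z; tgt X f = B\<rbrakk>
    \<Longrightarrow> left.pact left_functor A Z B f = left_par A Z B f"
proof (rule left.pact_formula, goal_cases)
  case (6 x)
  then show ?case using left_par_nat[of "ev X A B" A x B] by simp
qed (simp_all add: left_hat)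

lemma right_vfar_elem: "\<lbrakk>src L f = E; tgt L f = E'\<rbrakk>
    \<Longrightarrow> vfar (right_vfun X L G) E E' \<cdot>\<^bsub>X\<^esub> base.elem f = X.self.elem (far G f)"
  by (rule right.vfar_elem) (simp_all add: right_pact right_par_run[simplified])

lemma left_vfar_elem: "\<lbrakk>src X f = A; tgt X f = B\<rbrakk>
    \<Longrightarrow> vfar left_functor A B \<cdot>\<^bsub>X\<^esub> X.self.elem f = base.elem (far F f)"
  by (rule left.vfar_elem) (simp_all add: left_pact left_par_run[simplified])

lemma right_hat_cmp: "\<lbrakk>tgt X x = fob G (ihom L E E'); src X x = Z\<rbrakk>
    \<Longrightarrow> X.self.hat (fob G E) (fob G E') (vfar (right_vfun X L G) E E' \<cdot>\<^bsub>X\<^esub> x) = right_par E Z E' (base.hat E E' x)"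
  using right.pact_hat[of E E' x] right_pact[of "base.hat E E' x" E Z E'] by simp

lemma left_hat_cmp: "\<lbrakk>tgt X x = ihom X A B; src X x = Z\<rbrakk>
    \<Longrightarrow> base.hat (fob F A) (fob F B) (vfar left_functor A B \<cdot>\<^bsub>X\<^esub> x) = left_par A Z B (X.self.hat A B x)"
  using left.pact_hat[of A B x] left_pact[of "X.self.hat A B x" A Z B] by simp

text \<open>Enriched naturality of the counit in parametrised form. The lax structure of G followed
  by that of F collapses by \<open>counit_phi2\<close>, and the unit on the parameter is cancelled
  by a triangle identity.\<close>

lemma counit_right_par:
  assumes "src L f = E \<otimes>\<^bsub>L\<^esub> fob F Z" "tgt L f = E'"
  shows "\<epsilon> E' \<cdot>\<^bsub>L\<^esub> left_par (fob G E) Z (fob G E') (right_par E Z E' f) = f \<cdot>\<^bsub>L\<^esub> (\<epsilon> E \<odot>\<^bsub>L\<^esub> idn L (fob F Z))"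
proof -
  have "\<epsilon> E' \<cdot>\<^bsub>L\<^esub> left_par (fob G E) Z (fob G E') (right_par E Z E' f)
    = \<epsilon> E' \<cdot>\<^bsub>L\<^esub> (far F (far G f) \<cdot>\<^bsub>L\<^esub> (far F (phi2 G E (fob F Z)) \<cdot>\<^bsub>L\<^esub>
        (phi2 F (fob G E) (fob G (fob F Z)) \<cdot>\<^bsub>L\<^esub> (idn L (fob F (fob G E)) \<odot>\<^bsub>L\<^esub> far F (\<eta> Z)))))"
    using assms by (simp add: right_par_def left_par_def F.phi2_nat_right)
  then show ?thesis using assms by (simp add: counit_nat' counit_phi2')
qed

lemma unit_left_par:
  assumes "src X f = A \<otimes>\<^bsub>X\<^esub> Z" "tgt X f = B"
  shows "right_par (fob F A) Z (fob F B) (left_par A Z B f) \<cdot>\<^bsub>X\<^esub> (\<eta> A \<odot>\<^bsub>X\<^esub> idn X Z) = \<eta> B \<cdot>\<^bsub>X\<^esub> f"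
  using assms unit_nat[of f] by (simp add: right_par_def left_par_def unit_phi2)

text \<open>The left side of the last hypothesis is k transposed across the adjunction in its first
  variable, and transposition is injective. Hence naturality of the unit determines how F acts on
  parametrised arrows.\<close>

lemma left_par_unique:
  assumes "src X f = A \<otimes>\<^bsub>X\<^esub> Z" "tgt X f = B" "src L k = fob F A \<otimes>\<^bsub>L\<^esub> fob F Z" "tgt L k = fob F B"
    and k: "right_par (fob F A) Z (fob F B) k \<cdot>\<^bsub>X\<^esub> (\<eta> A \<odot>\<^bsub>X\<^esub> idn X Z) = \<eta> B \<cdot>\<^bsub>X\<^esub> f"
  shows "k = left_par A Z B f"
proof -
  let ?r = "right_par (fob F A) Z (fob F B) k"
  \<comment> \<open>A triangle identity is inserted on the first factor, so that
    \<open>counit_right_par\<close> can move k inside \<open>right_par\<close>.\<close>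
  have "k = k \<cdot>\<^bsub>L\<^esub> ((\<epsilon> (fob F A) \<odot>\<^bsub>L\<^esub> idn L (fob F Z)) \<cdot>\<^bsub>L\<^esub> (far F (\<eta> A) \<odot>\<^bsub>L\<^esub> idn L (fob F Z)))"
    using assms(1-4) by simp
  also have "\<dots> = \<epsilon> (fob F B) \<cdot>\<^bsub>L\<^esub> (left_par (fob G (fob F A)) Z (fob G (fob F B)) ?r \<cdot>\<^bsub>L\<^esub> (far F (\<eta> A) \<odot>\<^bsub>L\<^esub> idn L (fob F Z)))"
    using counit_right_par[of k "fob F A" Z "fob F B"] assms(1-4)
      L.assoc[of "far F (\<eta> A) \<odot>\<^bsub>L\<^esub> idn L (fob F Z)" "\<epsilon> (fob F A) \<odot>\<^bsub>L\<^esub> idn L (fob F Z)" k]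
      L.assoc[of "far F (\<eta> A) \<odot>\<^bsub>L\<^esub> idn L (fob F Z)" "left_par (fob G (fob F A)) Z (fob G (fob F B)) ?r" "\<epsilon> (fob F B)"]
    by (simp del: L.assoc L.tar_tar L.tar_tar')
  also have "\<dots> = \<epsilon> (fob F B) \<cdot>\<^bsub>L\<^esub> (far F (?r \<cdot>\<^bsub>X\<^esub> (\<eta> A \<odot>\<^bsub>X\<^esub> idn X Z)) \<cdot>\<^bsub>L\<^esub> phi2 F A Z)"
    using assms(1-4) by (simp add: left_par_def F.phi2_nat_left)
  also have "\<dots> = left_par A Z B f"
    unfolding k using assms(1-4) L.reassoc[OF triangle_left[of B], of "far F f \<cdot>\<^bsub>L\<^esub> phi2 F A Z"]
    by (simp add: left_par_def)
  finally show ?thesis .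
qed

lemma enriched_adjunction_left_right:
  "enriched_adjunction X (self_enriched X) base left_functor (right_vfun X L G)
    (unit_elem X \<eta>) (counit_elem X L G \<epsilon>)"
proof (intro enriched_adjunction.intro enriched_adjunction_axioms.intro)
  interpret XX: tensored_pair X "self_enriched X" X "self_action X" "self_enriched X" X "self_action X" ..
  interpret BB: tensored_pair X base L base_action base L base_action ..
  show "enriched_transformation X (self_enriched X) (self_enriched X) (vfun_id X (self_enriched X))
      (vfun_comp X (right_vfun X L G) left_functor) (unit_elem X \<eta>)"
  proof (rule XX.enriched_transformationI[where s = \<eta>], goal_cases)
    case (6 a b)
    show ?case by (simp add: right_hat_cmp left_hat unit_left_par)
  qed (simp_all add: enriched_functor_id[OF X.enriched_category_self]
      enriched_functor_comp[OF enriched_functor_left enriched_functor_right]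
      unit_elem_def X.elem_of_eq)
  show "enriched_transformation X base base (vfun_comp X left_functor (right_vfun X L G))
      (vfun_id X base) (counit_elem X L G \<epsilon>)"
  proof (rule BB.enriched_transformationI[where s = \<epsilon>], goal_cases)
    case (6 a b)
    show ?case using counit_right_par[of "aev base_action a b" a "fob G (ihom L a b)" b] base.hat_idn[of a b]
      by (simp add: left_hat_cmp right_hat_par[simplified])
  qed (simp_all add: enriched_functor_id[OF base.enriched_category_axioms]
      enriched_functor_comp[OF enriched_functor_right enriched_functor_left]
      counit_elem_def base_elem_eq)
qed (simp_all add: enriched_functor_left enriched_functor_right vtrans_comp_def whisker_post_def whisker_pre_def
    unit_elem_def counit_elem_def base_elem_eq X.elem_of_eq
    left_vfar_elem right_vfar_elem base.elem_cmp_elem X.self.elem_cmp_elem base.elem_idn X.self.elem_idn)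

text \<open>Any competitor satisfies enriched naturality of the same unit, and
  \<open>left_par_unique\<close> then fixes its hom arrows.\<close>

lemma left_vfun_eq: "left_vfun X L F G \<eta> \<epsilon> = left_functor"
  unfolding left_vfun_def
proof (rule the_equality)
  fix S :: "('x, 'l, 'a) vfun"
  assume "vfob S = fob F \<and> enriched_adjunction X (self_enriched X) base S (right_vfun X L G)
      (unit_elem X \<eta>) (counit_elem X L G \<epsilon>)"
  then have S: "vfob S = fob F" and adj: "enriched_adjunction X (self_enriched X) base S (right_vfun X L G)
      (unit_elem X \<eta>) (counit_elem X L G \<epsilon>)" by auto
  interpret adj: enriched_adjunction X "self_enriched X" base S "right_vfun X L G" "unit_elem X \<eta>" "counit_elem X L G \<epsilon>"
    by (rule adj)
  interpret S: tensored_functor X "self_enriched X" X "self_action X" base L base_action S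
    by (simp add: tensored_functor_def left.tensored_pair_axioms adj.left.enriched_functor_axioms)
  interpret XX: tensored_pair X "self_enriched X" X "self_action X" "self_enriched X" X "self_action X" ..
  have "vfar S A B = vfar left_functor A B" for A B
  proof (rule base.hat_inject[of _ "fob F A" "fob F B"])
    have "base.hat (fob F A) (fob F B) (vfar S A B) = left_par A (ihom X A B) B (ev X A B)"
    proof (rule left_par_unique)
      show "right_par (fob F A) (ihom X A B) (fob F B) (base.hat (fob F A) (fob F B) (vfar S A B))
        \<cdot>\<^bsub>X\<^esub> (\<eta> A \<odot>\<^bsub>X\<^esub> idn X (ihom X A B)) = \<eta> B \<cdot>\<^bsub>X\<^esub> ev X A B"
        using XX.enriched_transformationD[OF adj.unit.enriched_transformation_axioms, of A B "\<eta> A" "\<eta> B"]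
          S.src_vfar[of A B] S.tgt_vfar[of A B]
        by (simp add: S unit_elem_def X.elem_of_eq right_hat_cmp)
    qed (use S.src_vfar[of A B] S.tgt_vfar[of A B] in \<open>simp_all add: S\<close>)
    then show "base.hat (fob F A) (fob F B) (vfar S A B) = base.hat (fob F A) (fob F B) (vfar left_functor A B)"
      by (simp add: left_hat)
  qed (use S.src_vfar[of A B] S.tgt_vfar[of A B] left.src_vfar[of A B] left.tgt_vfar[of A B] in \<open>simp_all add: S\<close>)
  then show "S = left_functor" by (intro vfun.equality) (auto simp: S fun_eq_iff)
qed (simp add: enriched_adjunction_left_right)

end

section \<open>Functionally complete objects\<close>

context category
begin

lemma monoD: "\<lbrakk>mono_arrow C m; tgt C u = src C m; tgt C v = src C m; src C u = src C v; m \<cdot> u = m \<cdot> v\<rbrakk> \<Longrightarrow> u = v"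
  unfolding mono_arrow_def in_hom_def by blast

lemma epiD: "\<lbrakk>epi_arrow C e; src C u = tgt C e; src C v = tgt C e; tgt C u = tgt C v; u \<cdot> e = v \<cdot> e\<rbrakk> \<Longrightarrow> u = v"
  unfolding epi_arrow_def in_hom_def by metis

lemma strong_mono_mono: "strong_mono C m \<Longrightarrow> mono_arrow C m"
  unfolding strong_mono_def by blast

lemma strong_monoD:
  assumes "strong_mono C m" "epi_arrow C e" "src C u = src C e" "tgt C u = src C m"
    "src C v = tgt C e" "tgt C v = tgt C m" "m \<cdot> u = v \<cdot> e"
  obtains w where "src C w = tgt C e" "tgt C w = src C m" "w \<cdot> e = u" "m \<cdot> w = v"
  using assms unfolding strong_mono_def in_hom_def by blast

text \<open>As m is monic, a filler is unique and its upper triangle follows from the lower one, so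
  only the lower triangle has to be provided.\<close>

lemma strong_monoI:
  assumes m: "mono_arrow C m"
    and "\<And>e u v. \<lbrakk>epi_arrow C e; src C u = src C e; tgt C u = src C m; src C v = tgt C e; tgt C v = tgt C m;
        m \<cdot> u = v \<cdot> e\<rbrakk> \<Longrightarrow> \<exists>w. src C w = tgt C e \<and> tgt C w = src C m \<and> m \<cdot> w = v"
  shows "strong_mono C m"
  unfolding strong_mono_def in_hom_def
proof (intro conjI allI impI m, elim conjE)
  fix e u v assume e: "epi_arrow C e" and [simp]: "src C u = src C e" "tgt C u = src C m" "src C v = tgt C e"
    "tgt C v = tgt C m" and eq: "m \<cdot> u = v \<cdot> e"
  from assms(2)[of e u v] e eq obtain w where w [simp]: "src C w = tgt C e" "tgt C w = src C m" and mw: "m \<cdot> w = v"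
    by auto
  have "m \<cdot> (w \<cdot> e) = m \<cdot> u" using mw eq assoc[of e w m] by simp
  then have "w \<cdot> e = u" by (intro monoD[OF m, of "w \<cdot> e" u]) simp_all
  then show "\<exists>!w. (src C w = tgt C e \<and> tgt C w = src C m) \<and> w \<cdot> e = u \<and> m \<cdot> w = v"
    using w mw monoD[OF m] by (intro ex1I[of _ w]) auto
qed

lemma strong_mono_cmp:
  assumes m: "strong_mono C m" and n: "strong_mono C n" and mn [simp]: "tgt C n = src C m"
  shows "strong_mono C (m \<cdot> n)"
proof (rule strong_monoI)
  show "mono_arrow C (m \<cdot> n)"
    unfolding mono_arrow_def in_hom_def
  proof (intro allI impI, elim conjE)
    fix Q u v assume [simp]: "src C u = Q" "src C v = Q" and "tgt C u = src C (m \<cdot> n)" "tgt C v = src C (m \<cdot> n)"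
      and eq: "(m \<cdot> n) \<cdot> u = (m \<cdot> n) \<cdot> v"
    then have [simp]: "tgt C u = src C n" "tgt C v = src C n" by simp_all
    have "n \<cdot> u = n \<cdot> v" by (rule monoD[OF strong_mono_mono[OF m]]) (use eq in simp_all)
    then show "u = v" by (intro monoD[OF strong_mono_mono[OF n], of u v]) simp_all
  qed
  fix e u v assume e: "epi_arrow C e" and [simp]: "src C u = src C e" and "tgt C u = src C (m \<cdot> n)"
    and [simp]: "src C v = tgt C e" and "tgt C v = tgt C (m \<cdot> n)" and eq: "(m \<cdot> n) \<cdot> u = v \<cdot> e"
  then have [simp]: "tgt C u = src C n" "tgt C v = tgt C m" by simp_all
  obtain w where w: "src C w = tgt C e" "tgt C w = src C m" "w \<cdot> e = n \<cdot> u" "m \<cdot> w = v"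
    using strong_monoD[OF m e, of "n \<cdot> u" v] eq by auto
  then obtain w' where "src C w' = tgt C e" "tgt C w' = src C n" "n \<cdot> w' = w"
    using strong_monoD[OF n e, of u w] by auto
  then show "\<exists>w. src C w = tgt C e \<and> tgt C w = src C (m \<cdot> n) \<and> (m \<cdot> n) \<cdot> w = v"
    using w by (intro exI[of _ w']) auto
qed

lemma equalizerE:
  assumes lim: "has_finite_limits C" and uv [simp]: "src C u = A" "src C v = A" "tgt C u = B" "tgt C v = B"
  obtains n where "tgt C n = A" "u \<cdot> n = v \<cdot> n"
    and "\<And>q. \<lbrakk>tgt C q = A; u \<cdot> q = v \<cdot> q\<rbrakk> \<Longrightarrow> \<exists>!w. src C w = src C q \<and> tgt C w = src C n \<and> n \<cdot> w = q"
proof -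
  \<comment> \<open>The shape of a parallel pair: arrows 0 and 1 are the identities of the objects 0
    and 1, arrows 2 and 3 go from 0 to 1. In every composable pair one factor is an identity, and
    \<open>cmp\<close> returns the other.\<close>
  define J :: "(nat, nat) cat" where "J = \<lparr>src = (\<lambda>f. if f = 1 then 1 else 0), tgt = (\<lambda>f. if f = 0 then 0 else 1),
    idn = (\<lambda>i. i), cmp = (\<lambda>g f. if f < 2 then g else f)\<rparr>"
  define D where "D = (\<lambda>i::nat. if i = 0 then A else B)"
  define d where "d = (\<lambda>f::nat. if f = 0 then idn C A else if f = 1 then idn C B else if f = 2 then u else v)"
  have J: "finite_shape J {0, 1} {0, 1, 2, 3}"
    by (simp add: finite_shape_def J_def in_hom_def)
  have D: "diagram J {0, 1} {0, 1, 2, 3} C D d"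
    unfolding diagram_def in_hom_def
    by (intro conjI ballI impI; elim insertE emptyE; simp add: J_def D_def d_def)
  from lim[unfolded has_finite_limits_def, THEN spec, THEN spec, THEN spec, THEN spec, THEN spec, THEN mp, OF conjI, OF J D]
  obtain P p where P: "cone J {0, 1} {0, 1, 2, 3} C D d P p"
    and univ: "\<And>Q q. cone J {0, 1} {0, 1, 2, 3} C D d Q q \<Longrightarrow>
      \<exists>!w. in_hom C w Q P \<and> (\<forall>i\<in>{0, 1}. p i \<cdot> w = q i)"
    by blast
  have cone_iff: "cone J {0, 1} {0, 1, 2, 3} C D d Q q \<longleftrightarrow>
      src C (q 0) = Q \<and> tgt C (q 0) = A \<and> q (Suc 0) = u \<cdot> q 0 \<and> u \<cdot> q 0 = v \<cdot> q 0" for Q q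
    by (auto simp: cone_def J_def in_hom_def D_def d_def)
  have p: "src C (p 0) = P" "tgt C (p 0) = A" "p (Suc 0) = u \<cdot> p 0"
    using P cone_iff[of P p] by auto
  show thesis
  proof
    show "tgt C (p 0) = A" "u \<cdot> p 0 = v \<cdot> p 0" using P cone_iff by auto
    fix q assume q: "tgt C q = A" "u \<cdot> q = v \<cdot> q"
    let ?q = "\<lambda>i::nat. if i = 0 then q else u \<cdot> q"
    have "\<exists>!w. in_hom C w (src C q) P \<and> (\<forall>i\<in>{0, 1}. p i \<cdot> w = ?q i)"
      by (rule univ) (use q cone_iff in auto)
    moreover have "(in_hom C w (src C q) P \<and> (\<forall>i\<in>{0, 1}. p i \<cdot> w = ?q i))
        \<longleftrightarrow> (src C w = src C q \<and> tgt C w = src C (p 0) \<and> p 0 \<cdot> w = q)" for w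
      by (auto simp: in_hom_def p)
    ultimately show "\<exists>!w. src C w = src C q \<and> tgt C w = src C (p 0) \<and> p 0 \<cdot> w = q" by simp
  qed
qed

text \<open>In a square against an epi, the lower side s satisfies u s e = v s e, hence u s = v s,
  and the universal property itself supplies the filler.\<close>

lemma equalizer_strong_mono:
  assumes uv [simp]: "src C u = tgt C n" "src C v = tgt C n" "tgt C u = tgt C v" "u \<cdot> n = v \<cdot> n"
    and univ: "\<And>q. \<lbrakk>tgt C q = tgt C n; u \<cdot> q = v \<cdot> q\<rbrakk> \<Longrightarrow> \<exists>!w. src C w = src C q \<and> tgt C w = src C n \<and> n \<cdot> w = q"
  shows "strong_mono C n"
proof (rule strong_monoI)
  show "mono_arrow C n"
    unfolding mono_arrow_def in_hom_def
  proof (intro allI impI, elim conjE)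
    fix Q r s assume rs [simp]: "src C r = Q" "src C s = Q" "tgt C r = src C n" "tgt C s = src C n"
      and eq: "n \<cdot> r = n \<cdot> s"
    have "u \<cdot> (n \<cdot> r) = v \<cdot> (n \<cdot> r)" using reassoc[OF uv(4)] by simp
    then have "\<exists>!w. src C w = Q \<and> tgt C w = src C n \<and> n \<cdot> w = n \<cdot> r" using univ[of "n \<cdot> r"] by simp
    then show "r = s" using rs eq by metis
  qed
  fix e r s assume e: "epi_arrow C e" and [simp]: "src C r = src C e" "tgt C r = src C n" "src C s = tgt C e"
    "tgt C s = tgt C n" and eq: "n \<cdot> r = s \<cdot> e"
  have "(u \<cdot> s) \<cdot> e = (v \<cdot> s) \<cdot> e" using eq[symmetric] reassoc[OF uv(4)] by simp
  then have "u \<cdot> s = v \<cdot> s" by (intro epiD[OF e, of "u \<cdot> s" "v \<cdot> s"]) simp_all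
  from univ[OF _ this] show "\<exists>w. src C w = tgt C e \<and> tgt C w = src C n \<and> n \<cdot> w = s" by auto
qed

text \<open>Fillers against the members of S all have the same composite into B, so they form a
  cone; the induced arrow into P is the filler against b.\<close>

lemma intersection_strong_mono:
  assumes cone: "fibre_product_cone C B S P b p"
    and univ: "\<And>Q c q. fibre_product_cone C B S Q c q \<Longrightarrow>
      \<exists>!u. in_hom C u Q P \<and> b \<cdot> u = c \<and> (\<forall>m\<in>S. p m \<cdot> u = q m)"
    and S: "\<And>m. m \<in> S \<Longrightarrow> strong_mono C m" "\<And>m. m \<in> S \<Longrightarrow> tgt C m = B"
  shows "strong_mono C b"
proof (rule strong_monoI)
  have [simp]: "src C b = P" "tgt C b = B" "\<And>m. m \<in> S \<Longrightarrow> src C (p m) = P" "\<And>m. m \<in> S \<Longrightarrow> tgt C (p m) = src C m"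
    using cone by (auto simp: fibre_product_cone_def in_hom_def)
  have mp: "m \<cdot> p m = b" if "m \<in> S" for m
    using cone that by (auto simp: fibre_product_cone_def)
  show "mono_arrow C b"
    unfolding mono_arrow_def in_hom_def
  proof (intro allI impI, elim conjE)
    fix Q r s assume "src C r = Q" "src C s = Q" "tgt C r = src C b" "tgt C s = src C b"
      and eq: "b \<cdot> r = b \<cdot> s"
    then have rs [simp]: "src C r = Q" "src C s = Q" "tgt C r = P" "tgt C s = P" by simp_all
    have "fibre_product_cone C B S Q (b \<cdot> r) (\<lambda>m. p m \<cdot> r)"
      by (auto simp: fibre_product_cone_def in_hom_def reassoc[OF mp])
    moreover have "p m \<cdot> s = p m \<cdot> r" if "m \<in> S" for m
      by (rule monoD[OF strong_mono_mono[OF S(1)[OF that]]]) (use that eq in \<open>simp_all add: reassoc[OF mp]\<close>)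
    moreover have "\<exists>!w. in_hom C w Q P \<and> b \<cdot> w = b \<cdot> r \<and> (\<forall>m\<in>S. p m \<cdot> w = p m \<cdot> r)"
      by (rule univ) fact
    ultimately show "r = s" using rs eq unfolding in_hom_def by metis
  qed
  fix e r s assume e: "epi_arrow C e" and "src C r = src C e" "tgt C r = src C b" "src C s = tgt C e"
    "tgt C s = tgt C b" and eq: "b \<cdot> r = s \<cdot> e"
  then have [simp]: "src C r = src C e" "tgt C r = P" "src C s = tgt C e" "tgt C s = B" by simp_all
  have "\<exists>w. src C w = tgt C e \<and> tgt C w = src C m \<and> m \<cdot> w = s" if "m \<in> S" for m
    using strong_monoD[OF S(1)[OF that] e, of "p m \<cdot> r" s] that S(2) eq by (auto simp: reassoc[OF mp])
  then obtain q where "\<And>m. m \<in> S \<Longrightarrow> src C (q m) = tgt C e \<and> tgt C (q m) = src C m \<and> m \<cdot> q m = s"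
    by metis
  then have "fibre_product_cone C B S (tgt C e) s q"
    by (auto simp: fibre_product_cone_def in_hom_def)
  from univ[OF this] show "\<exists>w. src C w = tgt C e \<and> tgt C w = src C b \<and> b \<cdot> w = s"
    by (auto simp: in_hom_def)
qed

section \<open>Orthogonality and its closure properties\<close>

definition orth :: "'a \<Rightarrow> 'o \<Rightarrow> bool"
  where "orth h B \<longleftrightarrow> (\<forall>f. src C f = src C h \<and> tgt C f = B \<longrightarrow>
    (\<exists>!g. src C g = tgt C h \<and> tgt C g = B \<and> g \<cdot> h = f))"

lemma orthI:
  assumes "\<And>f. \<lbrakk>src C f = src C h; tgt C f = B\<rbrakk> \<Longrightarrow> \<exists>g. src C g = tgt C h \<and> tgt C g = B \<and> g \<cdot> h = f"
    and "\<And>g g'. \<lbrakk>src C g = tgt C h; tgt C g = B; src C g' = tgt C h; tgt C g' = B; g \<cdot> h = g' \<cdot> h\<rbrakk> \<Longrightarrow> g = g'"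
  shows "orth h B"
  unfolding orth_def
proof (intro allI impI, elim conjE)
  fix f assume "src C f = src C h" "tgt C f = B"
  from assms(1)[OF this] show "\<exists>!g. src C g = tgt C h \<and> tgt C g = B \<and> g \<cdot> h = f"
    using assms(2) by blast
qed

lemma orth_factor:
  assumes "orth h B" "src C f = src C h" "tgt C f = B"
  obtains g where "src C g = tgt C h" "tgt C g = B" "g \<cdot> h = f"
  using assms unfolding orth_def by blast

lemma orth_eq:
  assumes "orth h B" "src C g = tgt C h" "tgt C g = B" "src C g' = tgt C h" "tgt C g' = B" "g \<cdot> h = g' \<cdot> h"
  shows "g = g'"
proof -
  have "\<exists>!k. src C k = tgt C h \<and> tgt C k = B \<and> k \<cdot> h = g \<cdot> h"
    using assms(1-3) unfolding orth_def by (metis src_cmp tgt_cmp)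
  then show ?thesis using assms by metis
qed

text \<open>Objects orthogonal to a given arrow are closed under limits; this lemma and
  \<open>orth_intersection\<close> are the two cases from which the reflection is built.\<close>

lemma orth_equalizer:
  assumes uv [simp]: "src C u = tgt C n" "src C v = tgt C n" "tgt C v = tgt C u" "u \<cdot> n = v \<cdot> n"
    and univ: "\<And>q. \<lbrakk>tgt C q = tgt C n; u \<cdot> q = v \<cdot> q\<rbrakk> \<Longrightarrow> \<exists>!w. src C w = src C q \<and> tgt C w = src C n \<and> n \<cdot> w = q"
    and h: "orth h (tgt C n)" "orth h (tgt C u)"
  shows "orth h (src C n)"
proof (rule orthI)
  have m: "mono_arrow C n" by (rule strong_mono_mono[OF equalizer_strong_mono[of u n v]]) (use univ in simp_all)
  fix f assume [simp]: "src C f = src C h" "tgt C f = src C n"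
  obtain g where [simp]: "src C g = tgt C h" "tgt C g = tgt C n" and g: "g \<cdot> h = n \<cdot> f"
    using orth_factor[OF h(1), of "n \<cdot> f"] by auto
  have "u \<cdot> g = v \<cdot> g"
    by (rule orth_eq[OF h(2)]) (simp_all add: g reassoc[OF uv(4)])
  from univ[OF _ this] obtain w where w [simp]: "src C w = tgt C h" "tgt C w = src C n" "n \<cdot> w = g" by auto
  have "w \<cdot> h = f" by (rule monoD[OF m]) (simp_all add: reassoc[OF w(3)] g)
  then show "\<exists>w. src C w = tgt C h \<and> tgt C w = src C n \<and> w \<cdot> h = f" using w by blast
next
  have m: "mono_arrow C n" by (rule strong_mono_mono[OF equalizer_strong_mono[of u n v]]) (use univ in simp_all)
  fix g g' assume [simp]: "src C g = tgt C h" "tgt C g = src C n" "src C g' = tgt C h" "tgt C g' = src C n"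
    and eq: "g \<cdot> h = g' \<cdot> h"
  have "n \<cdot> g = n \<cdot> g'" by (rule orth_eq[OF h(1)]) (simp_all add: eq)
  then show "g = g'" by (intro monoD[OF m, of g g']) simp_all
qed

text \<open>Orthogonality of B provides the common composite of the extension. It also settles the
  empty family, where P is a copy of B.\<close>

lemma orth_intersection:
  assumes cone: "fibre_product_cone C B S P b p"
    and univ: "\<And>Q c q. fibre_product_cone C B S Q c q \<Longrightarrow>
      \<exists>!u. in_hom C u Q P \<and> b \<cdot> u = c \<and> (\<forall>m\<in>S. p m \<cdot> u = q m)"
    and S: "\<And>m. m \<in> S \<Longrightarrow> strong_mono C m" "\<And>m. m \<in> S \<Longrightarrow> tgt C m = B"
    and h: "\<And>m. m \<in> S \<Longrightarrow> orth h (src C m)" "orth h B"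
  shows "orth h P"
proof (rule orthI)
  have bp [simp]: "src C b = P" "tgt C b = B" "\<And>m. m \<in> S \<Longrightarrow> src C (p m) = P" "\<And>m. m \<in> S \<Longrightarrow> tgt C (p m) = src C m"
    using cone by (auto simp: fibre_product_cone_def in_hom_def)
  have mp: "m \<cdot> p m = b" if "m \<in> S" for m
    using cone that by (auto simp: fibre_product_cone_def)
  have m: "mono_arrow C b" by (rule strong_mono_mono[OF intersection_strong_mono[OF cone univ S]])
  { fix f assume f [simp]: "src C f = src C h" "tgt C f = P"
    obtain g where [simp]: "src C g = tgt C h" "tgt C g = B" and g: "g \<cdot> h = b \<cdot> f"
      using orth_factor[OF h(2), of "b \<cdot> f"] by auto
    have "\<exists>k. src C k = tgt C h \<and> tgt C k = src C m \<and> k \<cdot> h = p m \<cdot> f" if "m \<in> S" for m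
      using orth_factor[OF h(1)[OF that], of "p m \<cdot> f"] that f by (metis bp(3,4) src_cmp tgt_cmp)
    then obtain k where k: "\<And>m. m \<in> S \<Longrightarrow> src C (k m) = tgt C h" "\<And>m. m \<in> S \<Longrightarrow> tgt C (k m) = src C m"
        "\<And>m. m \<in> S \<Longrightarrow> k m \<cdot> h = p m \<cdot> f"
      by metis
    have "m \<cdot> k m = g" if "m \<in> S" for m
      by (rule orth_eq[OF h(2)]) (use that in \<open>simp_all add: k S g reassoc[OF mp]\<close>)
    then have "fibre_product_cone C B S (tgt C h) g k"
      by (auto simp: fibre_product_cone_def in_hom_def k)
    from univ[OF this] obtain w where w: "src C w = tgt C h" "tgt C w = P" "b \<cdot> w = g" by (auto simp: in_hom_def)
    have "w \<cdot> h = f" by (rule monoD[OF m]) (use w in \<open>simp_all add: reassoc[OF w(3)] g\<close>)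
    then show "\<exists>w. src C w = tgt C h \<and> tgt C w = P \<and> w \<cdot> h = f" using w by blast }
  fix g g' assume [simp]: "src C g = tgt C h" "tgt C g = P" "src C g' = tgt C h" "tgt C g' = P"
    and eq: "g \<cdot> h = g' \<cdot> h"
  have "b \<cdot> g = b \<cdot> g'" by (rule orth_eq[OF h(2)]) (simp_all add: eq)
  then show "g = g'" by (intro monoD[OF m, of g g']) simp_all
qed

end

section \<open>Duals and functional completeness\<close>

context closed_symmetric_monoidal_category
begin

lemma src_ihom_pre [simp]: "src V (ihom_pre V h B) = ihom V (tgt V h) B"
  and tgt_ihom_pre [simp]: "tgt V (ihom_pre V h B) = ihom V (src V h) B"
  and ev_ihom_pre: "ev V (src V h) B \<cdot> (idn V (src V h) \<odot> ihom_pre V h B)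
    = ev V (tgt V h) B \<cdot> (h \<odot> idn V (ihom V (tgt V h) B))"
  by (simp_all add: ihom_pre_def)

lemma hat_ihom_pre:
  assumes "tgt V x = ihom V (tgt V h) B"
  shows "self.hat (src V h) B (ihom_pre V h B \<cdot> x) = self.hat (tgt V h) B x \<cdot> (h \<odot> idn V (src V x))"
  using assms reassoc[OF ev_ihom_pre[of h B], of "idn V (src V h) \<odot> x"] by (simp add: self_hat)

text \<open>Under \<open>hat\<close>, composing with \<open>ihom_pre V h B\<close> becomes
  precomposition with h \<otimes> Z, so this is the Yoneda lemma. In the converse direction the
  inverse is the transpose of the extension of \<open>ev\<close> along h \<otimes> Z.\<close>

lemma iso_ihom_pre_iff: "iso V (ihom_pre V h B) \<longleftrightarrow> (\<forall>Z. orth (h \<odot> idn V Z) B)"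
proof
  assume i: "iso V (ihom_pre V h B)"
  show "\<forall>Z. orth (h \<odot> idn V Z) B"
  proof (intro allI orthI, goal_cases)
    case (1 Z f)
    let ?x = "inverse_arrow V (ihom_pre V h B) \<cdot> self.unhat (src V h) Z B f"
    have "self.hat (tgt V h) B ?x \<cdot> (h \<odot> idn V Z) = f"
      using hat_ihom_pre[of ?x h B] 1 i by simp
    then show ?case using 1 i by (intro exI[of _ "self.hat (tgt V h) B ?x"]) simp
  next
    case (2 Z g g')
    let ?x = "self.unhat (tgt V h) Z B g" and ?y = "self.unhat (tgt V h) Z B g'"
    have "ihom_pre V h B \<cdot> ?x = ihom_pre V h B \<cdot> ?y"
      by (rule self.hat_inject[of _ "src V h" B]) (use 2 in \<open>simp_all add: hat_ihom_pre\<close>)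
    then have "?x = ?y"
      using 2 by (intro iso_mono[OF i, of ?x ?y]) simp_all
    then have "self.hat (tgt V h) B ?x = self.hat (tgt V h) B ?y" by simp
    then show ?case using 2 by simp
  qed
next
  assume o: "\<forall>Z. orth (h \<odot> idn V Z) B"
  obtain g where [simp]: "src V g = tgt V h \<otimes> ihom V (src V h) B" "tgt V g = B"
    and g: "g \<cdot> (h \<odot> idn V (ihom V (src V h) B)) = ev V (src V h) B"
    using orth_factor[OF o[THEN spec], of "ev V (src V h) B" "ihom V (src V h) B"] by auto
  let ?x = "self.unhat (tgt V h) (ihom V (src V h) B) B g"
  show "iso V (ihom_pre V h B)"
  proof (rule isoI[of ?x])
    show "ihom_pre V h B \<cdot> ?x = idn V (tgt V (ihom_pre V h B))"
      by (rule self.hat_inject[of _ "src V h" B]) (simp_all add: hat_ihom_pre g)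
    have "g \<cdot> (idn V (tgt V h) \<odot> ihom_pre V h B) = ev V (tgt V h) B"
    proof (rule orth_eq[OF o[THEN spec], of _ "ihom V (tgt V h) B"])
      have "(g \<cdot> (idn V (tgt V h) \<odot> ihom_pre V h B)) \<cdot> (h \<odot> idn V (ihom V (tgt V h) B))
        = (g \<cdot> (h \<odot> idn V (ihom V (src V h) B))) \<cdot> (idn V (src V h) \<odot> ihom_pre V h B)" by simp
      then show "(g \<cdot> (idn V (tgt V h) \<odot> ihom_pre V h B)) \<cdot> (h \<odot> idn V (ihom V (tgt V h) B))
        = ev V (tgt V h) B \<cdot> (h \<odot> idn V (ihom V (tgt V h) B))"
        unfolding g ev_ihom_pre .
    qed simp_all
    then show "?x \<cdot> ihom_pre V h B = idn V (src V (ihom_pre V h B))"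
      by (intro self.hat_inject[of "?x \<cdot> ihom_pre V h B" "tgt V h" B]) (simp_all add: self.hat_cmp)
  qed simp_all
qed

lemma iso_orth: assumes "iso V h" shows "orth h B"
proof (rule orthI)
  fix f assume "src V f = src V h" "tgt V f = B"
  then show "\<exists>g. src V g = tgt V h \<and> tgt V g = B \<and> g \<cdot> h = f"
    using assms by (intro exI[of _ "f \<cdot> inverse_arrow V h"]) simp
qed (use assms iso_epi in blast)

text \<open>Duals are taken with respect to B. If k, the dual of h, itself has an invertible dual,
  then B is orthogonal to every k \<otimes> Z. The evaluation pairing on E' therefore extends along
  k to a pairing g between the dual of E and E', and the transpose of g inverts k.\<close>

lemma iso_double_dual_iff: "iso V (ihom_pre V (ihom_pre V h B) B) \<longleftrightarrow> iso V (ihom_pre V h B)"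
proof
  assume "iso V (ihom_pre V h B)"
  then show "iso V (ihom_pre V (ihom_pre V h B) B)"
    by (simp add: iso_ihom_pre_iff iso_orth tar_iso iso_idn)
next
  assume "iso V (ihom_pre V (ihom_pre V h B) B)"
  then have o: "orth (ihom_pre V h B \<odot> idn V Z) B" for Z by (simp add: iso_ihom_pre_iff)
  let ?E = "src V h" and ?E' = "tgt V h" and ?k = "ihom_pre V h B"
  let ?D = "ihom V ?E B" and ?D' = "ihom V ?E' B"
  obtain g where [simp]: "src V g = ?D \<otimes> ?E'" "tgt V g = B"
    and g: "g \<cdot> (?k \<odot> idn V ?E') = ev V ?E' B \<cdot> sym V ?D' ?E'"
    using orth_factor[OF o[of ?E'], of "ev V ?E' B \<cdot> sym V ?D' ?E'"] by auto
  let ?x = "self.unhat ?E' ?D B (g \<cdot> sym V ?E' ?D)"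
  show "iso V ?k"
  proof (rule isoI[of ?x])
    have "(g \<cdot> sym V ?E' ?D) \<cdot> (idn V ?E' \<odot> ?k) = (g \<cdot> (?k \<odot> idn V ?E')) \<cdot> sym V ?E' ?D'"
      by (simp add: sym_nat)
    then have "(g \<cdot> sym V ?E' ?D) \<cdot> (idn V ?E' \<odot> ?k) = ev V ?E' B" unfolding g by simp
    then show "?x \<cdot> ?k = idn V (src V ?k)"
      by (intro self.hat_inject[of "?x \<cdot> ?k" ?E' B]) (simp_all add: self.hat_cmp)
    \<comment> \<open>The second composite amounts to the equation \<open>gh\<close> between arrows
      out of ?D \<otimes> ?E. Orthogonality allows testing it along ?k \<otimes> ?E, where the
      definition of g applies.\<close>
    have "(g \<cdot> (idn V ?D \<odot> h)) \<cdot> (?k \<odot> idn V ?E) = (ev V ?E B \<cdot> sym V ?D ?E) \<cdot> (?k \<odot> idn V ?E)"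
    proof -
      have "(g \<cdot> (idn V ?D \<odot> h)) \<cdot> (?k \<odot> idn V ?E) = (g \<cdot> (?k \<odot> idn V ?E')) \<cdot> (idn V ?D' \<odot> h)" by simp
      also have "\<dots> = (ev V ?E' B \<cdot> (h \<odot> idn V ?D')) \<cdot> sym V ?D' ?E" unfolding g by (simp add: sym_nat)
      also have "\<dots> = (ev V ?E B \<cdot> sym V ?D ?E) \<cdot> (?k \<odot> idn V ?E)"
        unfolding ev_ihom_pre[symmetric] by (simp add: sym_nat)
      finally show ?thesis .
    qed
    then have gh: "g \<cdot> (idn V ?D \<odot> h) = ev V ?E B \<cdot> sym V ?D ?E"
      by (intro orth_eq[OF o[of ?E], of "g \<cdot> (idn V ?D \<odot> h)"]) simp_all
    have "(g \<cdot> sym V ?E' ?D) \<cdot> (h \<odot> idn V ?D) = (g \<cdot> (idn V ?D \<odot> h)) \<cdot> sym V ?E ?D"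
      by (simp add: sym_nat)
    then have "(g \<cdot> sym V ?E' ?D) \<cdot> (h \<odot> idn V ?D) = ev V ?E B" unfolding gh by simp
    then show "?k \<cdot> ?x = idn V (tgt V ?k)"
      by (intro self.hat_inject[of "?k \<cdot> ?x" ?E B]) (simp_all add: hat_ihom_pre)
  qed simp_all
qed

text \<open>Invertibility of the dual of h, by \<open>iso_ihom_pre_iff\<close>, in the form in which
  it is established and applied below.\<close>

definition dual_iso :: "'a \<Rightarrow> bool"
  where "dual_iso h \<longleftrightarrow> (\<forall>Z. orth (h \<odot> idn V Z) \<one>)"

lemma functionally_complete_iff:
  "functionally_complete V E \<longleftrightarrow> (\<forall>h Z. dual_iso h \<longrightarrow> orth (h \<odot> idn V Z) E)"
  unfolding functionally_complete_def iso_double_dual_iff by (auto simp: iso_ihom_pre_iff dual_iso_def)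

lemma functionally_complete_unit: "functionally_complete V \<one>"
  by (simp add: functionally_complete_iff dual_iso_def)

text \<open>Arrows E \<otimes> W \<rightarrow> ihom Z B are the same as arrows E \<otimes> (W
  \<otimes> Z) \<rightarrow> B, naturally in E.\<close>

lemma orth_ihom:
  assumes "orth (h \<odot> idn V (W \<otimes> Z)) B" shows "orth (h \<odot> idn V W) (ihom V Z B)"
proof -
  \<comment> \<open>The rearrangement E \<otimes> (W \<otimes> Z) \<rightarrow> Z \<otimes> (E
    \<otimes> W), natural in E, which puts Z where \<open>ev\<close> expects it.\<close>
  define c where "c = (\<lambda>E. sym V (E \<otimes> W) Z \<cdot> inverse_arrow V (asc V E W Z))"
  have [simp]: "src V (c E) = E \<otimes> (W \<otimes> Z)" "tgt V (c E) = Z \<otimes> (E \<otimes> W)" "iso V (c E)" for E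
    by (simp_all add: c_def iso_cmp iso_inverse)
  have "(idn V Z \<odot> (h \<odot> idn V W)) \<cdot> c (src V h) = sym V (tgt V h \<otimes> W) Z \<cdot> ((h \<odot> idn V W) \<odot> idn V Z) \<cdot> inverse_arrow V (asc V (src V h) W Z)"
    by (simp add: c_def sym_nat)
  also have "\<dots> = sym V (tgt V h \<otimes> W) Z \<cdot> (inverse_arrow V (asc V (tgt V h) W Z) \<cdot> (asc V (tgt V h) W Z \<cdot> ((h \<odot> idn V W) \<odot> idn V Z)) \<cdot> inverse_arrow V (asc V (src V h) W Z))"
    by simp
  also have "\<dots> = c (tgt V h) \<cdot> (h \<odot> idn V (W \<otimes> Z))"
    using asc_nat[of "tgt V h" h W "idn V W" Z "idn V Z"] by (simp add: c_def)
  finally have c: "(idn V Z \<odot> (h \<odot> idn V W)) \<cdot> c (src V h) = c (tgt V h) \<cdot> (h \<odot> idn V (W \<otimes> Z))" .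
  show ?thesis
  proof (rule orthI, goal_cases)
    case (1 f)
    obtain g where [simp]: "src V g = tgt V h \<otimes> (W \<otimes> Z)" "tgt V g = B"
      and g: "g \<cdot> (h \<odot> idn V (W \<otimes> Z)) = self.hat Z B f \<cdot> c (src V h)"
      using orth_factor[OF assms, of "self.hat Z B f \<cdot> c (src V h)"] 1 by auto
    let ?x = "self.unhat Z (tgt V h \<otimes> W) B (g \<cdot> inverse_arrow V (c (tgt V h)))"
    have "((g \<cdot> inverse_arrow V (c (tgt V h))) \<cdot> (idn V Z \<odot> (h \<odot> idn V W))) \<cdot> c (src V h) = self.hat Z B f \<cdot> c (src V h)"
      using c g by simp
    then have "(g \<cdot> inverse_arrow V (c (tgt V h))) \<cdot> (idn V Z \<odot> (h \<odot> idn V W)) = self.hat Z B f"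
      by (rule iso_epi[of "c (src V h)", rotated 3]) (use 1 in simp_all)
    then have "?x \<cdot> (h \<odot> idn V W) = f"
      using 1 by (intro self.hat_inject[of "?x \<cdot> (h \<odot> idn V W)" Z B]) (simp_all add: self.hat_cmp)
    then show ?case by (intro exI[of _ ?x]) simp
  next
    case (2 g g')
    have "self.hat Z B g \<cdot> (idn V Z \<odot> (h \<odot> idn V W)) = self.hat Z B g' \<cdot> (idn V Z \<odot> (h \<odot> idn V W))"
      using 2 self.hat_cmp[of g Z B "h \<odot> idn V W"] self.hat_cmp[of g' Z B "h \<odot> idn V W"] by simp
    then have "(self.hat Z B g \<cdot> (idn V Z \<odot> (h \<odot> idn V W))) \<cdot> c (src V h) = (self.hat Z B g' \<cdot> (idn V Z \<odot> (h \<odot> idn V W))) \<cdot> c (src V h)"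
      by simp
    then have "(self.hat Z B g \<cdot> c (tgt V h)) \<cdot> (h \<odot> idn V (W \<otimes> Z)) = (self.hat Z B g' \<cdot> c (tgt V h)) \<cdot> (h \<odot> idn V (W \<otimes> Z))"
      using 2 by (simp add: c)
    then have "self.hat Z B g \<cdot> c (tgt V h) = self.hat Z B g' \<cdot> c (tgt V h)"
      by (rule orth_eq[OF assms, rotated 4]) (use 2 in simp_all)
    then have "self.hat Z B g = self.hat Z B g'"
      by (rule iso_epi[of "c (tgt V h)", rotated 3]) (use 2 in simp_all)
    then show ?case using 2 by (intro self.hat_inject[of g Z B g']) simp_all
  qed
qed

lemma functionally_complete_ihom: "functionally_complete V B \<Longrightarrow> functionally_complete V (ihom V Z B)"
  by (simp add: functionally_complete_iff orth_ihom)

text \<open>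
  The reflection of \<open>E\<close> is the intersection of all strong subobjects of \<open>E\<^sup>*\<^sup>*\<close> with functionally
  complete domain through which \<open>E \<rightarrow> E\<^sup>*\<^sup>*\<close> factors.  The dual of \<open>e : E \<rightarrow> P\<close> is split epi since
  that of \<open>E \<rightarrow> E\<^sup>*\<^sup>*\<close> is, and it is mono because equalizers of arrows \<open>P \<rightarrow> Z\<^sup>*\<close> coequalized by
  \<open>e\<close> are again such subobjects.
\<close>

lemma functionally_complete_reflection:
  assumes "finitely_well_complete V"
  obtains P e where "functionally_complete V P" "src V e = E" "tgt V e = P" "dual_iso e"
proof -
  have lim: "has_finite_limits V" and int: "has_strong_intersections V"
    using assms by (simp_all add: finitely_well_complete_def)
  define D DD where "D = ihom V E \<one>" and "DD = ihom V D \<one>"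
  \<comment> \<open>The canonical arrow of E into its double dual.\<close>
  define d where "d = self.unhat D E \<one> (ev V E \<one> \<cdot> sym V D E)"
  have d [simp]: "src V d = E" "tgt V d = DD" "self.hat D \<one> d = ev V E \<one> \<cdot> sym V D E"
    by (simp_all add: d_def DD_def D_def)
  have DD: "functionally_complete V DD"
    by (simp add: DD_def functionally_complete_ihom functionally_complete_unit)
  define S where "S = {m. strong_mono V m \<and> tgt V m = DD \<and> functionally_complete V (src V m)
    \<and> (\<exists>k. src V k = E \<and> tgt V k = src V m \<and> m \<cdot> k = d)}"
  have S: "strong_mono V m" "tgt V m = DD" "functionally_complete V (src V m)" if "m \<in> S" for m
    using that by (auto simp: S_def)
  have "\<forall>m\<in>S. strong_mono V m \<and> tgt V m = DD" using S by blast
  from int[unfolded has_strong_intersections_def, THEN spec, THEN spec, THEN mp, OF this]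
  obtain P b p where cone: "fibre_product_cone V DD S P b p"
    and univ: "\<And>Q c q. fibre_product_cone V DD S Q c q \<Longrightarrow>
      \<exists>!u. in_hom V u Q P \<and> b \<cdot> u = c \<and> (\<forall>m\<in>S. p m \<cdot> u = q m)"
    by blast
  have b [simp]: "src V b = P" "tgt V b = DD"
    using cone by (auto simp: fibre_product_cone_def in_hom_def)
  have bs: "strong_mono V b" by (rule intersection_strong_mono[OF cone univ S(1,2)])
  have P: "functionally_complete V P"
    unfolding functionally_complete_iff
    using orth_intersection[OF cone univ S(1,2)] S(3) DD by (simp add: functionally_complete_iff)
  have "\<forall>m\<in>S. \<exists>k. src V k = E \<and> tgt V k = src V m \<and> m \<cdot> k = d" by (simp add: S_def)
  then obtain q where "\<And>m. m \<in> S \<Longrightarrow> src V (q m) = E \<and> tgt V (q m) = src V m \<and> m \<cdot> q m = d" by metis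
  then have "fibre_product_cone V DD S E d q" by (auto simp: fibre_product_cone_def in_hom_def)
  from univ[OF this] obtain e where e [simp]: "src V e = E" "tgt V e = P" "b \<cdot> e = d" by (auto simp: in_hom_def)
  have "dual_iso e"
    unfolding dual_iso_def
  proof (intro allI orthI, goal_cases)
    case (1 Z f)
    then have [simp]: "src V f = E \<otimes> Z" "tgt V f = \<one>" by simp_all
    let ?y = "self.unhat E Z \<one> f"
    have [simp]: "src V ?y = Z" "tgt V ?y = D" by (simp_all add: D_def)
    \<comment> \<open>f is evaluation at y, a generalised element of the dual of E. Elements of P
      lie over the double dual, so they too can be evaluated at y.\<close>
    let ?g = "ev V D \<one> \<cdot> sym V DD D \<cdot> (b \<odot> ?y)"
    have "?g \<cdot> (e \<odot> idn V Z) = ev V D \<one> \<cdot> (sym V DD D \<cdot> (d \<odot> ?y))" by (simp add: DD_def[symmetric])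
    also have "\<dots> = (ev V D \<one> \<cdot> (idn V D \<odot> d)) \<cdot> ((?y \<odot> idn V E) \<cdot> sym V E Z)"
      by (simp add: sym_nat DD_def[symmetric])
    also have "\<dots> = ev V E \<one> \<cdot> ((sym V D E \<cdot> (?y \<odot> idn V E)) \<cdot> sym V E Z)"
      using d(3) by (simp add: self_hat D_def[symmetric])
    also have "\<dots> = ev V E \<one> \<cdot> (idn V E \<odot> ?y)"
      by (simp add: sym_nat D_def[symmetric])
    also have "\<dots> = f" using self.hat_unhat[of f E Z \<one>] by (simp add: self_hat)
    finally show ?case by (intro exI[of _ ?g]) (simp add: DD_def[symmetric])
  next
    case (2 Z f f')
    then have [simp]: "src V f = P \<otimes> Z" "src V f' = P \<otimes> Z" "tgt V f = \<one>" "tgt V f' = \<one>" by simp_all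
    \<comment> \<open>The two extensions, regarded as arrows from P to the dual of Z; both agree on
      e, so e factors through their equalizer n.\<close>
    define u where "u = self.unhat Z P \<one> (f \<cdot> sym V Z P)"
    define v where "v = self.unhat Z P \<one> (f' \<cdot> sym V Z P)"
    have [simp]: "src V u = P" "src V v = P" "tgt V u = ihom V Z \<one>" "tgt V v = ihom V Z \<one>"
      and uv: "self.hat Z \<one> u = f \<cdot> sym V Z P" "self.hat Z \<one> v = f' \<cdot> sym V Z P"
      by (simp_all add: u_def v_def)
    have "(f \<cdot> (e \<odot> idn V Z)) \<cdot> sym V Z E = (f' \<cdot> (e \<odot> idn V Z)) \<cdot> sym V Z E" using 2 by simp
    then have ue: "u \<cdot> e = v \<cdot> e"
      by (intro self.hat_inject[of "u \<cdot> e" Z \<one>]) (simp_all add: self.hat_cmp uv sym_nat)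
    obtain n where n [simp]: "tgt V n = P" "u \<cdot> n = v \<cdot> n"
      and nu: "\<And>q. \<lbrakk>tgt V q = P; u \<cdot> q = v \<cdot> q\<rbrakk> \<Longrightarrow> \<exists>!w. src V w = src V q \<and> tgt V w = src V n \<and> n \<cdot> w = q"
      using equalizerE[OF lim, of u P v "ihom V Z \<one>"] by auto
    have ns: "strong_mono V n" by (rule equalizer_strong_mono[of u n v]) (use nu in simp_all)
    have nc: "functionally_complete V (src V n)"
      unfolding functionally_complete_iff
    proof (intro allI impI)
      fix h W assume "dual_iso h"
      then show "orth (h \<odot> idn V W) (src V n)"
        using P functionally_complete_ihom[OF functionally_complete_unit, of Z] nu
        by (intro orth_equalizer[of u n v]) (simp_all add: functionally_complete_iff)
    qed
    obtain k where k: "src V k = E" "tgt V k = src V n" "n \<cdot> k = e" using nu[of e] ue by auto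
    \<comment> \<open>Minimality of the intersection: the subobject cut out by n belongs to the
      family, so P projects into it. This splits the equalizer and forces u = v.\<close>
    have "b \<cdot> n \<in> S"
      using strong_mono_cmp[OF bs ns] nc k e(3) by (simp add: S_def exI[of _ k])
    then have pn: "src V (p (b \<cdot> n)) = P" "tgt V (p (b \<cdot> n)) = src V n" "(b \<cdot> n) \<cdot> p (b \<cdot> n) = b"
      using cone by (auto simp: fibre_product_cone_def in_hom_def)
    then have "n \<cdot> p (b \<cdot> n) = idn V P"
      by (intro monoD[OF strong_mono_mono[OF bs], of "n \<cdot> p (b \<cdot> n)"]) simp_all
    then have "u = v" using pn reassoc[OF n(2), of "p (b \<cdot> n)"] by simp
    then have "f \<cdot> sym V Z P = f' \<cdot> sym V Z P" using uv by simp
    then show ?case by (rule iso_epi[OF sym_iso, rotated 2]) simp_all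
  qed
  then show thesis using that P e by blast
qed

end

section \<open>Full subcategories\<close>

lemma full_subcategory_simps [simp]:
  "vob (full_subcategory A P) = vob A \<inter> P" "vhom (full_subcategory A P) = vhom A"
  "vcmp (full_subcategory A P) = vcmp A" "vidn (full_subcategory A P) = vidn A"
  by (simp_all add: full_subcategory_def)

lemma enriched_category_full:
  assumes "enriched_category V A" shows "enriched_category V (full_subcategory A P)"
proof -
  interpret enriched_category V A by fact
  show ?thesis
    by unfold_locales (simp_all add: vcmp_in_hom vidn_in_hom vcmp_vidn_left vcmp_vidn_right vcmp_assoc)
qed

lemma (in tensored_category) tensored_full: "tensored_category V (full_subcategory A P) C N"
proof -
  interpret Q: enriched_category V "full_subcategory A P"
    by (rule enriched_category_full[OF enriched_category_axioms])
  show ?thesis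
  proof (unfold_locales, goal_cases)
    case (18 a b c)
    then show ?case using aev_vcmp[of a b c] by simp
  qed (simp_all add: aun_nat aas_nat aun_lun aun_run aev_universal aev_vidn)
qed

lemma (in tensored_category) full_elem: "tensored_category.elem V (full_subcategory A P) C N = elem"
proof -
  interpret Q: tensored_category V "full_subcategory A P" C N by (rule tensored_full)
  show ?thesis by (simp add: fun_eq_iff Q.elem_def elem_def Q.unhat_def unhat_def)
qed

lemma enriched_functor_inclusion:
  assumes "enriched_category V A"
  shows "enriched_functor V (full_subcategory A P) A (vfun_id V (full_subcategory A P))"
proof -
  interpret A: enriched_category V A by fact
  interpret Q: enriched_category V "full_subcategory A P" by (rule enriched_category_full) fact
  show ?thesis
    by unfold_locales (use A.vcmp_in_hom A.vidn_in_hom in \<open>simp_all add: in_hom_def\<close>)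
qed

text \<open>
  An idempotent monad in ordinary terms: \<open>e a : a \<rightarrow> K a\<close> is a reflection into \<open>P\<close> that
  stays one after tensoring.
\<close>

locale tensor_reflection = closed_symmetric_monoidal_category V
  for V :: "('o, 'a, 'm) csmcat_scheme" (structure) +
  fixes P :: "'o set" and K :: "'o \<Rightarrow> 'o" and e :: "'o \<Rightarrow> 'a"
  assumes K_in [simp]: "K a \<in> P" and src_e [simp]: "src V (e a) = a" and tgt_e [simp]: "tgt V (e a) = K a"
    and e_orth: "b \<in> P \<Longrightarrow> orth (e a \<odot> idn V Z) b"
begin

definition ext :: "'o \<Rightarrow> 'o \<Rightarrow> 'o \<Rightarrow> 'a \<Rightarrow> 'a"
  where "ext a Z b f = (THE g. src V g = K a \<otimes> Z \<and> tgt V g = b \<and> g \<cdot> (e a \<odot> idn V Z) = f)"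

lemma ext_char:
  assumes "b \<in> P" "src V f = a \<otimes> Z" "tgt V f = b"
  shows "src V (ext a Z b f) = K a \<otimes> Z \<and> tgt V (ext a Z b f) = b \<and> ext a Z b f \<cdot> (e a \<odot> idn V Z) = f"
  unfolding ext_def by (rule theI') (use e_orth[OF assms(1), of a Z] assms in \<open>simp add: orth_def\<close>)

lemma src_ext [simp]: "\<lbrakk>b \<in> P; src V f = a \<otimes> Z; tgt V f = b\<rbrakk> \<Longrightarrow> src V (ext a Z b f) = K a \<otimes> Z"
  and tgt_ext [simp]: "\<lbrakk>b \<in> P; src V f = a \<otimes> Z; tgt V f = b\<rbrakk> \<Longrightarrow> tgt V (ext a Z b f) = b"
  and ext_e [simp]: "\<lbrakk>b \<in> P; src V f = a \<otimes> Z; tgt V f = b\<rbrakk> \<Longrightarrow> ext a Z b f \<cdot> (e a \<odot> idn V Z) = f"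
  using ext_char by blast+

lemma ext_eqI:
  assumes "b \<in> P" "src V g = K a \<otimes> Z" "tgt V g = b" "g \<cdot> (e a \<odot> idn V Z) = f"
  shows "ext a Z b f = g"
proof -
  have f: "src V f = a \<otimes> Z" "tgt V f = b" using assms(2,3) by (auto simp flip: assms(4))
  show ?thesis
    by (rule orth_eq[OF e_orth[OF assms(1), of a Z]]) (use f assms in simp_all)
qed

lemma e_orth_left: "b \<in> P \<Longrightarrow> orth (idn V Z \<odot> e a) b"
proof (rule orthI, goal_cases)
  case (1 f)
  let ?g = "ext a Z b (f \<cdot> sym V a Z) \<cdot> sym V Z (K a)"
  have "?g \<cdot> (idn V Z \<odot> e a) = (ext a Z b (f \<cdot> sym V a Z) \<cdot> (e a \<odot> idn V Z)) \<cdot> sym V Z a"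
    using 1 by (simp add: sym_nat del: ext_e)
  then show ?case using 1 by (intro exI[of _ ?g]) simp
next
  case (2 g g')
  have "(k \<cdot> sym V (K a) Z) \<cdot> (e a \<odot> idn V Z) = (k \<cdot> (idn V Z \<odot> e a)) \<cdot> sym V a Z"
    if "src V k = Z \<otimes> K a" for k
    using that by (simp add: sym_nat)
  then have "(g \<cdot> sym V (K a) Z) \<cdot> (e a \<odot> idn V Z) = (g' \<cdot> sym V (K a) Z) \<cdot> (e a \<odot> idn V Z)"
    using 2(2-5) by (simp only: 2(6) src_tar tgt_tar src_e tgt_e src_idn tgt_idn)
  then have "g \<cdot> sym V (K a) Z = g' \<cdot> sym V (K a) Z"
    by (rule orth_eq[OF e_orth[OF 2(1)], rotated 4]) (use 2 in simp_all)
  then show ?case by (rule iso_epi[OF sym_iso, rotated 2]) (use 2 in simp_all)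
qed

lemma e_orth_unit: assumes "b \<in> P" shows "orth (e a) b"
proof (rule orthI, goal_cases)
  case (1 f)
  let ?g = "ext a \<one> b (f \<cdot> run V a) \<cdot> inverse_arrow V (run V (K a))"
  have "(?g \<cdot> e a) \<cdot> run V a = ?g \<cdot> (run V (K a) \<cdot> (e a \<odot> idn V \<one>))" using assms 1 by (simp add: run_nat)
  also have "\<dots> = f \<cdot> run V a" using assms 1 by simp
  finally have "?g \<cdot> e a = f" by (rule iso_epi[OF run_iso, rotated 2]) (use assms 1 in simp_all)
  then show ?case using assms 1 by (intro exI[of _ ?g]) simp
next
  case (2 g g')
  have "(k \<cdot> run V (K a)) \<cdot> (e a \<odot> idn V \<one>) = (k \<cdot> e a) \<cdot> run V a" if "src V k = K a" for k
    using that by (simp add: run_nat)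
  then have "(g \<cdot> run V (K a)) \<cdot> (e a \<odot> idn V \<one>) = (g' \<cdot> run V (K a)) \<cdot> (e a \<odot> idn V \<one>)"
    using 2(1-4) by (simp only: 2(5) tgt_e)
  then have "g \<cdot> run V (K a) = g' \<cdot> run V (K a)"
    by (rule orth_eq[OF e_orth[OF assms], rotated 4]) (use 2 in simp_all)
  then show ?case by (rule iso_epi[OF run_iso, rotated 2]) (use 2 in simp_all)
qed

text \<open>Extending the identity along \<open>e a\<close> gives a left inverse, and uniqueness of
  extensions makes it a right inverse.\<close>

lemma e_iso: assumes "a \<in> P" shows "iso V (e a)"
proof -
  obtain g where [simp]: "src V g = K a" "tgt V g = a" and g: "g \<cdot> e a = idn V a"
    using orth_factor[OF e_orth_unit[OF assms], of "idn V a" a] by auto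
  have "e a \<cdot> g = idn V (K a)"
    by (rule orth_eq[OF e_orth_unit[of "K a"], of _ a]) (simp_all add: g)
  then show ?thesis by (intro isoI[of g]) (simp_all add: g)
qed

abbreviation "sub \<equiv> full_subcategory (self_enriched V) P"

definition reflector :: "('o, 'o, 'a) vfun"
  where "reflector = \<lparr>vfob = K, vfar = (\<lambda>a b. self.unhat (K a) (ihom V a b) (K b)
    (ext a (ihom V a b) (K b) (e b \<cdot> ev V a b)))\<rparr>"

lemma reflector_hat: "self.hat (K a) (K b) (vfar reflector a b) = ext a (ihom V a b) (K b) (e b \<cdot> ev V a b)"
  by (simp add: reflector_def)

lemma vfob_reflector [simp]: "vfob reflector = K" by (simp add: reflector_def)

lemma ext_nat:
  assumes "b \<in> P" "src V f = a \<otimes> tgt V x" "tgt V f = b"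
  shows "ext a (src V x) b (f \<cdot> (idn V a \<odot> x)) = ext a (tgt V x) b f \<cdot> (idn V (K a) \<odot> x)"
proof (rule ext_eqI)
  have "(ext a (tgt V x) b f \<cdot> (idn V (K a) \<odot> x)) \<cdot> (e a \<odot> idn V (src V x))
    = (ext a (tgt V x) b f \<cdot> (e a \<odot> idn V (tgt V x))) \<cdot> (idn V a \<odot> x)"
    using assms by (simp del: ext_e)
  then show "(ext a (tgt V x) b f \<cdot> (idn V (K a) \<odot> x)) \<cdot> (e a \<odot> idn V (src V x)) = f \<cdot> (idn V a \<odot> x)"
    using assms by simp
qed (use assms in simp_all)

text \<open>Up to the associator both sides extend \<open>e c \<cdot> h\<close> along e a \<otimes>
  (Z \<otimes> W), so uniqueness of extensions decides.\<close>

lemma ext_compose: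
  assumes [simp]: "src V f = a \<otimes> Z" "tgt V f = b" "src V g = b \<otimes> W" "tgt V g = c" "src V h = a \<otimes> (Z \<otimes> W)" "tgt V h = c"
    and h: "h \<cdot> asc V a Z W = g \<cdot> (f \<odot> idn V W)"
  shows "ext a (Z \<otimes> W) (K c) (e c \<cdot> h) \<cdot> asc V (K a) Z W
    = ext b W (K c) (e c \<cdot> g) \<cdot> (ext a Z (K b) (e b \<cdot> f) \<odot> idn V W)"
proof -
  let ?g = "ext b W (K c) (e c \<cdot> g)" and ?f = "ext a Z (K b) (e b \<cdot> f)"
  have "ext a (Z \<otimes> W) (K c) (e c \<cdot> h) = ?g \<cdot> (?f \<odot> idn V W) \<cdot> inverse_arrow V (asc V (K a) Z W)"
  proof (rule ext_eqI)
    have "(?g \<cdot> (?f \<odot> idn V W) \<cdot> inverse_arrow V (asc V (K a) Z W) \<cdot> (e a \<odot> idn V (Z \<otimes> W))) \<cdot> asc V a Z W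
      = ?g \<cdot> (?f \<odot> idn V W) \<cdot> (inverse_arrow V (asc V (K a) Z W) \<cdot> (asc V (K a) Z W \<cdot> ((e a \<odot> idn V Z) \<odot> idn V W)))"
      by (simp add: asc_nat del: inverse_cmp')
    also have "\<dots> = ?g \<cdot> ((?f \<cdot> (e a \<odot> idn V Z)) \<odot> idn V W)" by (simp del: ext_e)
    also have "\<dots> = (?g \<cdot> (e b \<odot> idn V W)) \<cdot> (f \<odot> idn V W)" by (simp del: ext_e) simp
    also have "\<dots> = (e c \<cdot> h) \<cdot> asc V a Z W" by (simp add: h)
    finally have "?g \<cdot> (?f \<odot> idn V W) \<cdot> inverse_arrow V (asc V (K a) Z W) \<cdot> (e a \<odot> idn V (Z \<otimes> W)) = e c \<cdot> h"
      by (rule iso_epi[OF asc_iso, rotated 2]) simp_all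
    then show "(?g \<cdot> (?f \<odot> idn V W) \<cdot> inverse_arrow V (asc V (K a) Z W)) \<cdot> (e a \<odot> idn V (Z \<otimes> W)) = e c \<cdot> h"
      by simp
  qed simp_all
  then show ?thesis by simp
qed

lemma enriched_functor_reflector: "enriched_functor V (self_enriched V) sub reflector"
proof -
  interpret Q: tensored_category V sub V "self_action V" by (rule self.tensored_full)
  interpret tensored_pair V "self_enriched V" V "self_action V" sub V "self_action V" ..
  show ?thesis
  proof (rule enriched_functorI[where P = "\<lambda>a Z b f. ext a Z (K b) (e b \<cdot> f)"], goal_cases)
    case (3 a b)
    show ?case by (simp add: reflector_hat)
  next
    case (4 a b x f)
    then show ?case using ext_nat[of "K b" "e b \<cdot> f" a x] by simp
  next
    case (5 a)
    show ?case by (simp, rule ext_eqI) (simp_all add: run_nat)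
  next
    case (6 a b c Z W f g h)
    then show ?case using ext_compose[of f a Z b g W c h] by simp
  qed (simp_all add: reflector_def)
qed

text \<open>The reflector is well-pointed: K applied to \<open>e a\<close> is
  \<open>e (K a)\<close>, because both restrict along \<open>e a\<close> to the same arrow.\<close>

lemma reflector_elem_e: "vfar reflector a (K a) \<cdot> self.elem (e a) = self.elem (e (K a))"
proof (rule self.elem_eqI[of _ "K a" "K (K a)"])
  interpret T: enriched_functor V "self_enriched V" sub reflector by (rule enriched_functor_reflector)
  have [simp]: "src V (vfar reflector a b) = ihom V a b" "tgt V (vfar reflector a b) = ihom V (K a) (K b)" for a b
    using T.vfar_in_hom[of a b] by (simp_all add: in_hom_def)
  have "self.hat (K a) (K (K a)) (vfar reflector a (K a) \<cdot> self.elem (e a))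
    = ext a \<one> (K (K a)) (e (K a) \<cdot> (ev V a (K a) \<cdot> (idn V a \<odot> self.elem (e a))))"
    using ext_nat[of "K (K a)" "e (K a) \<cdot> ev V a (K a)" a "self.elem (e a)"]
    by (simp add: self.hat_cmp reflector_hat)
  also have "ev V a (K a) \<cdot> (idn V a \<odot> self.elem (e a)) = e a \<cdot> run V a"
    using self.hat_elem[of "e a"] by (simp add: self_hat)
  also have "ext a \<one> (K (K a)) (e (K a) \<cdot> (e a \<cdot> run V a)) = e (K a) \<cdot> run V (K a)"
    by (rule ext_eqI) (simp_all add: run_nat)
  finally show "self.hat (K a) (K (K a)) (vfar reflector a (K a) \<cdot> self.elem (e a)) = e (K a) \<cdot> aun (self_action V) (K a)"
    by simp
  show "src V (vfar reflector a (K a) \<cdot> self.elem (e a)) = \<one>"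
    "tgt V (vfar reflector a (K a) \<cdot> self.elem (e a)) = vhom (self_enriched V) (K a) (K (K a))"
    by simp_all
qed simp_all

text \<open>Guarantees that the choice in \<open>reflection_monad\<close> is made among actual
  adjunctions.\<close>

lemma reflector_adjunction:
  "enriched_adjunction V (self_enriched V) sub reflector (vfun_id V sub)
    (\<lambda>a. self.elem (e a)) (\<lambda>b. self.elem (inverse_arrow V (e b)))"
proof -
  interpret Q: tensored_category V sub V "self_action V" by (rule self.tensored_full)
  interpret SS: tensored_pair V "self_enriched V" V "self_action V" "self_enriched V" V "self_action V" ..
  interpret QQ: tensored_pair V sub V "self_action V" sub V "self_action V" ..
  interpret T: enriched_functor V "self_enriched V" sub reflector by (rule enriched_functor_reflector)
  have T [simp]: "src V (vfar reflector a b) = ihom V a b" "tgt V (vfar reflector a b) = ihom V (K a) (K b)" for a b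
    using T.vfar_in_hom[of a b] by (simp_all add: in_hom_def)
  note J = enriched_functor_inclusion[OF enriched_category_self, of P]
  note R = enriched_functor_reflector
  note [simp] = self.full_elem[of P] e_iso
  show ?thesis
  proof (intro enriched_adjunction.intro enriched_adjunction_axioms.intro)
    show "enriched_transformation V (self_enriched V) (self_enriched V) (vfun_id V (self_enriched V))
      (vfun_comp V (vfun_id V sub) reflector) (\<lambda>a. self.elem (e a))"
    proof (rule SS.enriched_transformationI[where s = e], goal_cases)
      case (6 a b)
      show ?case by (simp add: reflector_hat)
    qed (simp_all add: enriched_functor_id[OF enriched_category_self] enriched_functor_comp[OF R J])
    show "enriched_transformation V sub sub (vfun_comp V reflector (vfun_id V sub)) (vfun_id V sub)
      (\<lambda>b. self.elem (inverse_arrow V (e b)))"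
    proof (rule QQ.enriched_transformationI[where s = "\<lambda>b. inverse_arrow V (e b)"], goal_cases)
      case (6 a b)
      then have [simp]: "a \<in> P" "b \<in> P" by simp_all
      have "ev V a b \<cdot> (inverse_arrow V (e a) \<odot> idn V (ihom V a b))
        = inverse_arrow V (e b) \<cdot> ext a (ihom V a b) (K b) (e b \<cdot> ev V a b)"
        by (rule orth_eq[OF e_orth[of b a "ihom V a b"]]) simp_all
      then show ?case by (simp add: reflector_hat)
    qed (simp_all add: enriched_functor_id[OF Q.enriched_category_axioms] enriched_functor_comp[OF J R])
  next
    fix a
    have "elem_cmp V sub (K a) (K (K a)) (K a) (self.elem (e (K a))) (self.elem (inverse_arrow V (e (K a))))
      = self.elem (inverse_arrow V (e (K a)) \<cdot> e (K a))"
      using Q.elem_cmp_elem[of "e (K a)" "K a" "K (K a)" "inverse_arrow V (e (K a))" "K a"] by simp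
    then show "vtrans_comp V sub reflector (vfun_comp V reflector (vfun_comp V (vfun_id V sub) reflector)) reflector
        (whisker_post V reflector (vfun_id V (self_enriched V)) (vfun_comp V (vfun_id V sub) reflector) (\<lambda>a. self.elem (e a)))
        (whisker_pre (\<lambda>b. self.elem (inverse_arrow V (e b))) reflector) a = vidn sub (vfob reflector a)"
      by (simp add: vtrans_comp_def whisker_post_def whisker_pre_def reflector_elem_e self.elem_idn)
  next
    fix b assume "b \<in> vob sub"
    then have [simp]: "b \<in> P" by simp
    have "elem_cmp V (self_enriched V) b (K b) b (self.elem (e b)) (self.elem (inverse_arrow V (e b)))
      = self.elem (inverse_arrow V (e b) \<cdot> e b)"
      using self.elem_cmp_elem[of "e b" b "K b" "inverse_arrow V (e b)" b] by simp
    then show "vtrans_comp V (self_enriched V) (vfun_id V sub)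
        (vfun_comp V (vfun_id V sub) (vfun_comp V reflector (vfun_id V sub))) (vfun_id V sub)
        (whisker_pre (\<lambda>a. self.elem (e a)) (vfun_id V sub))
        (whisker_post V (vfun_id V sub) (vfun_comp V reflector (vfun_id V sub)) (vfun_id V sub) (\<lambda>b. self.elem (inverse_arrow V (e b)))) b
        = vidn (self_enriched V) (vfob (vfun_id V sub) b)"
      by (simp add: vtrans_comp_def whisker_post_def whisker_pre_def self.elem_idn)
  qed (use R J in simp_all)
qed

end

section \<open>The reflection carried by an arbitrary enriched adjunction\<close>

context closed_symmetric_monoidal_category
begin

lemma reflection_exists:
  assumes "finitely_well_complete V"
  obtains K e where "tensor_reflection V {E. functionally_complete V E} K e"
proof -
  have "\<forall>E. \<exists>e. functionally_complete V (tgt V e) \<and> src V e = E \<and> dual_iso e"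
    using functionally_complete_reflection[OF assms] by metis
  then obtain e where e: "\<And>E. functionally_complete V (tgt V (e E)) \<and> src V (e E) = E \<and> dual_iso (e E)" by metis
  have "tensor_reflection V {E. functionally_complete V E} (\<lambda>E. tgt V (e E)) e"
    by unfold_locales (use e in \<open>simp_all add: functionally_complete_iff\<close>)
  then show thesis by (rule that)
qed

text \<open>\<open>reflection_monad\<close> uses a left adjoint about which nothing else is known,
  so the tensor-stable reflection must be read off from any enriched adjunction. With m the counit,
  f extends along e a \<otimes> Z to m b \<cdot> K f, and \<open>retract\<close> shows that an
  extension is determined by its restriction.\<close>

lemma adjunction_reflection:
  assumes "enriched_adjunction V (self_enriched V) (full_subcategory (self_enriched V) P) K
    (vfun_id V (full_subcategory (self_enriched V) P)) u c"
  defines "T \<equiv> vfun_comp V (vfun_id V (full_subcategory (self_enriched V) P)) K"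
  obtains e m where "tensor_reflection V P (vfob K) e" "enriched_functor V (self_enriched V) (self_enriched V) T"
    and "\<And>a. u a = self.elem (e a)" "\<And>b. b \<in> P \<Longrightarrow> c b = self.elem (m b)"
    and "\<And>b. b \<in> P \<Longrightarrow> src V (m b) = vfob K b" "\<And>b. b \<in> P \<Longrightarrow> tgt V (m b) = b"
    and "\<And>b. b \<in> P \<Longrightarrow> m b \<cdot> e b = idn V b"
    and "\<And>a b. self.hat (vfob K a) (vfob K b) (vfar T a b) \<cdot> (e a \<odot> idn V (ihom V a b)) = e b \<cdot> ev V a b"
proof -
  let ?Q = "full_subcategory (self_enriched V) P" let ?J = "vfun_id V ?Q"
  interpret adj: enriched_adjunction V "self_enriched V" ?Q K ?J u c by fact
  interpret Q: tensored_category V ?Q V "self_action V" by (rule self.tensored_full)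
  interpret SS: tensored_pair V "self_enriched V" V "self_action V" "self_enriched V" V "self_action V" ..
  interpret QQ: tensored_pair V ?Q V "self_action V" ?Q V "self_action V" ..
  interpret K: tensored_functor V "self_enriched V" V "self_action V" ?Q V "self_action V" K
    by (intro tensored_functor.intro tensored_pair.intro self.tensored_category_axioms Q.tensored_category_axioms
        adj.left.enriched_functor_axioms)
  note [simp] = self.full_elem[of P]
  have KP [simp]: "vfob K a \<in> P" for a using adj.left.vfob_in_vob[of a] by simp
  have vK [simp]: "src V (vfar K a b) = ihom V a b" "tgt V (vfar K a b) = ihom V (vfob K a) (vfob K b)" for a b
    using K.src_vfar[of a b] K.tgt_vfar[of a b] by simp_all
  have "\<exists>f. src V f = a \<and> tgt V f = vfob K a \<and> u a = self.elem f" for a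
    using adj.unit.comp_in_hom[of a] self.elem_exhaust[of "u a" a "vfob K a"] by (auto simp: in_hom_def)
  then obtain e where e [simp]: "\<And>a. src V (e a) = a" "\<And>a. tgt V (e a) = vfob K a" "\<And>a. u a = self.elem (e a)"
    by metis
  have "\<exists>f. src V f = vfob K b \<and> tgt V f = b \<and> c b = self.elem f" if "b \<in> P" for b
    using adj.counit.comp_in_hom[of b] self.elem_exhaust[of "c b" "vfob K b" b] that by (auto simp: in_hom_def)
  then obtain m where m [simp]: "\<And>b. b \<in> P \<Longrightarrow> src V (m b) = vfob K b" "\<And>b. b \<in> P \<Longrightarrow> tgt V (m b) = b"
      "\<And>b. b \<in> P \<Longrightarrow> c b = self.elem (m b)"
    by metis
  have me: "m b \<cdot> e b = idn V b" if [simp]: "b \<in> P" for b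
  proof (rule self.elem_inject)
    show "self.elem (m b \<cdot> e b) = self.elem (idn V b)"
      using adj.vtriangle_right[of b] self.elem_cmp_elem[of "e b" b "vfob K b" "m b" b] self.elem_idn[of b]
      by (simp add: vtrans_comp_def whisker_post_def whisker_pre_def)
  qed simp_all
  have unat: "self.hat (vfob K a) (vfob K b) (vfar K a b) \<cdot> (e a \<odot> idn V (ihom V a b)) = e b \<cdot> ev V a b" for a b
    using SS.enriched_transformationD[OF adj.unit.enriched_transformation_axioms, of a b "e a" "e b"] by simp
  have cnat: "ev V a b \<cdot> (m a \<odot> idn V (ihom V a b)) = m b \<cdot> self.hat (vfob K a) (vfob K b) (vfar K a b)"
    if "a \<in> P" "b \<in> P" for a b
    using QQ.enriched_transformationD[OF adj.counit.enriched_transformation_axioms, of a b "m a" "m b"] that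
    by simp
  have pact: "K.pact K a Z b f = self.hat (vfob K a) (vfob K b) (vfar K a b) \<cdot> (idn V (vfob K a) \<odot> self.unhat a Z b f)"
    if "src V f = a \<otimes> Z" "tgt V f = b" for a Z b f
    using K.pact_eq[of a b f Z] that by simp
  have hat: "ev V a b \<cdot> (idn V a \<odot> self.unhat a Z b f) = f"
    if "src V f = a \<otimes> Z" "tgt V f = b" for a Z b f
    using self.hat_unhat[of f a Z b] that by (simp add: self_hat)
  have pe: "K.pact K a Z b f \<cdot> (e a \<odot> idn V Z) = e b \<cdot> f" if [simp]: "src V f = a \<otimes> Z" "tgt V f = b" for a Z b f
    using reassoc[OF unat[of a b], of "idn V a \<odot> self.unhat a Z b f"] by (simp add: pact hat)
  have mp: "m b \<cdot> K.pact K a Z b f = f \<cdot> (m a \<odot> idn V Z)"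
    if [simp]: "src V f = a \<otimes> Z" "tgt V f = b" "a \<in> P" "b \<in> P" for a Z b f
  proof -
    have "m b \<cdot> K.pact K a Z b f = (m b \<cdot> self.hat (vfob K a) (vfob K b) (vfar K a b)) \<cdot> (idn V (vfob K a) \<odot> self.unhat a Z b f)"
      by (simp add: pact)
    also have "\<dots> = (ev V a b \<cdot> (idn V a \<odot> self.unhat a Z b f)) \<cdot> (m a \<odot> idn V Z)"
      unfolding cnat[OF that(3,4), symmetric] by simp
    finally show ?thesis by (simp add: hat)
  qed
  \<comment> \<open>With k = K (e a), functoriality gives K (g (e a \<otimes> Z)) = K g (k \<otimes>
    Z). Naturality of m then moves m b past K g, and m k is the identity by a triangle
    identity.\<close>
  have retract: "g = m b \<cdot> K.pact K a Z b (g \<cdot> (e a \<odot> idn V Z))"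
    if [simp]: "src V g = vfob K a \<otimes> Z" "tgt V g = b" "b \<in> P" for a Z b g
  proof -
    let ?a = "vfob K a"
    let ?h = "g \<cdot> (e a \<odot> idn V Z)" and ?f = "e a \<cdot> run V a"
    obtain k where k [simp]: "src V k = ?a" "tgt V k = vfob K ?a" "vfar K a ?a \<cdot> self.elem (e a) = self.elem k"
      using self.elem_exhaust[of "vfar K a ?a \<cdot> self.elem (e a)" ?a "vfob K ?a"] by auto
    have mk: "m ?a \<cdot> k = idn V ?a"
    proof (rule self.elem_inject)
      show "self.elem (m ?a \<cdot> k) = self.elem (idn V ?a)"
        using adj.vtriangle_left[of a] Q.elem_cmp_elem[of k ?a "vfob K ?a" "m ?a" ?a] self.elem_idn[of ?a]
        by (simp add: vtrans_comp_def whisker_post_def whisker_pre_def)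
    qed simp_all
    have "K.pact K a \<one> ?a ?f = self.hat ?a (vfob K ?a) (self.elem k)"
      using K.pact_hat[of a ?a "self.elem (e a)"] by simp
    then have pf: "K.pact K a \<one> ?a ?f = k \<cdot> run V ?a" by simp
    \<comment> \<open>To compose it with g, e a counts as a parametrised arrow with unit parameter.
      The composite then has parameter \<one> \<otimes> Z, and \<open>lun\<close> brings it back to
      Z.\<close>
    have "K.pact K a (\<one> \<otimes> Z) b (?h \<cdot> (idn V a \<odot> lun V Z)) = K.pact K a Z b ?h \<cdot> (idn V ?a \<odot> lun V Z)"
    proof -
      have "self.unhat a (\<one> \<otimes> Z) b (?h \<cdot> (idn V a \<odot> lun V Z)) = self.unhat a Z b ?h \<cdot> lun V Z"
        by (rule self.hat_inject[of _ a b]) (simp_all add: self.hat_cmp)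
      then show ?thesis by (simp add: pact)
    qed
    moreover have "K.pact K a (\<one> \<otimes> Z) b (?h \<cdot> (idn V a \<odot> lun V Z)) \<cdot> asc V ?a \<one> Z
      = K.pact K ?a Z b g \<cdot> (K.pact K a \<one> ?a ?f \<odot> idn V Z)"
    proof -
      have "(e a \<odot> lun V Z) \<cdot> asc V a \<one> Z = (e a \<odot> idn V Z) \<cdot> ((idn V a \<odot> lun V Z) \<cdot> asc V a \<one> Z)" by simp
      also have "\<dots> = ?f \<odot> idn V Z" by (simp add: triangle)
      finally show ?thesis
        using K.pact_compose[of a ?a b ?f \<one> g Z "?h \<cdot> (idn V a \<odot> lun V Z)"] by simp
    qed
    ultimately have "K.pact K a Z b ?h \<cdot> (run V ?a \<odot> idn V Z) = (K.pact K ?a Z b g \<cdot> (k \<odot> idn V Z)) \<cdot> (run V ?a \<odot> idn V Z)"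
      using K.src_pact[of a b ?h Z] K.src_pact[of ?a b g Z] by (simp add: pf triangle)
    then have "K.pact K a Z b ?h = K.pact K ?a Z b g \<cdot> (k \<odot> idn V Z)"
      using K.src_pact[of a b ?h Z] K.src_pact[of ?a b g Z]
      by (intro iso_epi[OF tar_iso[OF run_iso iso_idn], of "K.pact K a Z b ?h" ?a Z]) simp_all
    then have "m b \<cdot> K.pact K a Z b ?h = (m b \<cdot> K.pact K ?a Z b g) \<cdot> (k \<odot> idn V Z)"
      using K.src_pact[of ?a b g Z] K.tgt_pact[of ?a b g Z] by simp
    then show ?thesis by (simp add: mp mk)
  qed
  have "tensor_reflection V P (vfob K) e"
  proof (unfold_locales, goal_cases)
    case (4 b a Z)
    show ?case
    proof (rule orthI)
      fix f assume f: "src V f = src V (e a \<odot> idn V Z)" "tgt V f = b"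
      have "(m b \<cdot> K.pact K a Z b f) \<cdot> (e a \<odot> idn V Z) = (m b \<cdot> e b) \<cdot> f"
        using pe[of f a Z b] K.src_pact[of a b f Z] K.tgt_pact[of a b f Z] f 4 by (simp del: e(3))
      then show "\<exists>g. src V g = tgt V (e a \<odot> idn V Z) \<and> tgt V g = b \<and> g \<cdot> (e a \<odot> idn V Z) = f"
        using K.src_pact[of a b f Z] K.tgt_pact[of a b f Z] f 4
        by (intro exI[of _ "m b \<cdot> K.pact K a Z b f"]) (simp add: me)
    next
      fix g g' assume "src V g = tgt V (e a \<odot> idn V Z)" "tgt V g = b" "src V g' = tgt V (e a \<odot> idn V Z)" "tgt V g' = b"
        "g \<cdot> (e a \<odot> idn V Z) = g' \<cdot> (e a \<odot> idn V Z)"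
      then show "g = g'" using retract[of g a Z b] retract[of g' a Z b] 4 by simp
    qed
  qed simp_all
  moreover have "enriched_functor V (self_enriched V) (self_enriched V) T"
    unfolding T_def
    by (rule enriched_functor_comp[OF adj.left.enriched_functor_axioms enriched_functor_inclusion[OF enriched_category_self]])
  moreover have "vfar T = vfar K" by (simp add: T_def fun_eq_iff)
  ultimately show thesis using that e m me unat by simp
qed

lemma functional_completion_monad:
  assumes "finitely_well_complete V"
  defines "H \<equiv> functional_completion_monad V"
  obtains K e m where "tensor_reflection V {E. functionally_complete V E} K e" "vfob (mfun H) = K"
    and "enriched_functor V (self_enriched V) (self_enriched V) (mfun H)"
    and "\<And>a. munit H a = elem_of V (e a)" "\<And>a. mmult H a = elem_of V (m a)"
    and "\<And>a. src V (m a) = K (K a)" "\<And>a. tgt V (m a) = K a" "\<And>a. m a \<cdot> e (K a) = idn V (K a)"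
    and "\<And>a b. self.hat (K a) (K b) (vfar (mfun H) a b) \<cdot> (e a \<odot> idn V (ihom V a b)) = e b \<cdot> ev V a b"
proof -
  let ?P = "{E. functionally_complete V E}"
  let ?Q = "full_subcategory (self_enriched V) ?P" let ?J = "vfun_id V ?Q"
  \<comment> \<open>This reflection only shows that the choice has a witness; the K and e that are
    delivered come from the chosen adjunction.\<close>
  obtain K0 e0 where "tensor_reflection V ?P K0 e0" using reflection_exists[OF assms(1)] .
  then interpret R: tensor_reflection V ?P K0 e0 .
  define t where "t = (SOME (K, u, c). enriched_adjunction V (self_enriched V) ?Q K ?J u c)"
  obtain K u c where t: "t = (K, u, c)" by (cases t)
  have "case t of (K, u, c) \<Rightarrow> enriched_adjunction V (self_enriched V) ?Q K ?J u c"
    unfolding t_def by (rule someI[where P = "\<lambda>(K, u, c). enriched_adjunction V (self_enriched V) ?Q K ?J u c",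
      of "(R.reflector, \<lambda>a. self.elem (e0 a), \<lambda>b. self.elem (inverse_arrow V (e0 b)))"])
      (simp add: R.reflector_adjunction)
  then have adj: "enriched_adjunction V (self_enriched V) ?Q K ?J u c" by (simp add: t)
  have H: "H = adjunction_monad V K ?J u c"
    using t by (simp add: H_def functional_completion_monad_def reflection_monad_def Let_def t_def)
  obtain e m where Kr: "tensor_reflection V ?P (vfob K) e"
    and T: "enriched_functor V (self_enriched V) (self_enriched V) (vfun_comp V ?J K)"
    and u: "\<And>a. u a = self.elem (e a)" and c: "\<And>b. b \<in> ?P \<Longrightarrow> c b = self.elem (m b)"
    and m: "\<And>b. b \<in> ?P \<Longrightarrow> src V (m b) = vfob K b" "\<And>b. b \<in> ?P \<Longrightarrow> tgt V (m b) = b"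
      "\<And>b. b \<in> ?P \<Longrightarrow> m b \<cdot> e b = idn V b"
    and n: "\<And>a b. self.hat (vfob K a) (vfob K b) (vfar (vfun_comp V ?J K) a b) \<cdot> (e a \<odot> idn V (ihom V a b)) = e b \<cdot> ev V a b"
    using adjunction_reflection[OF adj] by metis
  interpret R': tensor_reflection V ?P "vfob K" e by (rule Kr)
  show thesis
  proof (rule that[of "vfob K" e "\<lambda>a. m (vfob K a)"])
    fix a b
    show "mmult H a = elem_of V (m (vfob K a))"
      using R'.K_in[of a] c m by (simp add: H adjunction_monad_def whisker_post_def whisker_pre_def elem_of_eq del: R'.K_in)
    show "self.hat (vfob K a) (vfob K b) (vfar (mfun H) a b) \<cdot> (e a \<odot> idn V (ihom V a b)) = e b \<cdot> ev V a b"
      using n[of a b] by (simp add: H adjunction_monad_def)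
  qed (use Kr T u m R'.K_in in \<open>simp_all add: H adjunction_monad_def elem_of_eq fun_eq_iff del: R'.K_in\<close>)
qed

end

section \<open>The accessible distribution monad\<close>

context closed_adjunction
begin

lemma right_par_precompose:
  assumes "src L h = E" "tgt L h = E'" "src L f = E' \<otimes>\<^bsub>L\<^esub> fob F Z"
  shows "right_par E' Z E'' f \<cdot>\<^bsub>X\<^esub> (far G h \<odot>\<^bsub>X\<^esub> idn X Z) = right_par E Z E'' (f \<cdot>\<^bsub>L\<^esub> (h \<odot>\<^bsub>L\<^esub> idn L (fob F Z)))"
proof -
  have "right_par E' Z E'' f \<cdot>\<^bsub>X\<^esub> (far G h \<odot>\<^bsub>X\<^esub> idn X Z)
    = far G f \<cdot>\<^bsub>X\<^esub> ((phi2 G E' (fob F Z) \<cdot>\<^bsub>X\<^esub> (far G h \<odot>\<^bsub>X\<^esub> idn X (fob G (fob F Z)))) \<cdot>\<^bsub>X\<^esub> (idn X (fob G E) \<odot>\<^bsub>X\<^esub> \<eta> Z))"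
    using assms by (simp add: right_par_def)
  then show ?thesis using assms by (simp add: right_par_def G.phi2_nat_left)
qed

lemma right_par_postcompose:
  "\<lbrakk>src L f = E \<otimes>\<^bsub>L\<^esub> fob F Z; tgt L f = src L g\<rbrakk> \<Longrightarrow> far G g \<cdot>\<^bsub>X\<^esub> right_par E Z E' f = right_par E Z E'' (g \<cdot>\<^bsub>L\<^esub> f)"
  by (simp add: right_par_def)

text \<open>The unit inside \<open>right_par\<close> cancels a counit on the parameter. In the
  commutativity proof this is where the structure morphism of G appears.\<close>

lemma right_par_counit:
  assumes "src L f = E \<otimes>\<^bsub>L\<^esub> E'"
  shows "right_par E (fob G E') E'' (f \<cdot>\<^bsub>L\<^esub> (idn L E \<odot>\<^bsub>L\<^esub> \<epsilon> E')) = far G f \<cdot>\<^bsub>X\<^esub> phi2 G E E'"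
  using assms by (simp add: right_par_tar)

end

text \<open>From here on functional completeness is replaced by an arbitrary tensor-stable
  reflection e, together with the facts about H that \<open>functional_completion_monad\<close>
  supplies.\<close>

locale reflective_adjunction =
  closed_adjunction X L F G \<eta> \<epsilon> + R: tensor_reflection L P K e
  for X :: "('x, 'a, 'm) csmcat_scheme" and L :: "('l, 'b, 'n) csmcat_scheme"
    and F :: "('x, 'a, 'l, 'b) smfun" and G :: "('l, 'b, 'x, 'a) smfun"
    and \<eta> :: "'x \<Rightarrow> 'a" and \<epsilon> :: "'l \<Rightarrow> 'b"
    and P :: "'l set" and K :: "'l \<Rightarrow> 'l" and e :: "'l \<Rightarrow> 'b" +
  fixes H :: "('l, 'b) vmonad" and m :: "'l \<Rightarrow> 'b"
  assumes vfob_H [simp]: "vfob (mfun H) = K"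
    and H_functor: "enriched_functor L (self_enriched L) (self_enriched L) (mfun H)"
    and munit_H: "munit H a = elem_of L (e a)" and mmult_H: "mmult H a = elem_of L (m a)"
    and src_m [simp]: "src L (m a) = K (K a)" and tgt_m [simp]: "tgt L (m a) = K a"
    and m_e: "m a \<cdot>\<^bsub>L\<^esub> e (K a) = idn L (K a)"
    and H_hat_e: "L.self.hat (K a) (K b) (vfar (mfun H) a b) \<cdot>\<^bsub>L\<^esub> (e a \<odot>\<^bsub>L\<^esub> idn L (ihom L a b)) = e b \<cdot>\<^bsub>L\<^esub> ev L a b"
begin

lemma src_vfar_H [simp]: "src L (vfar (mfun H) a b) = ihom L a b"
  and tgt_vfar_H [simp]: "tgt L (vfar (mfun H) a b) = ihom L (K a) (K b)"
  using enriched_functor.vfar_in_hom[OF H_functor, of a b] by (simp_all add: in_hom_def)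

lemma H_hat: "L.self.hat (K a) (K b) (vfar (mfun H) a b) = R.ext a (ihom L a b) (K b) (e b \<cdot>\<^bsub>L\<^esub> ev L a b)"
  by (rule R.ext_eqI[symmetric]) (simp_all add: H_hat_e)

abbreviation "BH \<equiv> base_fun G (mfun H)"

lemma base_fun_simps [simp]: "vfob BH = K" "vfar BH a b = far G (vfar (mfun H) a b)"
  by (simp_all add: base_fun_def)

text \<open>On arrows a \<otimes> F Z \<rightarrow> b the change of base of H acts as H does with
  parameter F Z: transposing across the adjunction turns G of the strength of H into the strength
  itself.\<close>

lemma base_H_hat:
  assumes "tgt X x = fob G (ihom L a b)" "src X x = Z"
  shows "base.hat (K a) (K b) (far G (vfar (mfun H) a b) \<cdot>\<^bsub>X\<^esub> x)
    = R.ext a (fob F Z) (K b) (e b \<cdot>\<^bsub>L\<^esub> base.hat a b x)"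
proof -
  let ?y = "\<epsilon> (ihom L a b) \<cdot>\<^bsub>L\<^esub> far F x"
  have "base.hat (K a) (K b) (far G (vfar (mfun H) a b) \<cdot>\<^bsub>X\<^esub> x) = L.self.hat (K a) (K b) (vfar (mfun H) a b \<cdot>\<^bsub>L\<^esub> ?y)"
    using assms by (simp add: base_hat L.self_hat counit_nat')
  also have "\<dots> = R.ext a (ihom L a b) (K b) (e b \<cdot>\<^bsub>L\<^esub> ev L a b) \<cdot>\<^bsub>L\<^esub> (idn L (K a) \<odot>\<^bsub>L\<^esub> ?y)"
    using assms by (simp add: L.self.hat_cmp H_hat)
  also have "\<dots> = R.ext a (fob F Z) (K b) (e b \<cdot>\<^bsub>L\<^esub> base.hat a b x)"
    using assms R.ext_nat[of "K b" "e b \<cdot>\<^bsub>L\<^esub> ev L a b" a ?y] by (simp add: base_hat)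
  finally show ?thesis .
qed

text \<open>The underlying functor of H on arrows, recovered from naturality of e.\<close>

definition kmap :: "'b \<Rightarrow> 'b"
  where "kmap f = (THE g. src L g = K (src L f) \<and> tgt L g = K (tgt L f) \<and> g \<cdot>\<^bsub>L\<^esub> e (src L f) = e (tgt L f) \<cdot>\<^bsub>L\<^esub> f)"

lemma kmap_char: "src L (kmap f) = K (src L f) \<and> tgt L (kmap f) = K (tgt L f) \<and> kmap f \<cdot>\<^bsub>L\<^esub> e (src L f) = e (tgt L f) \<cdot>\<^bsub>L\<^esub> f"
  unfolding kmap_def by (rule theI') (use R.e_orth_unit[of "K (tgt L f)" "src L f"] in \<open>simp add: L.orth_def\<close>)

lemma src_kmap [simp]: "src L (kmap f) = K (src L f)" and tgt_kmap [simp]: "tgt L (kmap f) = K (tgt L f)"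
  using kmap_char by blast+

lemma kmap_e: "src L f = a \<Longrightarrow> kmap f \<cdot>\<^bsub>L\<^esub> e a = e (tgt L f) \<cdot>\<^bsub>L\<^esub> f"
  using kmap_char by blast

lemma base_H_elem:
  assumes [simp]: "src L f = a" "tgt L f = b"
  shows "far G (vfar (mfun H) a b) \<cdot>\<^bsub>X\<^esub> base.elem f = base.elem (kmap f)"
proof (rule base.elem_eqI[of _ "K a" "K b"])
  have "R.ext a (fob F \<one>\<^bsub>X\<^esub>) (K b) (e b \<cdot>\<^bsub>L\<^esub> (f \<cdot>\<^bsub>L\<^esub> aun base_action a)) = kmap f \<cdot>\<^bsub>L\<^esub> aun base_action (K a)"
  proof (rule R.ext_eqI)
    have "(kmap f \<cdot>\<^bsub>L\<^esub> aun base_action (K a)) \<cdot>\<^bsub>L\<^esub> (e a \<odot>\<^bsub>L\<^esub> idn L (fob F \<one>\<^bsub>X\<^esub>))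
      = kmap f \<cdot>\<^bsub>L\<^esub> (aun base_action (K a) \<cdot>\<^bsub>L\<^esub> aar base_action (e a) (idn X \<one>\<^bsub>X\<^esub>))"
      by simp
    also have "\<dots> = (kmap f \<cdot>\<^bsub>L\<^esub> e a) \<cdot>\<^bsub>L\<^esub> aun base_action a"
      using base.aun_nat[of "e a"] by (simp del: base_action_simps)
    finally show "(kmap f \<cdot>\<^bsub>L\<^esub> aun base_action (K a)) \<cdot>\<^bsub>L\<^esub> (e a \<odot>\<^bsub>L\<^esub> idn L (fob F \<one>\<^bsub>X\<^esub>))
      = e b \<cdot>\<^bsub>L\<^esub> (f \<cdot>\<^bsub>L\<^esub> aun base_action a)"
      by (simp add: kmap_e)
  qed simp_all
  then show "base.hat (K a) (K b) (far G (vfar (mfun H) a b) \<cdot>\<^bsub>X\<^esub> base.elem f) = kmap f \<cdot>\<^bsub>L\<^esub> aun base_action (K a)"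
    by (simp add: base_H_hat del: base_action_simps)
qed simp_all

lemma K_eqI: "\<lbrakk>src L f = K a; src L g = K a; tgt L f = K b; tgt L g = K b; f \<cdot>\<^bsub>L\<^esub> e a = g \<cdot>\<^bsub>L\<^esub> e a\<rbrakk> \<Longrightarrow> f = g"
  by (rule L.orth_eq[OF R.e_orth_unit[of "K b" a]]) simp_all

lemma K_eqI_par: "\<lbrakk>src L f = K a \<otimes>\<^bsub>L\<^esub> Z; src L g = K a \<otimes>\<^bsub>L\<^esub> Z; tgt L f = K b; tgt L g = K b;
    f \<cdot>\<^bsub>L\<^esub> (e a \<odot>\<^bsub>L\<^esub> idn L Z) = g \<cdot>\<^bsub>L\<^esub> (e a \<odot>\<^bsub>L\<^esub> idn L Z)\<rbrakk> \<Longrightarrow> f = g"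
  by (rule L.orth_eq[OF R.e_orth[of "K b" a Z]]) simp_all

text \<open>The accessible distribution monad, with the explicit \<open>left_functor\<close> for
  \<open>left_vfun\<close> and with H in the role of the functional completion monad.\<close>

definition D :: "('x, 'a) vmonad"
  where "D = transfer_monad X (self_enriched X) base left_functor (right_vfun X L G)
    (unit_elem X \<eta>) (counit_elem X L G \<epsilon>) (base_monad X G H)"

abbreviation "Dob A \<equiv> fob G (K (fob F A))"

definition Dunit :: "'x \<Rightarrow> 'a"
  where "Dunit A = far G (e (fob F A)) \<cdot>\<^bsub>X\<^esub> \<eta> A"

definition kappa :: "'x \<Rightarrow> 'b"
  where "kappa A = m (fob F A) \<cdot>\<^bsub>L\<^esub> kmap (\<epsilon> (K (fob F A)))"

text \<open>The action of HF on parametrised arrows; applying G to it gives \<open>Dpar\<close>, the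
  action of D.\<close>

definition Dext :: "'x \<Rightarrow> 'x \<Rightarrow> 'x \<Rightarrow> 'a \<Rightarrow> 'b"
  where "Dext A Z B f = R.ext (fob F A) (fob F Z) (K (fob F B)) (e (fob F B) \<cdot>\<^bsub>L\<^esub> left_par A Z B f)"

definition Dpar :: "'x \<Rightarrow> 'x \<Rightarrow> 'x \<Rightarrow> 'a \<Rightarrow> 'a"
  where "Dpar A Z B f = right_par (K (fob F A)) Z (K (fob F B)) (Dext A Z B f)"

lemma src_Dunit [simp]: "src X (Dunit A) = A" and tgt_Dunit [simp]: "tgt X (Dunit A) = Dob A"
  by (simp_all add: Dunit_def)

lemma src_kappa [simp]: "src L (kappa A) = K (fob F (Dob A))"
  and tgt_kappa [simp]: "tgt L (kappa A) = K (fob F A)"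
  by (simp_all add: kappa_def)

lemma kappa_e: "kappa A \<cdot>\<^bsub>L\<^esub> e (fob F (Dob A)) = \<epsilon> (K (fob F A))"
  using L.reassoc[OF m_e[of "fob F A"], of "\<epsilon> (K (fob F A))"] by (simp add: kappa_def kmap_e)

lemma kappa_e': "tgt L k = fob F (Dob A) \<Longrightarrow> kappa A \<cdot>\<^bsub>L\<^esub> (e (fob F (Dob A)) \<cdot>\<^bsub>L\<^esub> k) = \<epsilon> (K (fob F A)) \<cdot>\<^bsub>L\<^esub> k"
  using L.reassoc[OF kappa_e] by simp

lemma src_Dext [simp]: "\<lbrakk>src X f = A \<otimes>\<^bsub>X\<^esub> Z; tgt X f = B\<rbrakk> \<Longrightarrow> src L (Dext A Z B f) = K (fob F A) \<otimes>\<^bsub>L\<^esub> fob F Z"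
  and tgt_Dext [simp]: "\<lbrakk>src X f = A \<otimes>\<^bsub>X\<^esub> Z; tgt X f = B\<rbrakk> \<Longrightarrow> tgt L (Dext A Z B f) = K (fob F B)"
  and Dext_e: "\<lbrakk>src X f = A \<otimes>\<^bsub>X\<^esub> Z; tgt X f = B\<rbrakk>
    \<Longrightarrow> Dext A Z B f \<cdot>\<^bsub>L\<^esub> (e (fob F A) \<odot>\<^bsub>L\<^esub> idn L (fob F Z)) = e (fob F B) \<cdot>\<^bsub>L\<^esub> left_par A Z B f"
  by (simp_all add: Dext_def)

lemma src_Dpar [simp]: "\<lbrakk>src X f = A \<otimes>\<^bsub>X\<^esub> Z; tgt X f = B\<rbrakk> \<Longrightarrow> src X (Dpar A Z B f) = Dob A \<otimes>\<^bsub>X\<^esub> Z"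
  and tgt_Dpar [simp]: "\<lbrakk>src X f = A \<otimes>\<^bsub>X\<^esub> Z; tgt X f = B\<rbrakk> \<Longrightarrow> tgt X (Dpar A Z B f) = Dob B"
  by (simp_all add: Dpar_def)

lemma mfun_D: "mfun D = vfun_comp X (right_vfun X L G) (vfun_comp X BH left_functor)"
  by (simp add: D_def transfer_monad_def Let_def base_monad_def)

lemma vfob_D [simp]: "vfob (mfun D) A = Dob A"
  by (simp add: mfun_D)

lemma enriched_functor_D: "enriched_functor X (self_enriched X) (self_enriched X) (mfun D)"
  unfolding mfun_D
  by (intro enriched_functor_comp[OF enriched_functor_comp[OF enriched_functor_left G.enriched_functor_base[OF H_functor]]
      enriched_functor_right])

lemma src_vfar_D [simp]: "src X (vfar (mfun D) A B) = ihom X A B"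
  and tgt_vfar_D [simp]: "tgt X (vfar (mfun D) A B) = ihom X (Dob A) (Dob B)"
  using enriched_functor.vfar_in_hom[OF enriched_functor_D, of A B] by (simp_all add: in_hom_def)

lemma D_hat_cmp:
  assumes "tgt X x = ihom X A B" "src X x = Z"
  shows "X.self.hat (Dob A) (Dob B) (vfar (mfun D) A B \<cdot>\<^bsub>X\<^esub> x) = Dpar A Z B (X.self.hat A B x)"
proof -
  have [simp]: "src X (vfar left_functor A B) = ihom X A B" "tgt X (vfar left_functor A B) = fob G (ihom L (fob F A) (fob F B))"
    "src X (vfar (right_vfun X L G) E E') = fob G (ihom L E E')"
    "tgt X (vfar (right_vfun X L G) E E') = ihom X (fob G E) (fob G E')" for E E'
    using left.src_vfar[of A B] left.tgt_vfar[of A B] right.src_vfar[of E E'] right.tgt_vfar[of E E'] by simp_all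
  show ?thesis
    using assms by (simp add: mfun_D right_hat_cmp base_H_hat left_hat_cmp Dpar_def Dext_def)
qed

lemma D_hat: "X.self.hat (Dob A) (Dob B) (vfar (mfun D) A B) = Dpar A (ihom X A B) B (ev X A B)"
  using D_hat_cmp[of "idn X (ihom X A B)" A B "ihom X A B"] by simp

lemma D_elem:
  assumes [simp]: "src X f = A" "tgt X f = B"
  shows "vfar (mfun D) A B \<cdot>\<^bsub>X\<^esub> X.self.elem f = X.self.elem (far G (kmap (far F f)))"
proof -
  have [simp]: "src X (vfar left_functor A B) = ihom X A B" "tgt X (vfar left_functor A B) = fob G (ihom L (fob F A) (fob F B))"
    "src X (vfar (right_vfun X L G) E E') = fob G (ihom L E E')"
    "tgt X (vfar (right_vfun X L G) E E') = ihom X (fob G E) (fob G E')" for E E'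
    using left.src_vfar[of A B] left.tgt_vfar[of A B] right.src_vfar[of E E'] right.tgt_vfar[of E E'] by simp_all
  show ?thesis by (simp add: mfun_D left_vfar_elem base_H_elem right_vfar_elem)
qed

lemma munit_D: "munit D A = X.self.elem (Dunit A)"
  by (simp add: D_def transfer_monad_def Let_def base_monad_def vtrans_comp_def whisker_post_def whisker_pre_def
      munit_H base_elem_eq unit_elem_def X.elem_of_eq right_vfar_elem X.self.elem_cmp_elem Dunit_def)

lemma mmult_D: "mmult D A = X.self.elem (far G (kappa A))"
proof -
  have [simp]: "src X (vfar (right_vfun X L G) E E') = fob G (ihom L E E')" for E E'
    using right.src_vfar[of E E'] by simp
  show ?thesis
    by (simp add: D_def transfer_monad_def Let_def base_monad_def vtrans_comp_def whisker_post_def whisker_pre_def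
        mmult_H base_elem_eq counit_elem_def base_H_elem right_vfar_elem X.self.elem_cmp_elem kappa_def)
qed

lemma Dunit_natural:
  assumes [simp]: "src X f = A \<otimes>\<^bsub>X\<^esub> Z" "tgt X f = B"
  shows "Dpar A Z B f \<cdot>\<^bsub>X\<^esub> (Dunit A \<odot>\<^bsub>X\<^esub> idn X Z) = Dunit B \<cdot>\<^bsub>X\<^esub> f"
proof -
  have "Dpar A Z B f \<cdot>\<^bsub>X\<^esub> (Dunit A \<odot>\<^bsub>X\<^esub> idn X Z)
    = (Dpar A Z B f \<cdot>\<^bsub>X\<^esub> (far G (e (fob F A)) \<odot>\<^bsub>X\<^esub> idn X Z)) \<cdot>\<^bsub>X\<^esub> (\<eta> A \<odot>\<^bsub>X\<^esub> idn X Z)"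
    by (simp add: Dunit_def)
  also have "Dpar A Z B f \<cdot>\<^bsub>X\<^esub> (far G (e (fob F A)) \<odot>\<^bsub>X\<^esub> idn X Z)
    = right_par (fob F A) Z (K (fob F B)) (e (fob F B) \<cdot>\<^bsub>L\<^esub> left_par A Z B f)"
    unfolding Dpar_def by (subst right_par_precompose) (simp_all add: Dext_e)
  also have "\<dots> = far G (e (fob F B)) \<cdot>\<^bsub>X\<^esub> right_par (fob F A) Z (fob F B) (left_par A Z B f)"
    by (rule right_par_postcompose[symmetric]) simp_all
  finally show ?thesis by (simp add: unit_left_par Dunit_def)
qed

lemma counit_left_Dpar:
  assumes "src X f = A \<otimes>\<^bsub>X\<^esub> Z" "tgt X f = B"
  shows "\<epsilon> (K (fob F B)) \<cdot>\<^bsub>L\<^esub> left_par (Dob A) Z (Dob B) (Dpar A Z B f) = Dext A Z B f \<cdot>\<^bsub>L\<^esub> (\<epsilon> (K (fob F A)) \<odot>\<^bsub>L\<^esub> idn L (fob F Z))"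
  unfolding Dpar_def by (rule counit_right_par) (use assms in simp_all)

text \<open>The equation already holds in L before G is applied. There both sides may be restricted
  along e, which turns kappa into the counit and leaves its naturality.\<close>

lemma Dmult_natural:
  assumes [simp]: "src X f = A \<otimes>\<^bsub>X\<^esub> Z" "tgt X f = B"
  shows "Dpar A Z B f \<cdot>\<^bsub>X\<^esub> (far G (kappa A) \<odot>\<^bsub>X\<^esub> idn X Z)
    = far G (kappa B) \<cdot>\<^bsub>X\<^esub> Dpar (Dob A) Z (Dob B) (Dpar A Z B f)"
proof -
  let ?Z = "fob F Z"
  have "Dext A Z B f \<cdot>\<^bsub>L\<^esub> (kappa A \<odot>\<^bsub>L\<^esub> idn L ?Z) = kappa B \<cdot>\<^bsub>L\<^esub> Dext (Dob A) Z (Dob B) (Dpar A Z B f)"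
    by (rule K_eqI_par[of _ "fob F (Dob A)" ?Z _ "fob F B"])
      (simp_all add: Dext_e kappa_e kappa_e' counit_left_Dpar)
  then show ?thesis
    unfolding Dpar_def[of "Dob A"] Dpar_def[of A Z B f]
    by (subst right_par_precompose right_par_postcompose; simp add: Dpar_def)+
qed

lemma enriched_monad_D: "enriched_monad X (self_enriched X) D"
proof (rule X.self.enriched_monadI[where e = Dunit and m = "\<lambda>A. far G (kappa A)" and U = "\<lambda>f. far G (kmap (far F f))"], goal_cases)
  \<comment> \<open>Goals 8 and 9 are enriched naturality of the unit and the multiplication; goals
    13 to 15 are the two unit laws and associativity.\<close>
  case (8 a b)
  show ?case by (simp add: D_hat Dunit_natural)
next
  case (9 a b)
  show ?case by (simp add: D_hat D_hat_cmp Dmult_natural)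
next
  case (13 a)
  have "far G (kappa a \<cdot>\<^bsub>L\<^esub> e (fob F (Dob a))) \<cdot>\<^bsub>X\<^esub> \<eta> (Dob a) = idn X (Dob a)"
    unfolding kappa_e by simp
  then show ?case by (simp add: Dunit_def)
next
  case (14 a)
  \<comment> \<open>Restricted along e, the left side becomes \<epsilon> after F of
    \<open>Dunit a\<close>, the transpose of G e \<cdot> \<eta>, which is e again.\<close>
  have "kappa a \<cdot>\<^bsub>L\<^esub> kmap (far F (Dunit a)) = idn L (K (fob F a))"
    by (rule K_eqI[of _ "fob F a" _ "fob F a"]) (simp_all add: kmap_e kappa_e' Dunit_def counit_nat')
  then have "far G (kappa a \<cdot>\<^bsub>L\<^esub> kmap (far F (Dunit a))) = idn X (Dob a)" by simp
  then show ?case by simp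
next
  case (15 a)
  \<comment> \<open>Restricted along e, this is naturality of the counit at kappa.\<close>
  have "kappa a \<cdot>\<^bsub>L\<^esub> kappa (Dob a) = kappa a \<cdot>\<^bsub>L\<^esub> kmap (far F (far G (kappa a)))"
    using counit_nat[of "kappa a"]
    by (intro K_eqI[of "kappa a \<cdot>\<^bsub>L\<^esub> kappa (Dob a)" "fob F (Dob (Dob a))" _ "fob F a"])
      (simp_all add: kmap_e kappa_e kappa_e')
  then have "far G (kappa a \<cdot>\<^bsub>L\<^esub> kappa (Dob a)) = far G (kappa a \<cdot>\<^bsub>L\<^esub> kmap (far F (far G (kappa a))))" by simp
  then show ?case by simp
qed (simp_all add: enriched_functor_D munit_D mmult_D D_elem)

section \<open>Strengths and commutativity\<close>

lemma underlying_D: "underlying_ob D A = Dob A" "underlying_ar X D f = far G (kmap (far F f))"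
  "underlying_mult X D A = far G (kappa A)"
  by (simp_all add: underlying_ob_def underlying_ar_def underlying_mult_def mmult_D X.elem_of_eq D_elem X.arrow_of_elem)

lemma strength'_D: "strength' X D A B = Dpar A B (A \<otimes>\<^bsub>X\<^esub> B) (idn X (A \<otimes>\<^bsub>X\<^esub> B))"
  by (simp add: strength'_def underlying_D X.untranspose_eq X.transpose_eq D_hat_cmp)

lemma strength''_D: "strength'' X D A B = Dpar B A (A \<otimes>\<^bsub>X\<^esub> B) (sym X B A) \<cdot>\<^bsub>X\<^esub> sym X A (Dob B)"
  by (simp add: strength''_def underlying_D X.untranspose_eq X.transpose_eq D_hat_cmp)

text \<open>chi extends ?s in its second variable only. That it also extends the mirror image of ?t
  in the first variable is tested on FA \<otimes> FB, where both restrict to e after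
  \<open>phi2 F\<close>; symmetry of F makes them equal.\<close>

lemma chi_exists:
  obtains chi where "src L chi = K (fob F A) \<otimes>\<^bsub>L\<^esub> K (fob F B)" "tgt L chi = K (fob F (A \<otimes>\<^bsub>X\<^esub> B))"
    and "chi \<cdot>\<^bsub>L\<^esub> (idn L (K (fob F A)) \<odot>\<^bsub>L\<^esub> e (fob F B)) = Dext A B (A \<otimes>\<^bsub>X\<^esub> B) (idn X (A \<otimes>\<^bsub>X\<^esub> B))"
    and "chi \<cdot>\<^bsub>L\<^esub> (e (fob F A) \<odot>\<^bsub>L\<^esub> idn L (K (fob F B))) = Dext B A (A \<otimes>\<^bsub>X\<^esub> B) (sym X B A) \<cdot>\<^bsub>L\<^esub> sym L (fob F A) (K (fob F B))"
proof -
  let ?a = "fob F A" and ?b = "fob F B" and ?c = "fob F (A \<otimes>\<^bsub>X\<^esub> B)"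
  let ?s = "Dext A B (A \<otimes>\<^bsub>X\<^esub> B) (idn X (A \<otimes>\<^bsub>X\<^esub> B))" and ?t = "Dext B A (A \<otimes>\<^bsub>X\<^esub> B) (sym X B A)"
  obtain chi where chi [simp]: "src L chi = K ?a \<otimes>\<^bsub>L\<^esub> K ?b" "tgt L chi = K ?c"
    and s: "chi \<cdot>\<^bsub>L\<^esub> (idn L (K ?a) \<odot>\<^bsub>L\<^esub> e ?b) = ?s"
    using L.orth_factor[OF R.e_orth_left[of "K ?c" "K ?a" ?b], of ?s] by auto
  have "chi \<cdot>\<^bsub>L\<^esub> (e ?a \<odot>\<^bsub>L\<^esub> idn L (K ?b)) = ?t \<cdot>\<^bsub>L\<^esub> sym L ?a (K ?b)"
  proof (rule L.orth_eq[OF R.e_orth_left[of "K ?c" ?a ?b]])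
    have "(chi \<cdot>\<^bsub>L\<^esub> (e ?a \<odot>\<^bsub>L\<^esub> idn L (K ?b))) \<cdot>\<^bsub>L\<^esub> (idn L ?a \<odot>\<^bsub>L\<^esub> e ?b)
      = (chi \<cdot>\<^bsub>L\<^esub> (idn L (K ?a) \<odot>\<^bsub>L\<^esub> e ?b)) \<cdot>\<^bsub>L\<^esub> (e ?a \<odot>\<^bsub>L\<^esub> idn L ?b)"
      by simp
    also have "\<dots> = e ?c \<cdot>\<^bsub>L\<^esub> phi2 F A B"
      unfolding s by (simp add: Dext_e left_par_def)
    also have "phi2 F A B = (far F (sym X B A) \<cdot>\<^bsub>L\<^esub> phi2 F B A) \<cdot>\<^bsub>L\<^esub> sym L ?a ?b"
      unfolding F.phi_sym by simp
    also have "e ?c \<cdot>\<^bsub>L\<^esub> \<dots> = (?t \<cdot>\<^bsub>L\<^esub> (e ?b \<odot>\<^bsub>L\<^esub> idn L ?a)) \<cdot>\<^bsub>L\<^esub> sym L ?a ?b"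
      by (simp add: Dext_e left_par_def)
    also have "\<dots> = (?t \<cdot>\<^bsub>L\<^esub> sym L ?a (K ?b)) \<cdot>\<^bsub>L\<^esub> (idn L ?a \<odot>\<^bsub>L\<^esub> e ?b)"
      by (simp add: L.sym_nat)
    finally show "(chi \<cdot>\<^bsub>L\<^esub> (e ?a \<odot>\<^bsub>L\<^esub> idn L (K ?b))) \<cdot>\<^bsub>L\<^esub> (idn L ?a \<odot>\<^bsub>L\<^esub> e ?b)
      = (?t \<cdot>\<^bsub>L\<^esub> sym L ?a (K ?b)) \<cdot>\<^bsub>L\<^esub> (idn L ?a \<odot>\<^bsub>L\<^esub> e ?b)" .
  qed simp_all
  then show thesis by (rule that[OF chi s])
qed

text \<open>Each composite is \<open>right_par\<close> of an arrow ?h \<cdot> ?u, up to symmetry,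
  whose parameter is the D-object handled by the second step. Restriction along e in the other
  variable turns kappa into the counit and leaves one of the two partial forms of chi, so ?h \<cdot>
  ?u is chi with the counit on the parameter, again up to symmetry. Applying G to it yields the same
  arrow both times.\<close>

lemma commutative_D: "commutative_vmonad X D"
  unfolding commutative_vmonad_def underlying_D
proof (intro conjI allI enriched_monad_D)
  fix A B
  let ?a = "fob F A" and ?b = "fob F B" and ?c = "fob F (A \<otimes>\<^bsub>X\<^esub> B)"
  let ?s = "Dext A B (A \<otimes>\<^bsub>X\<^esub> B) (idn X (A \<otimes>\<^bsub>X\<^esub> B))" and ?t = "Dext B A (A \<otimes>\<^bsub>X\<^esub> B) (sym X B A)"
  let ?k = "kappa (A \<otimes>\<^bsub>X\<^esub> B)"
  obtain chi where [simp]: "src L chi = K ?a \<otimes>\<^bsub>L\<^esub> K ?b" "tgt L chi = K ?c"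
    and s: "chi \<cdot>\<^bsub>L\<^esub> (idn L (K ?a) \<odot>\<^bsub>L\<^esub> e ?b) = ?s"
    and t: "chi \<cdot>\<^bsub>L\<^esub> (e ?a \<odot>\<^bsub>L\<^esub> idn L (K ?b)) = ?t \<cdot>\<^bsub>L\<^esub> sym L ?a (K ?b)"
    using chi_exists .
  have left: "far G ?k \<cdot>\<^bsub>X\<^esub> far G (kmap (far F (strength' X D A B))) \<cdot>\<^bsub>X\<^esub> strength'' X D (Dob A) B
    = far G chi \<cdot>\<^bsub>X\<^esub> phi2 G (K ?a) (K ?b)"
  proof -
    let ?f = "Dpar A B (A \<otimes>\<^bsub>X\<^esub> B) (idn X (A \<otimes>\<^bsub>X\<^esub> B))"
    let ?h = "?k \<cdot>\<^bsub>L\<^esub> kmap (far F ?f)"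
    let ?u = "Dext B (Dob A) (Dob A \<otimes>\<^bsub>X\<^esub> B) (sym X B (Dob A))"
    have h: "?h \<cdot>\<^bsub>L\<^esub> e (fob F (Dob A \<otimes>\<^bsub>X\<^esub> B)) = \<epsilon> (K ?c) \<cdot>\<^bsub>L\<^esub> far F ?f"
      by (simp add: kmap_e kappa_e')
    have "?h \<cdot>\<^bsub>L\<^esub> ?u = (chi \<cdot>\<^bsub>L\<^esub> sym L (K ?b) (K ?a)) \<cdot>\<^bsub>L\<^esub> (idn L (K ?b) \<odot>\<^bsub>L\<^esub> \<epsilon> (K ?a))"
    proof (rule K_eqI_par[of _ ?b "fob F (Dob A)" _ ?c])
      have "(?h \<cdot>\<^bsub>L\<^esub> ?u) \<cdot>\<^bsub>L\<^esub> (e ?b \<odot>\<^bsub>L\<^esub> idn L (fob F (Dob A)))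
        = (?h \<cdot>\<^bsub>L\<^esub> e (fob F (Dob A \<otimes>\<^bsub>X\<^esub> B))) \<cdot>\<^bsub>L\<^esub> (far F (sym X B (Dob A)) \<cdot>\<^bsub>L\<^esub> phi2 F B (Dob A))"
        by (simp add: Dext_e left_par_def del: F.phi_sym)
      also have "\<dots> = (\<epsilon> (K ?c) \<cdot>\<^bsub>L\<^esub> left_par (Dob A) B (Dob (A \<otimes>\<^bsub>X\<^esub> B)) ?f) \<cdot>\<^bsub>L\<^esub> sym L ?b (fob F (Dob A))"
        unfolding h F.phi_sym by (simp add: left_par_def)
      also have "\<dots> = (?s \<cdot>\<^bsub>L\<^esub> (\<epsilon> (K ?a) \<odot>\<^bsub>L\<^esub> idn L ?b)) \<cdot>\<^bsub>L\<^esub> sym L ?b (fob F (Dob A))"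
        by (simp add: counit_left_Dpar)
      also have "\<dots> = ((chi \<cdot>\<^bsub>L\<^esub> sym L (K ?b) (K ?a)) \<cdot>\<^bsub>L\<^esub> (idn L (K ?b) \<odot>\<^bsub>L\<^esub> \<epsilon> (K ?a))) \<cdot>\<^bsub>L\<^esub> (e ?b \<odot>\<^bsub>L\<^esub> idn L (fob F (Dob A)))"
        unfolding s[symmetric] by (simp add: L.sym_nat)
      finally show "(?h \<cdot>\<^bsub>L\<^esub> ?u) \<cdot>\<^bsub>L\<^esub> (e ?b \<odot>\<^bsub>L\<^esub> idn L (fob F (Dob A)))
        = ((chi \<cdot>\<^bsub>L\<^esub> sym L (K ?b) (K ?a)) \<cdot>\<^bsub>L\<^esub> (idn L (K ?b) \<odot>\<^bsub>L\<^esub> \<epsilon> (K ?a))) \<cdot>\<^bsub>L\<^esub> (e ?b \<odot>\<^bsub>L\<^esub> idn L (fob F (Dob A)))" .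
    qed simp_all
    then have "far G ?h \<cdot>\<^bsub>X\<^esub> Dpar B (Dob A) (Dob A \<otimes>\<^bsub>X\<^esub> B) (sym X B (Dob A))
      = right_par (K ?b) (Dob A) (K ?c) ((chi \<cdot>\<^bsub>L\<^esub> sym L (K ?b) (K ?a)) \<cdot>\<^bsub>L\<^esub> (idn L (K ?b) \<odot>\<^bsub>L\<^esub> \<epsilon> (K ?a)))"
      unfolding Dpar_def[of B] by (subst right_par_postcompose[where E'' = "K ?c"]) simp_all
    also have "\<dots> = far G chi \<cdot>\<^bsub>X\<^esub> (far G (sym L (K ?b) (K ?a)) \<cdot>\<^bsub>X\<^esub> phi2 G (K ?b) (K ?a))"
      by (subst right_par_counit) simp_all
    finally have "far G ?h \<cdot>\<^bsub>X\<^esub> Dpar B (Dob A) (Dob A \<otimes>\<^bsub>X\<^esub> B) (sym X B (Dob A))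
      = far G chi \<cdot>\<^bsub>X\<^esub> (phi2 G (K ?a) (K ?b) \<cdot>\<^bsub>X\<^esub> sym X (Dob B) (Dob A))"
      unfolding G.phi_sym .
    \<comment> \<open>The symmetry produced by \<open>phi_sym\<close> for G cancels the one in the
      definition of \<open>strength''\<close>.\<close>
    then have "(far G ?h \<cdot>\<^bsub>X\<^esub> Dpar B (Dob A) (Dob A \<otimes>\<^bsub>X\<^esub> B) (sym X B (Dob A))) \<cdot>\<^bsub>X\<^esub> sym X (Dob A) (Dob B)
      = far G chi \<cdot>\<^bsub>X\<^esub> phi2 G (K ?a) (K ?b)"
      by simp
    then show ?thesis by (simp add: strength'_D strength''_D)
  qed
  have right: "far G ?k \<cdot>\<^bsub>X\<^esub> far G (kmap (far F (strength'' X D A B))) \<cdot>\<^bsub>X\<^esub> strength' X D A (Dob B)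
    = far G chi \<cdot>\<^bsub>X\<^esub> phi2 G (K ?a) (K ?b)"
  proof -
    let ?f = "Dpar B A (A \<otimes>\<^bsub>X\<^esub> B) (sym X B A)"
    let ?h = "?k \<cdot>\<^bsub>L\<^esub> kmap (far F (?f \<cdot>\<^bsub>X\<^esub> sym X A (Dob B)))"
    let ?u = "Dext A (Dob B) (A \<otimes>\<^bsub>X\<^esub> Dob B) (idn X (A \<otimes>\<^bsub>X\<^esub> Dob B))"
    have h: "?h \<cdot>\<^bsub>L\<^esub> e (fob F (A \<otimes>\<^bsub>X\<^esub> Dob B)) = \<epsilon> (K ?c) \<cdot>\<^bsub>L\<^esub> far F ?f \<cdot>\<^bsub>L\<^esub> far F (sym X A (Dob B))"
      by (simp add: kmap_e kappa_e')
    have "?h \<cdot>\<^bsub>L\<^esub> ?u = chi \<cdot>\<^bsub>L\<^esub> (idn L (K ?a) \<odot>\<^bsub>L\<^esub> \<epsilon> (K ?b))"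
    proof (rule K_eqI_par[of _ ?a "fob F (Dob B)" _ ?c])
      have "(?h \<cdot>\<^bsub>L\<^esub> ?u) \<cdot>\<^bsub>L\<^esub> (e ?a \<odot>\<^bsub>L\<^esub> idn L (fob F (Dob B)))
        = (?h \<cdot>\<^bsub>L\<^esub> e (fob F (A \<otimes>\<^bsub>X\<^esub> Dob B))) \<cdot>\<^bsub>L\<^esub> phi2 F A (Dob B)"
        by (simp add: Dext_e left_par_def)
      also have "\<dots> = (\<epsilon> (K ?c) \<cdot>\<^bsub>L\<^esub> far F ?f) \<cdot>\<^bsub>L\<^esub> (far F (sym X A (Dob B)) \<cdot>\<^bsub>L\<^esub> phi2 F A (Dob B))"
        unfolding h by simp
      also have "\<dots> = (\<epsilon> (K ?c) \<cdot>\<^bsub>L\<^esub> left_par (Dob B) A (Dob (A \<otimes>\<^bsub>X\<^esub> B)) ?f) \<cdot>\<^bsub>L\<^esub> sym L ?a (fob F (Dob B))"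
        unfolding F.phi_sym by (simp add: left_par_def)
      also have "\<dots> = ?t \<cdot>\<^bsub>L\<^esub> ((\<epsilon> (K ?b) \<odot>\<^bsub>L\<^esub> idn L ?a) \<cdot>\<^bsub>L\<^esub> sym L ?a (fob F (Dob B)))"
        by (simp add: counit_left_Dpar)
      also have "\<dots> = (?t \<cdot>\<^bsub>L\<^esub> sym L ?a (K ?b)) \<cdot>\<^bsub>L\<^esub> (idn L ?a \<odot>\<^bsub>L\<^esub> \<epsilon> (K ?b))"
        by (simp add: L.sym_nat)
      also have "\<dots> = (chi \<cdot>\<^bsub>L\<^esub> (idn L (K ?a) \<odot>\<^bsub>L\<^esub> \<epsilon> (K ?b))) \<cdot>\<^bsub>L\<^esub> (e ?a \<odot>\<^bsub>L\<^esub> idn L (fob F (Dob B)))"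
        unfolding t[symmetric] by simp
      finally show "(?h \<cdot>\<^bsub>L\<^esub> ?u) \<cdot>\<^bsub>L\<^esub> (e ?a \<odot>\<^bsub>L\<^esub> idn L (fob F (Dob B)))
        = (chi \<cdot>\<^bsub>L\<^esub> (idn L (K ?a) \<odot>\<^bsub>L\<^esub> \<epsilon> (K ?b))) \<cdot>\<^bsub>L\<^esub> (e ?a \<odot>\<^bsub>L\<^esub> idn L (fob F (Dob B)))" .
    qed simp_all
    then have "far G ?h \<cdot>\<^bsub>X\<^esub> Dpar A (Dob B) (A \<otimes>\<^bsub>X\<^esub> Dob B) (idn X (A \<otimes>\<^bsub>X\<^esub> Dob B))
      = right_par (K ?a) (Dob B) (K ?c) (chi \<cdot>\<^bsub>L\<^esub> (idn L (K ?a) \<odot>\<^bsub>L\<^esub> \<epsilon> (K ?b)))"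
      unfolding Dpar_def[of A] by (subst right_par_postcompose[where E'' = "K ?c"]) simp_all
    also have "\<dots> = far G chi \<cdot>\<^bsub>X\<^esub> phi2 G (K ?a) (K ?b)"
      by (subst right_par_counit) simp_all
    finally show ?thesis by (simp add: strength'_D strength''_D)
  qed
  show "far G ?k \<cdot>\<^bsub>X\<^esub> far G (kmap (far F (strength' X D A B))) \<cdot>\<^bsub>X\<^esub> strength'' X D (Dob A) B
    = far G ?k \<cdot>\<^bsub>X\<^esub> far G (kmap (far F (strength'' X D A B))) \<cdot>\<^bsub>X\<^esub> strength' X D A (Dob B)"
    unfolding left right ..
qed

end

theorem proposition7p6p1:
  fixes X :: "('x, 'a) csmcat" and L :: "('l, 'b) csmcat"
    and F :: "('x, 'a, 'l, 'b) smfun" and G :: "('l, 'b, 'x, 'a) smfun"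
    and \<eta> :: "'x \<Rightarrow> 'a" and \<epsilon> :: "'l \<Rightarrow> 'b"
  assumes "closed_symmetric_monoidal_category X"
    and "closed_symmetric_monoidal_category L"
    and "symmetric_monoidal_adjunction X L F G \<eta> \<epsilon>"
    and "finitely_well_complete L"
  shows "commutative_vmonad X (accessible_distribution_monad X L F G \<eta> \<epsilon>)"
proof -
  interpret closed_adjunction X L F G \<eta> \<epsilon>
    using assms(1-3) by (rule closed_adjunction.intro)
  let ?H = "functional_completion_monad L"
  obtain K e m where Kr: "tensor_reflection L {E. functionally_complete L E} K e" and H: "vfob (mfun ?H) = K"
    "enriched_functor L (self_enriched L) (self_enriched L) (mfun ?H)"
    "\<And>a. munit ?H a = elem_of L (e a)" "\<And>a. mmult ?H a = elem_of L (m a)"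
    "\<And>a. src L (m a) = K (K a)" "\<And>a. tgt L (m a) = K a" "\<And>a. m a \<cdot>\<^bsub>L\<^esub> e (K a) = idn L (K a)"
    "\<And>a b. L.self.hat (K a) (K b) (vfar (mfun ?H) a b) \<cdot>\<^bsub>L\<^esub> (e a \<odot>\<^bsub>L\<^esub> idn L (ihom L a b)) = e b \<cdot>\<^bsub>L\<^esub> ev L a b"
    by (rule L.functional_completion_monad[OF assms(4)]) (rule that)
  interpret reflective_adjunction X L F G \<eta> \<epsilon> "{E. functionally_complete L E}" K e ?H m
    by (intro reflective_adjunction.intro closed_adjunction_axioms Kr reflective_adjunction_axioms.intro H)
  have "accessible_distribution_monad X L F G \<eta> \<epsilon> = D"
    by (simp add: accessible_distribution_monad_def D_def left_vfun_eq)
  then show ?thesis using commutative_D by simp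
qed

end
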